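(* For each $\mathbb{K}\in\{\mathbb{R},\mathbb{C},\mathbb{H}\}$, usual stochastic domination between $\Delta_3^{\mathbb{K}}$ and $X_3^{\mathbb{K}}$ fails in both directions, i.e. neither $\Delta_3^{\mathbb{K}}\le_{\mathrm{st}}X_3^{\mathbb{K}}$ nor $X_3^{\mathbb{K}}\le_{\mathrm{st}}\Delta_3^{\mathbb{K}}$ holds; moreover the convex-order comparison $X_3^{\mathbb{K}}\le_{\mathrm{cx}}\Delta_3^{\mathbb{K}}$ does not hold.
   Context: $\mathbb{H}$ denotes the quaternions, $\beta=\dim_{\mathbb{R}}\mathbb{K}$. $G_n^{\mathbb{K}}$ is an $n\times n$ matrix with i.i.d. standard $\mathbb{K}$-Gaussian entries (each entry has independent $N(0,1/\beta)$ real coordinates). The row-ordered permanent is $\mathrm{per}_{\mathbb{K}}A=\sum_{\sigma\in S_n}a_{1,\sigma(1)}a_{2,\sigma(2)}\cdots a_{n,\sigma(n)}$. $X_n^{\mathbb{K}}=|\mathrm{per}_{\mathbb{K}}G_n^{\mathbb{K}}|^2/n!$; $\Delta_n^{\mathbb{K}}=|\det G_n^{\mathbb{K}}|^2/n!$ for $\mathbb{K}\in\{\mathbb{R},\mathbb{C}\}$, and $\Delta_n^{\mathbb{H}}=\mathrm{Sdet}(G_n^{\mathbb{H}})^2/n!$, where $\mathrm{Sdet}A=\prod_j\sigma_j(A)$ is the product of the quaternionic singular values of $A$ (the nonnegative reals in $A=U\,\mathrm{diag}(\sigma_1(A),\dots,\sigma_n(A))V^*$ with $U,V$ quaternionic unitary).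 For random variables $U,V$: $U\le_{\mathrm{st}}V$ means $\mathbb{P}(U>t)\le\mathbb{P}(V>t)$ for every $t$; for integrable $U,V$, $U\le_{\mathrm{cx}}V$ means $\mathbb{E}f(U)\le\mathbb{E}f(V)$ for every convex $f:\mathbb{R}\to\mathbb{R}$ for which the expectations exist. *)

theory Defs
  imports
    "HOL-Probability.Probability"
    "Jordan_Normal_Form.Determinant"
begin

section \<open>Quaternions\<close>

datatype quat = Quat (qRe: real) (qI: real) (qJ: real) (qK: real)

lemma quat_eq_iff: "x = y \<longleftrightarrow> qRe x = qRe y \<and> qI x = qI y \<and> qJ x = qJ y \<and> qK x = qK y"
  by (cases x; cases y) auto

instantiation quat :: "{zero, one, plus, minus, uminus, times, scaleR}"
begin

definition "0 = Quat 0 0 0 0"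
definition "1 = Quat 1 0 0 0"
definition "x + y = Quat (qRe x + qRe y) (qI x + qI y) (qJ x + qJ y) (qK x + qK y)"
definition "x - y = Quat (qRe x - qRe y) (qI x - qI y) (qJ x - qJ y) (qK x - qK y)"
definition "- x = Quat (- qRe x) (- qI x) (- qJ x) (- qK x)"
definition "r *\<^sub>R x = Quat (r * qRe x) (r * qI x) (r * qJ x) (r * qK x)"

definition "x * y = Quat
  (qRe x * qRe y - qI x * qI y - qJ x * qJ y - qK x * qK y)
  (qRe x * qI y + qI x * qRe y + qJ x * qK y - qK x * qJ y)
  (qRe x * qJ y - qI x * qK y + qJ x * qRe y + qK x * qI y)
  (qRe x * qK y + qI x * qJ y - qJ x * qI y + qK x * qRe y)"

instance ..

end

lemmas quat_op_defs = zero_quat_def one_quat_def plus_quat_def minus_quat_def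
  uminus_quat_def scaleR_quat_def times_quat_def

instance quat :: real_algebra_1
  by standard (simp_all add: quat_eq_iff quat_op_defs algebra_simps)

instantiation quat :: real_inner
begin

definition "inner x y = qRe x * qRe y + qI x * qI y + qJ x * qJ y + qK x * qK y"
definition "norm (x :: quat) = sqrt (inner x x)"
definition "sgn (x :: quat) = x /\<^sub>R norm x"
definition "dist (x :: quat) y = norm (x - y)"
definition "uniformity = (INF e\<in>{0 <..}. principal {(x :: quat, y). dist x y < e})"
definition "open (U :: quat set) \<longleftrightarrow> (\<forall>x\<in>U. \<forall>\<^sub>F (x', y) in uniformity. x' = x \<longrightarrow> y \<in> U)"

instance
proof
  fix x y z :: quat and r :: real and U :: "quat set"
  show "inner x y = inner y x"
    by (simp add: inner_quat_def mult.commute)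
  show "inner (x + y) z = inner x z + inner y z"
    by (simp add: inner_quat_def plus_quat_def distrib_right)
  show "inner (r *\<^sub>R x) y = r * inner x y"
    by (simp add: inner_quat_def scaleR_quat_def distrib_left)
  show "0 \<le> inner x x"
    by (simp add: inner_quat_def)
  show "inner x x = 0 \<longleftrightarrow> x = 0"
    by (simp add: inner_quat_def quat_eq_iff zero_quat_def add_nonneg_eq_0_iff)
  show "norm x = sqrt (inner x x)"
    by (rule norm_quat_def)
  show "sgn x = x /\<^sub>R norm x"
    by (rule sgn_quat_def)
  show "dist x y = norm (x - y)"
    by (rule dist_quat_def)
  show "(uniformity :: (quat \<times> quat) filter) = (INF e\<in>{0 <..}. principal {(x, y). dist x y < e})"
    by (rule uniformity_quat_def)
  show "open U \<longleftrightarrow> (\<forall>x\<in>U. \<forall>\<^sub>F (x', y) in uniformity. x' = x \<longrightarrow> y \<in> U)"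
    by (rule open_quat_def)
qed

end

instantiation quat :: euclidean_space
begin

definition "Basis = {Quat 1 0 0 0, Quat 0 1 0 0, Quat 0 0 1 0, Quat 0 0 0 1}"

instance
proof
  fix u v x :: quat
  show "(Basis :: quat set) \<noteq> {}" "finite (Basis :: quat set)"
    by (simp_all add: Basis_quat_def)
  show "inner u v = (if u = v then 1 else 0)" if "u \<in> Basis" "v \<in> Basis"
    using that unfolding Basis_quat_def by (elim insertE emptyE) (simp_all add: inner_quat_def)
  show "(\<forall>u\<in>Basis. inner x u = 0) \<longleftrightarrow> x = 0"
    by (cases x) (simp add: Basis_quat_def inner_quat_def zero_quat_def)
qed

end

lemma DIM_quat [simp]: "DIM(quat) = 4"
  by (simp add: Basis_quat_def)

definition qcnj :: "quat \<Rightarrow> quat" where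
  "qcnj x = Quat (qRe x) (- qI x) (- qJ x) (- qK x)"

section \<open>Permanent and quaternionic singular values\<close>

text \<open>The factors are multiplied in the order of the rows.\<close>

definition per :: "'a::semiring_1 mat \<Rightarrow> 'a" where
  "per A = (\<Sum>p | p permutes {0..<dim_row A}. prod_list (map (\<lambda>i. A $$ (i, p i)) [0..<dim_row A]))"

definition qadjoint :: "quat mat \<Rightarrow> quat mat" where
  "qadjoint A = Matrix.mat (dim_col A) (dim_row A) (\<lambda>(i, j). qcnj (A $$ (j, i)))"

definition qunitary :: "nat \<Rightarrow> quat mat \<Rightarrow> bool" where
  "qunitary n U \<longleftrightarrow> U \<in> carrier_mat n n \<and> U * qadjoint U = 1\<^sub>m n \<and> qadjoint U * U = 1\<^sub>m n"

definition quat_svd :: "quat mat \<Rightarrow> quat mat \<Rightarrow> (nat \<Rightarrow> real) \<Rightarrow> quat mat \<Rightarrow> bool" where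
  "quat_svd A U s V \<longleftrightarrow>
     (let n = dim_row A in
        qunitary n U \<and> qunitary n V \<and> (\<forall>j<n. 0 \<le> s j) \<and>
        A = U * mat_diag n (\<lambda>j. of_real (s j)) * qadjoint V)"

text \<open>A quaternionic square matrix has a singular value decomposition and its singular values are
  unique up to order, so the description below has exactly one solution.\<close>

definition Sdet :: "quat mat \<Rightarrow> real" where
  "Sdet A = (THE d. \<exists>U s V. quat_svd A U s V \<and> d = (\<Prod>j<dim_row A. s j))"

section \<open>Gaussian matrices\<close>

text \<open>\<^const>\<open>normal_density\<close> takes the standard deviation, so the variance of each real coordinate
  is \<open>1 / DIM('a)\<close>.\<close>

definition std_gaussian :: "'w measure \<Rightarrow> ('w \<Rightarrow> 'a::euclidean_space) \<Rightarrow> bool" where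
  "std_gaussian M Z \<longleftrightarrow>
     prob_space.indep_vars M (\<lambda>_. borel) (\<lambda>b \<omega>. inner (Z \<omega>) b) Basis \<and>
     (\<forall>b\<in>Basis. distributed M lborel (\<lambda>\<omega>. inner (Z \<omega>) b) (normal_density 0 (1 / sqrt DIM('a))))"

definition gaussian_matrix :: "'w measure \<Rightarrow> nat \<Rightarrow> ('w \<Rightarrow> 'a::euclidean_space mat) \<Rightarrow> bool" where
  "gaussian_matrix M n G \<longleftrightarrow>
     (\<forall>\<omega>\<in>space M. G \<omega> \<in> carrier_mat n n) \<and>
     prob_space.indep_vars M (\<lambda>_. borel) (\<lambda>ij \<omega>. G \<omega> $$ ij) ({0..<n} \<times> {0..<n}) \<and>
     (\<forall>ij\<in>{0..<n} \<times> {0..<n}. std_gaussian M (\<lambda>\<omega>. G \<omega> $$ ij))"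

definition X_var :: "nat \<Rightarrow> ('w \<Rightarrow> 'a::{semiring_1, real_normed_vector} mat) \<Rightarrow> 'w \<Rightarrow> real" where
  "X_var n G \<omega> = (norm (per (G \<omega>)))\<^sup>2 / fact n"

definition Delta_var :: "nat \<Rightarrow> ('w \<Rightarrow> 'a::real_normed_field mat) \<Rightarrow> 'w \<Rightarrow> real" where
  "Delta_var n G \<omega> = (norm (Determinant.det (G \<omega>)))\<^sup>2 / fact n"

definition Delta_var_quat :: "nat \<Rightarrow> ('w \<Rightarrow> quat mat) \<Rightarrow> 'w \<Rightarrow> real" where
  "Delta_var_quat n G \<omega> = (Sdet (G \<omega>))\<^sup>2 / fact n"

section \<open>Stochastic orders\<close>

definition st_le :: "'w measure \<Rightarrow> ('w \<Rightarrow> real) \<Rightarrow> ('w \<Rightarrow> real) \<Rightarrow> bool" where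
  "st_le M U V \<longleftrightarrow>
     (\<forall>t. measure M {\<omega> \<in> space M. U \<omega> > t} \<le> measure M {\<omega> \<in> space M. V \<omega> > t})"

text \<open>Integrability of \<open>U\<close> and \<open>V\<close> is the domain of definition of the order and is deliberately not
  a conjunct, so that the negation of \<open>cx_le\<close> cannot hold for lack of integrability.\<close>

definition cx_le :: "'w measure \<Rightarrow> ('w \<Rightarrow> real) \<Rightarrow> ('w \<Rightarrow> real) \<Rightarrow> bool" where
  "cx_le M U V \<longleftrightarrow>
     (\<forall>f. convex_on UNIV f \<longrightarrow> integrable M (\<lambda>\<omega>. f (U \<omega>)) \<longrightarrow> integrable M (\<lambda>\<omega>. f (V \<omega>)) \<longrightarrow>
        (\<integral>\<omega>. f (U \<omega>) \<partial>M) \<le> (\<integral>\<omega>. f (V \<omega>) \<partial>M))"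

end

theory Submission
  imports Defs
begin

text \<open>
  Write \<open>a\<close>, \<open>b\<close>, \<open>c\<close> for the rows of the Gaussian matrix. In all three cases the permanent and the
  determinant have the same mean square, while the permanent has the strictly larger third moment
  of the squared norm; \<open>third_moment_obstructs_orders\<close> draws all three conclusions from this.
  Indeed, stochastic domination between nonnegative variables with equal means forces equality of
  the laws, and \<open>\<bar>x\<bar>\<^sup>3\<close> is a convex function that violates the convex order.

  The third row is integrated first. The permanent is \<open>\<Sum>\<^sub>k x\<^sub>k c\<^sub>k\<close> with
  \<open>x\<^sub>k = a\<^sub>i b\<^sub>j + a\<^sub>j b\<^sub>i\<close>, and the determinant has the norm of \<open>\<Sum>\<^sub>k c\<^sub>k v\<^sub>k\<close> for a vector \<open>v\<close> with
  \<open>\<bar>v\<bar>\<^sup>2 = \<bar>a\<bar>\<^sup>2 \<bar>b\<bar>\<^sup>2 - \<bar>\<langle>a, b\<rangle>\<bar>\<^sup>2\<close>. By \<open>nn_integral_norm_sum_conformal\<close> the even moments of such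
  sums are universal constants times the powers of \<open>\<bar>x\<bar>\<^sup>2\<close> and \<open>\<bar>v\<bar>\<^sup>2\<close>. It remains to compare
  \<open>\<bar>x\<bar>\<^sup>2 = S + 2 \<Sum> t\<^sub>i\<^sub>j\<close> with \<open>\<bar>v\<bar>\<^sup>2 = S - 2 \<Sum> t'\<^sub>i\<^sub>j\<close>, where \<open>S\<close> collects the products
  \<open>\<bar>a\<^sub>i\<bar>\<^sup>2 \<bar>b\<^sub>j\<bar>\<^sup>2\<close> with \<open>i \<noteq> j\<close>, and \<open>t\<close>, \<open>t'\<close> are inner products.

  The comparison uses only finite symmetries of the Gaussian law. Sign changes of the \<open>a\<^sub>i\<close> leave
  from the cubes the terms \<open>S\<^sup>3\<close>, \<open>S t\<^sub>i\<^sub>j\<^sup>2\<close> and the triangle \<open>t\<^sub>0\<^sub>1 t\<^sub>0\<^sub>2 t\<^sub>1\<^sub>2\<close>. Averaging over left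
  multiplication of one entry by the standard basis of the algebra, which is Parseval's identity,
  shows that \<open>S t\<^sub>i\<^sub>j\<^sup>2\<close> and \<open>S t'\<^sub>i\<^sub>j\<^sup>2\<close> have the same mean, that the triangle of \<open>t\<close> has a nonnegative
  mean and that the triangle of \<open>t'\<close> has a positive one (\<open>integral_perm_minor_vs_gram\<close>). The triangles
  enter with opposite signs, and this is the whole difference.

  Over the quaternions the vector \<open>v\<close> has to be extracted from the product of the singular values.
  A singular value decomposition is obtained by maximising a weighted trace over pairs of unitary
  matrices. The real part of the trace is cyclic, so Newton's identity expresses the squared product of
  the singular values through the traces of powers of the Gram matrix (\<open>gram_det3_eq_prod\<close>); the
  resulting polynomial is a quadratic form of rank one in the third row (\<open>gram_det3_conormal\<close>).
\<close>

no_notation scalar_prod (infix "\<bullet>" 70)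

section \<open>Stochastic orders and third moments\<close>

text \<open>\<open>W (U \<omega>)\<close> is the integral of \<open>w\<close> over \<open>[0, U \<omega>]\<close>, and Tonelli exchanges it with the expectation.\<close>

lemma nn_integral_layer_cake:
  fixes U :: "'w \<Rightarrow> real" and w :: "real \<Rightarrow> real"
  assumes "sigma_finite_measure M" and [measurable]: "U \<in> borel_measurable M" "w \<in> borel_measurable borel"
    and U: "\<And>\<omega>. \<omega> \<in> space M \<Longrightarrow> 0 \<le> U \<omega>"
    and w: "\<And>t. 0 \<le> t \<Longrightarrow> 0 \<le> w t"
    and W: "\<And>t. 0 \<le> t \<Longrightarrow> (W has_real_derivative w t) (at t)" "W 0 = 0"
  shows "(\<integral>\<^sup>+\<omega>. ennreal (W (U \<omega>)) \<partial>M) =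
    (\<integral>\<^sup>+t. ennreal (w t) * indicator {0..} t * emeasure M {\<omega>\<in>space M. U \<omega> > t} \<partial>lborel)"
proof -
  interpret sigma_finite_measure M by fact
  interpret pair_sigma_finite M lborel ..
  have cake: "(\<integral>\<^sup>+t. ennreal (w t) * indicator {0..} t * indicator {\<omega>\<in>space M. U \<omega> > t} \<omega> \<partial>lborel)
      = ennreal (W (U \<omega>))" if "\<omega> \<in> space M" for \<omega>
  proof -
    have "(\<integral>\<^sup>+t. ennreal (w t) * indicator {0..} t * indicator {\<omega>\<in>space M. U \<omega> > t} \<omega> \<partial>lborel)
        = (\<integral>\<^sup>+t. ennreal (w t) * indicator {0..U \<omega>} t \<partial>lborel)"
      using AE_lborel_singleton[of "U \<omega>"] that
      by (intro nn_integral_cong_AE) (auto split: split_indicator elim!: eventually_mono)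
    also have "\<dots> = ennreal (W (U \<omega>) - W 0)"
      using U[OF that] w W by (intro nn_integral_FTC_Icc) (auto intro: has_field_derivative_at_within)
    finally show ?thesis by (simp add: W)
  qed
  have "(\<integral>\<^sup>+\<omega>. ennreal (W (U \<omega>)) \<partial>M) =
    (\<integral>\<^sup>+\<omega>. (\<integral>\<^sup>+t. ennreal (w t) * indicator {0..} t * indicator {\<omega>\<in>space M. U \<omega> > t} \<omega> \<partial>lborel) \<partial>M)"
    by (intro nn_integral_cong) (simp add: cake)
  also have "\<dots> = (\<integral>\<^sup>+t. (\<integral>\<^sup>+\<omega>. ennreal (w t) * indicator {0..} t * indicator {\<omega>\<in>space M. U \<omega> > t} \<omega> \<partial>M) \<partial>lborel)"
    by (intro Fubini'[symmetric]) measurable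
  also have "\<dots> = (\<integral>\<^sup>+t. ennreal (w t) * indicator {0..} t * emeasure M {\<omega>\<in>space M. U \<omega> > t} \<partial>lborel)"
    by (intro nn_integral_cong) (simp add: nn_integral_cmult)
  finally show ?thesis .
qed

text \<open>The gap between the two tail functions has a constant sign and integrates to the difference of
  the means. Equal means therefore make the tails agree almost everywhere, and the third moment is an
  integral of the tail as well.\<close>

lemma st_le_eq_mean_imp_eq_cube:
  assumes "prob_space M" and [measurable]: "U \<in> borel_measurable M" "V \<in> borel_measurable M"
    and nn: "\<And>\<omega>. 0 \<le> U \<omega>" "\<And>\<omega>. 0 \<le> V \<omega>"
    and st: "st_le M U V"
    and mean: "(\<integral>\<^sup>+\<omega>. ennreal (U \<omega>) \<partial>M) = (\<integral>\<^sup>+\<omega>. ennreal (V \<omega>) \<partial>M)" "(\<integral>\<^sup>+\<omega>. ennreal (U \<omega>) \<partial>M) < \<infinity>"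
  shows "(\<integral>\<^sup>+\<omega>. ennreal (U \<omega> ^ 3) \<partial>M) = (\<integral>\<^sup>+\<omega>. ennreal (V \<omega> ^ 3) \<partial>M)"
proof -
  interpret prob_space M by fact
  let ?P = "\<lambda>U t. emeasure M {\<omega>\<in>space M. U \<omega> > (t::real)}"
  have le: "?P U t \<le> ?P V t" for t
    using st unfolding st_le_def emeasure_eq_measure by (simp add: ennreal_leI)
  have 1: "(\<integral>\<^sup>+\<omega>. ennreal (Z \<omega>) \<partial>M) = (\<integral>\<^sup>+t. indicator {0..} t * ?P Z t \<partial>lborel)"
    if "Z \<in> borel_measurable M" "\<And>\<omega>. 0 \<le> Z \<omega>" for Z
    using nn_integral_layer_cake[of M Z "\<lambda>_. 1" "\<lambda>t. t"] that sigma_finite_measure_axioms by simp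
  have 3: "(\<integral>\<^sup>+\<omega>. ennreal (Z \<omega> ^ 3) \<partial>M) = (\<integral>\<^sup>+t. ennreal (3 * t\<^sup>2) * indicator {0..} t * ?P Z t \<partial>lborel)"
    if "Z \<in> borel_measurable M" "\<And>\<omega>. 0 \<le> Z \<omega>" for Z
    by (rule nn_integral_layer_cake) (use that sigma_finite_measure_axioms in \<open>auto intro!: derivative_eq_intros\<close>)
  have meas: "(\<lambda>t. indicator {0..} t * ?P Z t) \<in> borel_measurable lborel"
    if [measurable]: "Z \<in> borel_measurable M" for Z
    by measurable
  have "AE t in lborel. indicator {0..} t * ?P U t = indicator {0..} t * ?P V t"
  proof -
    have "(\<integral>\<^sup>+t. indicator {0..} t * ?P V t - indicator {0..} t * ?P U t \<partial>lborel) =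
       (\<integral>\<^sup>+t. indicator {0..} t * ?P V t \<partial>lborel) - (\<integral>\<^sup>+t. indicator {0..} t * ?P U t \<partial>lborel)"
      using mean by (intro nn_integral_diff meas) (auto simp: 1[symmetric] nn le intro!: mult_left_mono)
    also have "\<dots> = 0" using mean by (simp add: 1[symmetric] nn ennreal_minus_eq_0)
    finally have "AE t in lborel. indicator {0..} t * ?P V t - indicator {0..} t * ?P U t = 0"
      by (subst (asm) nn_integral_0_iff_AE) (auto intro!: borel_measurable_minus_ennreal meas)
    then show ?thesis
    proof eventually_elim
      case (elim t)
      then show ?case
        using le[of t] by (cases "0 \<le> t") (auto simp: ennreal_minus_eq_0 intro!: antisym)
    qed
  qed
  then show ?thesis
    unfolding 3[OF assms(2) nn(1)] 3[OF assms(3) nn(2)]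
    by (intro nn_integral_cong_AE) (auto simp: mult.assoc)
qed

lemma convex_on_abs_cube: "convex_on UNIV (\<lambda>x::real. \<bar>x\<bar> ^ 3)"
proof (rule convex_onI)
  fix t x y :: real assume t: "0 < t" "t < 1"
  have "\<bar>(1 - t) *\<^sub>R x + t *\<^sub>R y\<bar> ^ 3 \<le> ((1 - t) * \<bar>x\<bar> + t * \<bar>y\<bar>) ^ 3"
    using t abs_triangle_ineq[of "(1 - t) * x" "t * y"] by (intro power_mono) (auto simp: abs_mult)
  also have "\<dots> \<le> (1 - t) * \<bar>x\<bar> ^ 3 + t * \<bar>y\<bar> ^ 3"
  proof -
    have "(1 - t) * a ^ 3 + t * b ^ 3 - ((1 - t) * a + t * b) ^ 3 =
        t * (1 - t) * (a - b)\<^sup>2 * ((2 - t) * a + (1 + t) * b)" for a b :: real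
      by (simp add: power2_eq_square power3_eq_cube algebra_simps)
    then show ?thesis
      using t by (smt (verit) abs_ge_zero mult_nonneg_nonneg zero_le_power2)
  qed
  finally show "\<bar>(1 - t) *\<^sub>R x + t *\<^sub>R y\<bar> ^ 3 \<le> (1 - t) * \<bar>x\<bar> ^ 3 + t * \<bar>y\<bar> ^ 3" .
qed simp

text \<open>The reduction of the theorem to moments: stochastic domination in either direction would make the
  third moments equal, and the convex order would put them in the wrong order.\<close>

lemma third_moment_obstructs_orders:
  assumes "prob_space M" and [measurable]: "X \<in> borel_measurable M" "D \<in> borel_measurable M"
    and nn: "\<And>\<omega>. 0 \<le> X \<omega>" "\<And>\<omega>. 0 \<le> D \<omega>"
    and mean: "(\<integral>\<^sup>+\<omega>. ennreal (X \<omega>) \<partial>M) = (\<integral>\<^sup>+\<omega>. ennreal (D \<omega>) \<partial>M)" "(\<integral>\<^sup>+\<omega>. ennreal (D \<omega>) \<partial>M) < \<infinity>"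
    and cube: "(\<integral>\<^sup>+\<omega>. ennreal (D \<omega> ^ 3) \<partial>M) < (\<integral>\<^sup>+\<omega>. ennreal (X \<omega> ^ 3) \<partial>M)" "(\<integral>\<^sup>+\<omega>. ennreal (X \<omega> ^ 3) \<partial>M) < \<infinity>"
  shows "\<not> st_le M D X \<and> \<not> st_le M X D \<and> \<not> cx_le M X D"
proof (intro conjI notI)
  assume "st_le M D X"
  then show False
    using st_le_eq_mean_imp_eq_cube[OF assms(1) assms(3,2) nn(2,1)] mean cube by simp
next
  assume "st_le M X D"
  then show False
    using st_le_eq_mean_imp_eq_cube[OF assms(1) assms(2,3) nn(1,2)] mean cube by simp
next
  assume cx: "cx_le M X D"
  have [simp]: "\<bar>X \<omega>\<bar> = X \<omega>" "\<bar>D \<omega>\<bar> = D \<omega>" for \<omega> using nn by auto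
  have int: "integrable M (\<lambda>\<omega>. X \<omega> ^ 3)" "integrable M (\<lambda>\<omega>. D \<omega> ^ 3)"
    using cube nn by (auto simp: integrable_iff_bounded)
  then have "(\<integral>\<omega>. X \<omega> ^ 3 \<partial>M) \<le> (\<integral>\<omega>. D \<omega> ^ 3 \<partial>M)"
    using cx convex_on_abs_cube unfolding cx_le_def by fastforce
  then have "(\<integral>\<^sup>+\<omega>. ennreal (X \<omega> ^ 3) \<partial>M) \<le> (\<integral>\<^sup>+\<omega>. ennreal (D \<omega> ^ 3) \<partial>M)"
    using int nn by (simp add: nn_integral_eq_integral ennreal_leI)
  then show False using cube by simp
qed

section \<open>The standard Gaussian law\<close>

text \<open>The common law of all entries. It is built from its coordinates so that statements about an
  arbitrary Gaussian matrix can be carried over to a concrete product space.\<close>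

definition gauss :: "'a::euclidean_space measure" where
  "gauss = distr (PiM (Basis :: 'a set)
      (\<lambda>_. density lborel (\<lambda>x. ennreal (normal_density 0 (1 / sqrt DIM('a)) x)))) borel
    (\<lambda>f. \<Sum>b\<in>Basis. f b *\<^sub>R b)"

lemma sets_gauss [simp, measurable_cong]: "sets gauss = sets borel"
  by (simp add: gauss_def)

lemma space_gauss [simp]: "space gauss = UNIV"
  by (simp add: gauss_def)

lemma indep_vars_PiM_components:
  assumes N: "\<And>i. i \<in> I \<Longrightarrow> prob_space (N i)" and I: "I \<noteq> {}"
  shows "prob_space.indep_vars (PiM I N) N (\<lambda>i f. f i) I"
proof -
  interpret prob_space "PiM I N" by (intro prob_space_PiM N)
  have "distr (PiM I N) (PiM I N) (\<lambda>f. \<lambda>i\<in>I. f i) = distr (PiM I N) (PiM I N) (\<lambda>f. f)"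
    by (intro distr_cong) (auto simp: space_PiM PiE_iff restrict_def extensional_def fun_eq_iff)
  also have "\<dots> = PiM I N"
    by (rule distr_id)
  also have "PiM I N = PiM I (\<lambda>i. distr (PiM I N) (N i) (\<lambda>f. f i))"
    by (intro PiM_cong refl distr_PiM_component[symmetric] N)
  finally show ?thesis
    by (rule iffD2[OF indep_vars_iff_distr_eq_PiM'[OF I], rotated]) (rule measurable_component_singleton)
qed

lemma std_gaussian_measurable:
  fixes Z :: "'a \<Rightarrow> 'b::euclidean_space"
  assumes "std_gaussian M Z"
  shows "Z \<in> borel_measurable M"
proof (rule borel_measurable_euclidean_space[THEN iffD2], rule)
  fix b :: 'b assume "b \<in> Basis"
  then have "distributed M lborel (\<lambda>\<omega>. Z \<omega> \<bullet> b) (normal_density 0 (1 / sqrt DIM('b)))"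
    using assms unfolding std_gaussian_def by blast
  from distributed_measurable[OF this] show "(\<lambda>\<omega>. Z \<omega> \<bullet> b) \<in> borel_measurable M"
    by (simp only: measurable_lborel1)
qed

lemma distr_borel_eq_density:
  assumes "distributed M lborel X f"
  shows "distr M borel X = density lborel f"
proof -
  have "distr M borel X = distr M lborel X" by (intro distr_cong) auto
  then show ?thesis using distributed_distr_eq_density[OF assms] by simp
qed

lemma distr_std_gaussian:
  fixes Z :: "'w \<Rightarrow> 'a::euclidean_space"
  assumes "prob_space M" and Z: "std_gaussian M Z"
  shows "distr M borel Z = gauss"
proof -
  interpret prob_space M by fact
  have [measurable]: "Z \<in> borel_measurable M" using Z by (rule std_gaussian_measurable)
  let ?D = "density lborel (\<lambda>x. ennreal (normal_density 0 (1 / sqrt DIM('a)) x))"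
  have D: "distr M borel (\<lambda>\<omega>. Z \<omega> \<bullet> b) = ?D" if "b \<in> Basis" for b
    using Z that unfolding std_gaussian_def by (intro distr_borel_eq_density) blast
  have "distr M (PiM (Basis :: 'a set) (\<lambda>_. borel)) (\<lambda>\<omega>. \<lambda>b\<in>Basis. Z \<omega> \<bullet> b)
      = PiM (Basis :: 'a set) (\<lambda>b. distr M borel (\<lambda>\<omega>. Z \<omega> \<bullet> b))"
    using Z unfolding std_gaussian_def
    by (subst (asm) indep_vars_iff_distr_eq_PiM') auto
  also have "\<dots> = PiM (Basis :: 'a set) (\<lambda>_. ?D)"
    by (intro PiM_cong) (auto simp: D)
  finally have *: "distr M (PiM (Basis :: 'a set) (\<lambda>_. borel)) (\<lambda>\<omega>. \<lambda>b\<in>Basis. Z \<omega> \<bullet> b) = \<dots>" .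
  have "distr M borel Z = distr M borel ((\<lambda>f. \<Sum>b\<in>Basis. f b *\<^sub>R b) \<circ> (\<lambda>\<omega>. \<lambda>b\<in>Basis. Z \<omega> \<bullet> b))"
    by (intro distr_cong) (auto simp: euclidean_representation)
  also have "\<dots> = distr (distr M (PiM (Basis :: 'a set) (\<lambda>_. borel)) (\<lambda>\<omega>. \<lambda>b\<in>Basis. Z \<omega> \<bullet> b)) borel (\<lambda>f. \<Sum>b\<in>Basis. f b *\<^sub>R b)"
    by (intro distr_distr[symmetric]) measurable
  finally show ?thesis by (simp add: * gauss_def)
qed

lemma std_gaussian_coords:
  "std_gaussian (PiM (Basis :: 'a::euclidean_space set)
      (\<lambda>_. density lborel (\<lambda>x. ennreal (normal_density 0 (1 / sqrt DIM('a)) x))))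
    (\<lambda>f. \<Sum>b\<in>Basis. f b *\<^sub>R (b::'a))"
    (is "std_gaussian (PiM _ ?D) ?Y")
proof -
  have D: "prob_space (?D b)" for b
    by (intro prob_space_normal_density) simp
  interpret prob_space "PiM (Basis :: 'a set) ?D" by (intro prob_space_PiM D)
  have Y: "?Y f \<bullet> b = f b" if "b \<in> Basis" for f b
    using that by (simp add: inner_sum_left inner_Basis if_distrib sum.delta cong: if_cong)
  have "indep_vars ?D (\<lambda>b f. f b) (Basis :: 'a set)"
    by (intro indep_vars_PiM_components D) simp
  then have "indep_vars (\<lambda>_. borel) (\<lambda>b f. f b) (Basis :: 'a set)"
    by (rule indep_vars_compose2[where Y = "\<lambda>_ x. x"]) simp
  then have 1: "indep_vars (\<lambda>_. borel) (\<lambda>b f. ?Y f \<bullet> b) (Basis :: 'a set)"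
    by (subst indep_vars_cong) (auto simp: Y)
  have 2: "distributed (PiM (Basis :: 'a set) ?D) lborel (\<lambda>f. ?Y f \<bullet> b) (normal_density 0 (1 / sqrt DIM('a)))"
    if b: "b \<in> Basis" for b :: 'a
  proof -
    have "distr (PiM (Basis :: 'a set) ?D) lborel (\<lambda>f. f b) = distr (PiM (Basis :: 'a set) ?D) (?D b) (\<lambda>f. f b)"
      by (intro distr_cong) auto
    also have "\<dots> = ?D b" using b by (intro distr_PiM_component D)
    finally show ?thesis using b by (simp add: Y distributed_def cong: distr_cong)
  qed
  show ?thesis unfolding std_gaussian_def using 1 2 by auto
qed

lemma prob_space_gauss: "prob_space (gauss :: 'a::euclidean_space measure)"
proof -
  have "prob_space (PiM (Basis :: 'a set) (\<lambda>_. density lborel (\<lambda>x. ennreal (normal_density 0 (1 / sqrt DIM('a)) x))))"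
    by (intro prob_space_PiM prob_space_normal_density) simp
  then show ?thesis
    unfolding gauss_def
    by (rule prob_space.prob_space_distr) (rule std_gaussian_measurable[OF std_gaussian_coords])
qed

text \<open>Multiplication by a basis element of the complex numbers or the quaternions permutes the
  coordinates up to sign. This finite part of the rotation invariance carries the averaging arguments; it
  follows from the independence of the coordinates and the symmetry of the normal law.\<close>

lemma distr_gauss_signed_permutation:
  fixes L :: "'a::euclidean_space \<Rightarrow> 'a"
  assumes \<pi>: "bij_betw \<pi> Basis (Basis :: 'a set)" and s: "\<And>b. s b = 1 \<or> s b = -1"
    and L: "\<And>x b. b \<in> Basis \<Longrightarrow> L x \<bullet> b = s b * (x \<bullet> \<pi> b)"
  shows "distr gauss borel L = gauss"
proof -
  let ?D = "\<lambda>_. density lborel (\<lambda>x. ennreal (normal_density 0 (1 / sqrt DIM('a)) x))"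
  let ?Y = "\<lambda>f. \<Sum>b\<in>Basis. f b *\<^sub>R (b::'a)"
  let ?M = "PiM (Basis :: 'a set) ?D"
  have D: "prob_space (?D b)" for b
    by (intro prob_space_normal_density) simp
  interpret prob_space ?M by (intro prob_space_PiM D)
  note g = std_gaussian_coords[where 'a='a]
  have [measurable]: "?Y \<in> borel_measurable ?M" using g by (rule std_gaussian_measurable)
  have Lm [measurable]: "L \<in> borel_measurable borel"
    by (rule borel_measurable_euclidean_space[THEN iffD2]) (auto simp: L)
  have \<pi>': "inj_on \<pi> Basis" "\<pi> b \<in> Basis" if "b \<in> Basis" for b
    using \<pi> that by (auto simp: bij_betw_def)
  have "distr ?M ?M (\<lambda>f. \<lambda>b\<in>Basis. f (\<pi> b)) = ?M"
    using \<pi> D by (intro distr_PiM_reindex) (auto simp: bij_betw_def)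
  moreover have "?M = (\<Pi>\<^sub>M b\<in>Basis. distr ?M borel (\<lambda>f. f (\<pi> b)))"
  proof (intro PiM_cong refl)
    fix b :: 'a assume b: "b \<in> Basis"
    have "distr ?M borel (\<lambda>f. f (\<pi> b)) = distr ?M (?D b) (\<lambda>f. f (\<pi> b))"
      by (intro distr_cong) auto
    also have "\<dots> = ?D b" using \<pi>'(2)[OF b] by (intro distr_PiM_component D)
    finally show "?D b = distr ?M borel (\<lambda>f. f (\<pi> b))" ..
  qed
  moreover have "distr ?M ?M (\<lambda>f. \<lambda>b\<in>Basis. f (\<pi> b)) = distr ?M (\<Pi>\<^sub>M b\<in>Basis. borel) (\<lambda>f. \<lambda>b\<in>Basis. f (\<pi> b))"
    by (intro distr_cong refl sets_PiM_cong) auto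
  ultimately have "indep_vars (\<lambda>_. borel) (\<lambda>b f. f (\<pi> b)) (Basis :: 'a set)"
    using \<pi>'(2) by (subst indep_vars_iff_distr_eq_PiM') auto
  then have "indep_vars (\<lambda>_. borel) (\<lambda>b f. s b * f (\<pi> b)) (Basis :: 'a set)"
    by (rule indep_vars_compose2) simp
  moreover have Yb: "L (?Y f) \<bullet> b = s b * f (\<pi> b)" if "b \<in> Basis" for f b
    using that \<pi>'(2)[OF that]
    by (simp add: L inner_sum_left inner_Basis if_distrib sum.delta cong: if_cong)
  ultimately have 1: "indep_vars (\<lambda>_. borel) (\<lambda>b f. L (?Y f) \<bullet> b) (Basis :: 'a set)"
    by (subst indep_vars_cong) auto
  have 2: "distributed ?M lborel (\<lambda>f. L (?Y f) \<bullet> b) (normal_density 0 (1 / sqrt DIM('a)))"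
    if b: "b \<in> Basis" for b :: 'a
  proof -
    have "distributed ?M lborel (\<lambda>f. ?Y f \<bullet> \<pi> b) (normal_density 0 (1 / sqrt DIM('a)))"
      using g \<pi>'(2)[OF b] unfolding std_gaussian_def by auto
    from normal_density_affine[OF this, of "s b" 0] have
      "distributed ?M lborel (\<lambda>f. s b * (?Y f \<bullet> \<pi> b)) (normal_density 0 (1 / sqrt DIM('a)))"
      using s[of b] by auto
    then show ?thesis by (simp only: L[OF b])
  qed
  have "std_gaussian ?M (\<lambda>f. L (?Y f))"
    unfolding std_gaussian_def using 1 2 by auto
  from distr_std_gaussian[OF prob_space_axioms this]
  have "distr ?M borel (\<lambda>f. L (?Y f)) = gauss" .
  moreover have "distr gauss borel L = distr ?M borel (\<lambda>f. L (?Y f))"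
    unfolding gauss_def by (subst distr_distr) (auto simp: comp_def)
  ultimately show ?thesis by simp
qed

lemma char_distr_scale:
  assumes "X \<in> borel_measurable M"
  shows "char (distr M borel (\<lambda>\<omega>. r * X \<omega>)) t = char (distr M borel X) (r * t)"
  using assms by (simp add: char_def integral_distr ac_simps)

lemma char_normal_density:
  assumes "0 < \<sigma>"
  shows "char (density lborel (\<lambda>x. ennreal (normal_density 0 \<sigma> x))) t = complex_of_real (exp (- (\<sigma>\<^sup>2 * t\<^sup>2) / 2))"
proof -
  interpret std: prob_space std_normal_distribution
    using real_dist_normal_dist by (simp add: real_distribution_def)
  have "distributed std_normal_distribution lborel (\<lambda>x. x) std_normal_density"
    by (simp add: distributed_def distr_id2)
  from std.normal_density_affine[OF this, of \<sigma> 0] assms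
  have "distributed std_normal_distribution lborel (\<lambda>x. \<sigma> * x) (normal_density 0 \<sigma>)" by simp
  from distr_borel_eq_density[OF this]
  have "density lborel (\<lambda>x. ennreal (normal_density 0 \<sigma> x)) = distr std_normal_distribution borel (\<lambda>x. \<sigma> * x)"
    by simp
  moreover have "distr std_normal_distribution borel (\<lambda>x. x) = std_normal_distribution"
    by (simp add: distr_id2)
  ultimately show ?thesis
    using char_distr_scale[of "\<lambda>x. x" std_normal_distribution \<sigma> t]
    by (simp add: char_std_normal_distribution power_mult_distrib)
qed

text \<open>Stating normality through the characteristic function admits the degenerate variance
  \<open>v = 0\<close>, which occurs for vanishing coefficients: \<open>X\<close> has the law of \<open>sqrt v\<close> times a standard
  normal variable in every case.\<close>

lemma nn_integral_even_moment_of_char: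
  assumes "prob_space M" and [measurable]: "X \<in> borel_measurable M" and v: "0 \<le> v"
    and ch: "\<And>t. char (distr M borel X) t = complex_of_real (exp (- (v * t\<^sup>2) / 2))"
  shows "(\<integral>\<^sup>+\<omega>. ennreal (X \<omega> ^ (2 * k)) \<partial>M) = ennreal (v ^ k * (fact (2 * k) / (2 ^ k * fact k)))"
proof -
  interpret prob_space M by fact
  interpret std: prob_space std_normal_distribution
    using real_dist_normal_dist by (simp add: real_distribution_def)
  have "distr M borel X = distr std_normal_distribution borel (\<lambda>x. sqrt v * x)"
  proof (rule Levy_uniqueness)
    have "distr std_normal_distribution borel (\<lambda>x. x) = std_normal_distribution"
      by (simp add: distr_id2)
    then show "char (distr M borel X) = char (distr std_normal_distribution borel (\<lambda>x. sqrt v * x))"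
      using v by (auto simp: fun_eq_iff ch char_distr_scale[of "\<lambda>x. x"] char_std_normal_distribution power_mult_distrib)
  qed auto
  then have "(\<integral>\<^sup>+x. ennreal (x ^ (2 * k)) \<partial>distr M borel X) = (\<integral>\<^sup>+x. ennreal (x ^ (2 * k)) \<partial>distr std_normal_distribution borel (\<lambda>x. sqrt v * x))"
    by simp
  then have "(\<integral>\<^sup>+\<omega>. ennreal (X \<omega> ^ (2 * k)) \<partial>M) = (\<integral>\<^sup>+x. ennreal ((sqrt v * x) ^ (2 * k)) \<partial>std_normal_distribution)"
    by (simp add: nn_integral_distr)
  also have "\<dots> = (\<integral>\<^sup>+x. ennreal (v ^ k * (std_normal_density x * x ^ (2 * k))) \<partial>lborel)"
  proof -
    have "(sqrt v * x) ^ (2 * k) = v ^ k * x ^ (2 * k)" for x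
      using v by (simp add: power_mult_distrib power_mult)
    then show ?thesis
      by (subst nn_integral_density)
        (auto simp: ennreal_mult'[symmetric] ac_simps intro!: nn_integral_cong)
  qed
  also have "\<dots> = ennreal (v ^ k * (fact (2 * k) / (2 ^ k * fact k)))"
    using has_bochner_integral_mult_right[OF std_normal_moment_even[of k], of "v ^ k"] v
    by (subst nn_integral_eq_integral) (auto simp: has_bochner_integral_iff)
  finally show ?thesis .
qed

lemma char_inner_gauss:
  fixes p :: "'a::euclidean_space"
  shows "char (distr gauss borel (\<lambda>x. x \<bullet> p)) t = complex_of_real (exp (- ((norm p)\<^sup>2 / DIM('a) * t\<^sup>2) / 2))"
proof -
  let ?D = "\<lambda>_. density lborel (\<lambda>x. ennreal (normal_density 0 (1 / sqrt DIM('a)) x))"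
  let ?Y = "\<lambda>f. \<Sum>b\<in>Basis. f b *\<^sub>R (b::'a)"
  let ?M = "PiM (Basis :: 'a set) ?D"
  have D: "prob_space (?D b)" for b
    by (intro prob_space_normal_density) simp
  interpret prob_space ?M by (intro prob_space_PiM D)
  note g = std_gaussian_coords[where 'a='a]
  have [measurable]: "?Y \<in> borel_measurable ?M" using g by (rule std_gaussian_measurable)
  have ind: "indep_vars (\<lambda>_. borel) (\<lambda>b f. (p \<bullet> b) * (?Y f \<bullet> b)) (Basis :: 'a set)"
    using g unfolding std_gaussian_def by (auto intro: indep_vars_compose2)
  have chb: "char (distr ?M borel (\<lambda>f. (p \<bullet> b) * (?Y f \<bullet> b))) t = complex_of_real (exp (- ((p \<bullet> b)\<^sup>2 / DIM('a) * t\<^sup>2) / 2))"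
    if b: "b \<in> Basis" for b
  proof -
    have "distr ?M borel (\<lambda>f. ?Y f \<bullet> b) = ?D b"
      using g b unfolding std_gaussian_def by (intro distr_borel_eq_density) auto
    then show ?thesis
      by (subst char_distr_scale) (auto simp: char_normal_density power_mult_distrib power_divide)
  qed
  have "distr gauss borel (\<lambda>x. x \<bullet> p) = distr ?M borel (\<lambda>f. ?Y f \<bullet> p)"
    unfolding gauss_def by (subst distr_distr) (auto simp: comp_def)
  also have "(\<lambda>f. ?Y f \<bullet> p) = (\<lambda>f. \<Sum>b\<in>Basis. (p \<bullet> b) * (?Y f \<bullet> b))"
    by (subst euclidean_inner) (simp add: mult.commute)
  also have "char (distr ?M borel \<dots>) t = (\<Prod>b\<in>Basis. complex_of_real (exp (- ((p \<bullet> b)\<^sup>2 / DIM('a) * t\<^sup>2) / 2)))"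
    by (subst char_distr_sum[OF ind]) (intro prod.cong refl chb)
  also have "\<dots> = complex_of_real (exp (\<Sum>b\<in>Basis. - ((p \<bullet> b)\<^sup>2 / DIM('a) * t\<^sup>2) / 2))"
    by (simp add: exp_sum)
  also have "(\<Sum>b\<in>Basis. - ((p \<bullet> b)\<^sup>2 / DIM('a) * t\<^sup>2) / 2) = - ((norm p)\<^sup>2 / DIM('a) * t\<^sup>2) / 2"
    unfolding power2_norm_eq_inner euclidean_inner[of p p]
    by (simp add: power2_eq_square sum_divide_distrib sum_distrib_right sum_negf)
  finally show ?thesis .
qed

text \<open>The moment of order \<open>2 k\<close> of one real coordinate.\<close>

definition gauss_moment :: "'a::euclidean_space itself \<Rightarrow> nat \<Rightarrow> real" where
  "gauss_moment _ k = fact (2 * k) / (2 ^ k * fact k) / DIM('a) ^ k"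

lemma gauss_moment_pos: "0 < gauss_moment TYPE('a::euclidean_space) k"
  by (simp add: gauss_moment_def)

lemma nn_integral_PiM_gauss_functional:
  fixes p :: "'j \<Rightarrow> 'a::euclidean_space"
  assumes "finite J"
  shows "(\<integral>\<^sup>+f. ennreal ((\<Sum>j\<in>J. f j \<bullet> p j) ^ (2 * k)) \<partial>PiM J (\<lambda>_. gauss))
    = ennreal (gauss_moment TYPE('a) k * (\<Sum>j\<in>J. (norm (p j))\<^sup>2) ^ k)"
proof (cases "J = {}")
  case True
  then show ?thesis by (cases "k = 0") (auto simp: gauss_moment_def PiM_empty nn_integral_count_space_finite power_0_left)
next
  case False
  interpret prob_space "PiM J (\<lambda>_. gauss :: 'a measure)" by (intro prob_space_PiM prob_space_gauss)
  have "indep_vars (\<lambda>_. gauss) (\<lambda>j f. f j) J"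
    using False by (intro indep_vars_PiM_components prob_space_gauss)
  then have ind: "indep_vars (\<lambda>_. borel) (\<lambda>j f. f j \<bullet> p j) J"
    by (rule indep_vars_compose2) simp
  have ch: "char (distr (PiM J (\<lambda>_. gauss)) borel (\<lambda>f. \<Sum>j\<in>J. f j \<bullet> p j)) t
      = complex_of_real (exp (- ((\<Sum>j\<in>J. (norm (p j))\<^sup>2) / DIM('a) * t\<^sup>2) / 2))" for t
  proof -
    have "distr (PiM J (\<lambda>_. gauss)) borel (\<lambda>f. f j \<bullet> p j) = distr gauss borel (\<lambda>x. x \<bullet> p j)" if "j \<in> J" for j
      using distr_distr[of "\<lambda>x. x \<bullet> p j" gauss borel "\<lambda>f. f j" "PiM J (\<lambda>_. gauss)"] that
        distr_PiM_component[of J "\<lambda>_. gauss :: 'a measure" j]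
      by (simp add: prob_space_gauss comp_def)
    then have "char (distr (PiM J (\<lambda>_. gauss)) borel (\<lambda>f. \<Sum>j\<in>J. f j \<bullet> p j)) t
       = (\<Prod>j\<in>J. complex_of_real (exp (- ((norm (p j))\<^sup>2 / DIM('a) * t\<^sup>2) / 2)))"
      by (subst char_distr_sum[OF ind]) (simp add: char_inner_gauss)
    also have "\<dots> = complex_of_real (exp (\<Sum>j\<in>J. - ((norm (p j))\<^sup>2 / DIM('a) * t\<^sup>2) / 2))"
      using assms by (simp add: exp_sum)
    also have "(\<Sum>j\<in>J. - ((norm (p j))\<^sup>2 / DIM('a) * t\<^sup>2) / 2) = - ((\<Sum>j\<in>J. (norm (p j))\<^sup>2) / DIM('a) * t\<^sup>2) / 2"
      by (simp add: sum_divide_distrib sum_distrib_right sum_negf)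
    finally show ?thesis .
  qed
  have "(\<integral>\<^sup>+f. ennreal ((\<Sum>j\<in>J. f j \<bullet> p j) ^ (2 * k)) \<partial>PiM J (\<lambda>_. gauss))
     = ennreal (((\<Sum>j\<in>J. (norm (p j))\<^sup>2) / DIM('a)) ^ k * (fact (2 * k) / (2 ^ k * fact k)))"
    by (intro nn_integral_even_moment_of_char prob_space_axioms ch divide_nonneg_nonneg sum_nonneg) auto
  also have "((\<Sum>j\<in>J. (norm (p j))\<^sup>2) / DIM('a)) ^ k * (fact (2 * k) / (2 ^ k * fact k))
     = gauss_moment TYPE('a) k * (\<Sum>j\<in>J. (norm (p j))\<^sup>2) ^ k"
    by (simp add: gauss_moment_def power_divide ac_simps)
  finally show ?thesis .
qed

lemma nn_integral_gauss_functional: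
  fixes p :: "'a::euclidean_space"
  shows "(\<integral>\<^sup>+x. ennreal ((x \<bullet> p) ^ (2 * k)) \<partial>gauss) = ennreal (gauss_moment TYPE('a) k * norm p ^ (2 * k))"
proof -
  have "(\<integral>\<^sup>+x. ennreal ((x \<bullet> p) ^ (2 * k)) \<partial>gauss) = ennreal (((norm p)\<^sup>2 / DIM('a)) ^ k * (fact (2 * k) / (2 ^ k * fact k)))"
    by (intro nn_integral_even_moment_of_char prob_space_gauss char_inner_gauss) auto
  also have "((norm p)\<^sup>2 / DIM('a)) ^ k * (fact (2 * k) / (2 ^ k * fact k)) = gauss_moment TYPE('a) k * norm p ^ (2 * k)"
    by (simp add: gauss_moment_def power_divide power_mult[symmetric] ac_simps)
  finally show ?thesis .
qed

text \<open>An independent auxiliary Gaussian vector \<open>u\<close> turns a power of a norm into a power of a linear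
  functional, since the mean of \<open>(u \<bullet> y) ^ (2 * k)\<close> is a constant times \<open>norm y ^ (2 * k)\<close>. After
  exchanging the integrals, the inner one is the moment of a scalar normal variable. Thus the joint law
  of the coordinates of \<open>\<Sum>j\<in>J. L j (f j)\<close> never enters.\<close>

lemma nn_integral_norm_sum_conformal:
  fixes L :: "'j \<Rightarrow> 'a::euclidean_space \<Rightarrow> 'a"
  assumes J: "finite J"
    and adj: "\<And>j x u. j \<in> J \<Longrightarrow> L j x \<bullet> u = x \<bullet> L' j u"
    and conf: "\<And>j u. j \<in> J \<Longrightarrow> norm (L' j u) = c j * norm u"
  shows "(\<integral>\<^sup>+f. ennreal (norm (\<Sum>j\<in>J. L j (f j)) ^ (2 * k)) \<partial>PiM J (\<lambda>_. gauss))
    = ennreal ((\<Sum>j\<in>J. (c j)\<^sup>2) ^ k) * (\<integral>\<^sup>+u. ennreal (norm (u::'a) ^ (2 * k)) \<partial>gauss)"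
proof -
  let ?P = "PiM J (\<lambda>_. gauss :: 'a measure)"
  let ?m = "gauss_moment TYPE('a) k"
  interpret g: prob_space "gauss :: 'a measure" by (rule prob_space_gauss)
  interpret P: prob_space ?P by (intro prob_space_PiM prob_space_gauss)
  interpret pair_sigma_finite "gauss :: 'a measure" ?P ..
  have [measurable]: "L j \<in> borel_measurable borel" if "j \<in> J" for j
    using that by (intro borel_measurable_euclidean_space[THEN iffD2]) (auto simp: adj)
  have "?m * (\<integral>\<^sup>+f. ennreal (norm (\<Sum>j\<in>J. L j (f j)) ^ (2 * k)) \<partial>?P)
     = (\<integral>\<^sup>+f. (\<integral>\<^sup>+u. ennreal ((u \<bullet> (\<Sum>j\<in>J. L j (f j))) ^ (2 * k)) \<partial>gauss) \<partial>?P)"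
    using gauss_moment_pos[where 'a='a, of k]
    by (subst nn_integral_cmult[symmetric]) (auto simp: nn_integral_gauss_functional ennreal_mult)
  also have "\<dots> = (\<integral>\<^sup>+u. (\<integral>\<^sup>+f. ennreal ((u \<bullet> (\<Sum>j\<in>J. L j (f j))) ^ (2 * k)) \<partial>?P) \<partial>gauss)"
    by (intro Fubini') measurable
  also have "\<dots> = (\<integral>\<^sup>+u. (\<integral>\<^sup>+f. ennreal ((\<Sum>j\<in>J. f j \<bullet> L' j u) ^ (2 * k)) \<partial>?P) \<partial>gauss)"
    by (intro nn_integral_cong) (simp add: inner_sum_right inner_commute[of _ "L _ _"] adj)
  also have "\<dots> = (\<integral>\<^sup>+u. ennreal (?m * (\<Sum>j\<in>J. (c j * norm (u::'a))\<^sup>2) ^ k) \<partial>gauss)"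
    by (simp add: nn_integral_PiM_gauss_functional[OF J] conf)
  also have "\<dots> = (\<integral>\<^sup>+u. ennreal ?m * ennreal ((\<Sum>j\<in>J. (c j)\<^sup>2) ^ k) * ennreal (norm (u::'a) ^ (2 * k)) \<partial>gauss)"
    using gauss_moment_pos[where 'a='a, of k]
    by (intro nn_integral_cong)
       (simp add: ennreal_mult[symmetric] sum_nonneg power_mult_distrib sum_distrib_right[symmetric] power_mult)
  also have "\<dots> = ennreal ?m * (ennreal ((\<Sum>j\<in>J. (c j)\<^sup>2) ^ k) * (\<integral>\<^sup>+u. ennreal (norm (u::'a) ^ (2 * k)) \<partial>gauss))"
    by (simp add: nn_integral_cmult mult.assoc)
  finally show ?thesis
    using gauss_moment_pos[where 'a='a, of k] by (simp add: ennreal_mult_cancel_left)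
qed

lemma sum_power_le_card_mult:
  fixes x :: "'i \<Rightarrow> real"
  assumes I: "finite I" "I \<noteq> {}" and x: "\<And>i. i \<in> I \<Longrightarrow> 0 \<le> x i"
  shows "(\<Sum>i\<in>I. x i) ^ k \<le> real (card I) ^ k * (\<Sum>i\<in>I. x i ^ k)"
proof -
  have "Max (x ` I) \<in> x ` I" using I by (intro Max_in) auto
  then obtain i where i: "i \<in> I" "Max (x ` I) = x i" by blast
  have le: "x j \<le> x i" if "j \<in> I" for j using that i I by (metis Max_ge finite_imageI imageI)
  have "(\<Sum>i\<in>I. x i) ^ k \<le> (real (card I) * x i) ^ k"
    using le x by (intro power_mono sum_bounded_above sum_nonneg) auto
  also have "\<dots> = real (card I) ^ k * x i ^ k" by (simp add: power_mult_distrib)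
  also have "\<dots> \<le> real (card I) ^ k * (\<Sum>i\<in>I. x i ^ k)"
    using i I x by (intro mult_left_mono member_le_sum) auto
  finally show ?thesis .
qed

lemma nn_integral_norm_gauss_finite:
  "(\<integral>\<^sup>+u. ennreal (norm (u::'a::euclidean_space) ^ (2 * k)) \<partial>gauss) < \<infinity>"
proof -
  have "norm u ^ (2 * k) \<le> DIM('a) ^ k * (\<Sum>b\<in>Basis. (u \<bullet> b) ^ (2 * k))" for u :: 'a
  proof -
    have "(norm u)\<^sup>2 = (\<Sum>b\<in>Basis. (u \<bullet> b)\<^sup>2)"
      unfolding power2_norm_eq_inner euclidean_inner[of u u] by (simp add: power2_eq_square)
    then show ?thesis
      using sum_power_le_card_mult[of "Basis :: 'a set" "\<lambda>b. (u \<bullet> b)\<^sup>2" k] by (simp add: power_mult)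
  qed
  then have "(\<integral>\<^sup>+u. ennreal (norm (u::'a) ^ (2 * k)) \<partial>gauss)
     \<le> (\<integral>\<^sup>+u. (\<Sum>b\<in>Basis. ennreal (DIM('a) ^ k) * ennreal (((u::'a) \<bullet> b) ^ (2 * k))) \<partial>gauss)"
    by (intro nn_integral_mono)
       (simp add: ennreal_mult[symmetric] sum_ennreal sum_distrib_left ennreal_leI)
  also have "\<dots> = (\<Sum>b\<in>Basis. ennreal (DIM('a) ^ k) * (\<integral>\<^sup>+u. ennreal (((u::'a) \<bullet> b) ^ (2 * k)) \<partial>gauss))"
    by (simp add: nn_integral_sum nn_integral_cmult)
  also have "\<dots> < \<infinity>"
    by (simp add: nn_integral_gauss_functional ennreal_mult_less_top of_nat_less_top)
  finally show ?thesis .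
qed

lemma nn_integral_norm_gauss_pos:
  "0 < (\<integral>\<^sup>+u. ennreal (norm (u::'a::euclidean_space) ^ (2 * k)) \<partial>gauss)"
proof -
  obtain b :: 'a where b: "b \<in> Basis" using nonempty_Basis by blast
  have "0 < ennreal (gauss_moment TYPE('a) k * norm b ^ (2 * k))"
    using b gauss_moment_pos[where 'a='a, of k] by simp
  also have "\<dots> = (\<integral>\<^sup>+u. ennreal ((u \<bullet> b) ^ (2 * k)) \<partial>gauss)"
    by (simp add: nn_integral_gauss_functional)
  also have "\<dots> \<le> (\<integral>\<^sup>+u. ennreal (norm (u::'a) ^ (2 * k)) \<partial>gauss)"
  proof (intro nn_integral_mono ennreal_leI)
    fix u :: 'a
    have "\<bar>u \<bullet> b\<bar> ^ (2 * k) \<le> norm u ^ (2 * k)"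
      using b by (intro power_mono Basis_le_norm) auto
    then show "(u \<bullet> b) ^ (2 * k) \<le> norm u ^ (2 * k)" by (simp add: power_even_abs)
  qed
  finally show ?thesis .
qed

section \<open>Integrals over two Gaussian rows\<close>

lemma lessThan_3: "{..<3::nat} = {0, 1, 2}"
  by auto

lemma distr_gauss_uminus: "distr gauss borel (\<lambda>x. - x) = (gauss :: 'a::euclidean_space measure)"
  by (rule distr_gauss_signed_permutation[of id "\<lambda>_. -1"]) auto

lemma integral_PiM_gauss_update:
  fixes F :: "('j \<Rightarrow> 'a::euclidean_space) \<Rightarrow> real"
  assumes I: "finite I" "i \<in> I" and [measurable]: "L \<in> borel_measurable borel"
    and L: "distr gauss borel L = gauss" and F: "integrable (PiM I (\<lambda>_. gauss)) F"
  shows "integrable (PiM I (\<lambda>_. gauss)) (\<lambda>f. F (f(i := L (f i))))" (is ?int)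
    and "(\<integral>f. F (f(i := L (f i))) \<partial>PiM I (\<lambda>_. gauss)) = (\<integral>f. F f \<partial>PiM I (\<lambda>_. gauss))" (is ?eq)
proof -
  let ?P = "PiM I (\<lambda>_. gauss :: 'a measure)"
  let ?T = "\<lambda>f. f(i := L (f i))"
  interpret product_sigma_finite "\<lambda>_. gauss :: 'a measure"
    unfolding product_sigma_finite_def by (auto intro: prob_space_imp_sigma_finite prob_space_gauss)
  have T [measurable]: "?T \<in> measurable ?P ?P"
  proof -
    have "(\<lambda>f. L (f i)) \<in> measurable ?P gauss" using I by measurable
    moreover have "?T = (\<lambda>f. fun_upd f i (L (f i)))" ..
    ultimately show ?thesis
      using I by (intro measurable_fun_upd[where J = I]) (auto simp: insert_absorb)
  qed
  have inv: "distr ?P ?P ?T = ?P"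
  proof (rule PiM_eqI[OF I(1)])
    fix A :: "'j \<Rightarrow> 'a set" assume A: "\<And>j. j \<in> I \<Longrightarrow> A j \<in> sets gauss"
    let ?A = "A(i := L -` A i)"
    have LA: "L -` A i \<in> sets borel"
      using A[OF I(2)] measurable_sets[of L borel borel "A i"] by simp
    have "emeasure (distr ?P ?P ?T) (Pi\<^sub>E I A) = emeasure ?P (?T -` Pi\<^sub>E I A \<inter> space ?P)"
      using A I by (intro emeasure_distr T) (auto intro!: sets_PiM_I_finite)
    also have "?T -` Pi\<^sub>E I A \<inter> space ?P = Pi\<^sub>E I ?A"
      using I by (auto simp: space_PiM PiE_iff extensional_def split: if_splits)
    also have "emeasure ?P (Pi\<^sub>E I ?A) = (\<Prod>j\<in>I. emeasure gauss (?A j))"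
      using A LA I by (intro emeasure_PiM) auto
    also have "\<dots> = (\<Prod>j\<in>I. emeasure gauss (A j))"
    proof (intro prod.cong refl)
      fix j assume j: "j \<in> I"
      have "emeasure gauss (L -` A i) = emeasure (distr gauss borel L) (A i)"
        using A[OF I(2)] by (subst emeasure_distr) auto
      then show "emeasure gauss (?A j) = emeasure gauss (A j)" by (simp add: L)
    qed
    finally show "emeasure (distr ?P ?P ?T) (Pi\<^sub>E I A) = (\<Prod>j\<in>I. emeasure gauss (A j))" .
  qed simp
  have F': "integrable (distr ?P ?P ?T) F" unfolding inv by (rule F)
  then show ?int using borel_measurable_integrable[OF F] by (subst (asm) integrable_distr_eq) auto
  have "(\<integral>f. F f \<partial>distr ?P ?P ?T) = (\<integral>f. F (?T f) \<partial>?P)"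
    using borel_measurable_integrable[OF F] by (intro integral_distr) auto
  then show ?eq by (simp add: inv)
qed

definition sq_sum :: "'j set \<Rightarrow> ('j \<Rightarrow> 'a::euclidean_space) \<Rightarrow> real" where
  "sq_sum I f = (\<Sum>i\<in>I. (norm (f i))\<^sup>2)"

lemma sq_sum_nonneg: "0 \<le> sq_sum I f"
  by (simp add: sq_sum_def sum_nonneg)

lemma integrable_sq_sum_power:
  assumes I: "finite I" "I \<noteq> {}"
  shows "integrable (PiM I (\<lambda>_. gauss :: 'a::euclidean_space measure)) (\<lambda>f. sq_sum I f ^ k)"
proof (rule Bochner_Integration.integrable_bound)
  let ?P = "PiM I (\<lambda>_. gauss :: 'a measure)"
  have comp: "integrable ?P (\<lambda>f. norm (f i) ^ (2 * k))" if i: "i \<in> I" for i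
  proof -
    have "integrable gauss (\<lambda>u::'a. norm u ^ (2 * k))"
      using nn_integral_norm_gauss_finite[where 'a='a, of k] by (simp add: integrable_iff_bounded)
    then have "integrable (distr ?P gauss (\<lambda>f. f i)) (\<lambda>u::'a. norm u ^ (2 * k))"
      using i distr_PiM_component[of I "\<lambda>_. gauss :: 'a measure" i] by (simp add: prob_space_gauss)
    then show ?thesis using i by (subst (asm) integrable_distr_eq) auto
  qed
  show "integrable ?P (\<lambda>f. real (card I) ^ k * (\<Sum>i\<in>I. norm (f i) ^ (2 * k)))"
    using comp by auto
  show "(\<lambda>f. sq_sum I f ^ k) \<in> borel_measurable ?P"
    unfolding sq_sum_def by measurable
  show "AE f in ?P. norm (sq_sum I f ^ k) \<le> norm (real (card I) ^ k * (\<Sum>i\<in>I. norm (f i) ^ (2 * k)))"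
  proof (rule AE_I2)
    fix f
    have "sq_sum I f ^ k \<le> real (card I) ^ k * (\<Sum>i\<in>I. norm (f i) ^ (2 * k))"
      using sum_power_le_card_mult[OF I(1), of "\<lambda>i. (norm (f i))\<^sup>2" k] I
      by (simp add: sq_sum_def power_mult)
    then show "norm (sq_sum I f ^ k) \<le> norm (real (card I) ^ k * (\<Sum>i\<in>I. norm (f i) ^ (2 * k)))"
      using sq_sum_nonneg[of I f] by (simp add: sum_nonneg)
  qed
qed

definition rows2 :: "(nat \<times> nat) set" where
  "rows2 = {0, 1} \<times> {..<3}"

lemma finite_rows2 [simp]: "finite rows2" by (simp add: rows2_def)

lemma rows2_nonempty [simp]: "rows2 \<noteq> {}" by (simp add: rows2_def lessThan_empty_iff)

lemma in_rows2 [simp]: "(i, j) \<in> rows2 \<longleftrightarrow> i \<le> 1 \<and> j < 3" by (auto simp: rows2_def)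

abbreviation gauss_rows2 :: "(nat \<times> nat \<Rightarrow> 'a::euclidean_space) measure" where
  "gauss_rows2 \<equiv> PiM rows2 (\<lambda>_. gauss)"

text \<open>The growth of a form of degree four in the entries. It makes all products of three
  such functions integrable, hence every term of the cubes that are expanded below.\<close>

definition quadratic :: "((nat \<times> nat \<Rightarrow> 'a::euclidean_space) \<Rightarrow> real) \<Rightarrow> bool" where
  "quadratic X \<longleftrightarrow> X \<in> borel_measurable gauss_rows2 \<and> (\<exists>c. \<forall>f. \<bar>X f\<bar> \<le> c * (sq_sum rows2 f)\<^sup>2)"

lemma quadratic_measurable: "quadratic X \<Longrightarrow> X \<in> borel_measurable gauss_rows2"
  by (simp add: quadratic_def)

lemma quadratic_add:
  assumes "quadratic X" "quadratic Y" shows "quadratic (\<lambda>f. X f + Y f)"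
proof -
  obtain a b where ab: "\<And>f. \<bar>X f\<bar> \<le> a * (sq_sum rows2 f)\<^sup>2" "\<And>f. \<bar>Y f\<bar> \<le> b * (sq_sum rows2 f)\<^sup>2"
    using assms unfolding quadratic_def by auto
  have "\<bar>X f + Y f\<bar> \<le> (a + b) * (sq_sum rows2 f)\<^sup>2" for f
    using ab(1)[of f] ab(2)[of f] by (simp add: distrib_right)
  then show ?thesis using assms unfolding quadratic_def by auto
qed

lemma quadratic_cmult:
  assumes "quadratic X" shows "quadratic (\<lambda>f. r * X f)"
proof -
  obtain a where a: "\<And>f. \<bar>X f\<bar> \<le> a * (sq_sum rows2 f)\<^sup>2"
    using assms unfolding quadratic_def by auto
  have "\<bar>r * X f\<bar> \<le> (\<bar>r\<bar> * a) * (sq_sum rows2 f)\<^sup>2" for f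
    using mult_left_mono[OF a[of f], of "\<bar>r\<bar>"] by (simp add: abs_mult mult.assoc)
  then show ?thesis using assms unfolding quadratic_def by auto
qed

lemma quadratic_uminus: "quadratic X \<Longrightarrow> quadratic (\<lambda>f. - X f)"
  using quadratic_cmult[of X "-1"] by simp

lemma integrable_quadratic:
  assumes "quadratic X" shows "integrable gauss_rows2 X"
proof -
  obtain c where c: "\<And>f. \<bar>X f\<bar> \<le> c * (sq_sum rows2 f)\<^sup>2" using assms by (auto simp: quadratic_def)
  show ?thesis
  proof (rule Bochner_Integration.integrable_bound)
    show "integrable gauss_rows2 (\<lambda>f. c * (sq_sum rows2 f)\<^sup>2)"
      by (intro integrable_mult_right integrable_sq_sum_power) simp_all
    show "AE f in gauss_rows2. norm (X f) \<le> norm (c * (sq_sum rows2 f)\<^sup>2)"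
      using c by (intro AE_I2) (force intro: order_trans)
  qed (rule quadratic_measurable[OF assms])
qed

lemma integrable_quadratic3:
  assumes X: "quadratic X" and Y: "quadratic Y" and Z: "quadratic Z"
  shows "integrable gauss_rows2 (\<lambda>f. X f * Y f * Z f)"
proof -
  obtain a b c where abc: "\<And>f. \<bar>X f\<bar> \<le> a * (sq_sum rows2 f)\<^sup>2" "\<And>f. \<bar>Y f\<bar> \<le> b * (sq_sum rows2 f)\<^sup>2"
     "\<And>f. \<bar>Z f\<bar> \<le> c * (sq_sum rows2 f)\<^sup>2"
    using assms by (auto simp: quadratic_def)
  note [measurable] = quadratic_measurable[OF X] quadratic_measurable[OF Y] quadratic_measurable[OF Z]
  show ?thesis
  proof (rule Bochner_Integration.integrable_bound)
    show "integrable gauss_rows2 (\<lambda>f. a * b * c * sq_sum rows2 f ^ 6)"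
      by (intro integrable_mult_right integrable_sq_sum_power) simp_all
    show "AE f in gauss_rows2. norm (X f * Y f * Z f) \<le> norm (a * b * c * sq_sum rows2 f ^ 6)"
    proof (rule AE_I2)
      fix f :: "nat \<times> nat \<Rightarrow> 'a"
      let ?q = "sq_sum rows2 f"
      have nn: "0 \<le> a * ?q\<^sup>2" "0 \<le> b * ?q\<^sup>2"
        using order_trans[OF abs_ge_zero abc(1)[of f]] order_trans[OF abs_ge_zero abc(2)[of f]] by auto
      have "\<bar>X f\<bar> * \<bar>Y f\<bar> \<le> (a * ?q\<^sup>2) * (b * ?q\<^sup>2)"
        using nn by (intro mult_mono abc) auto
      then have "\<bar>X f\<bar> * \<bar>Y f\<bar> * \<bar>Z f\<bar> \<le> (a * ?q\<^sup>2) * (b * ?q\<^sup>2) * (c * ?q\<^sup>2)"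
        using nn by (intro mult_mono abc) auto
      also have "\<dots> = a * b * c * ?q ^ 6" by (simp add: power_numeral_reduce)
      finally have "norm (X f * Y f * Z f) \<le> a * b * c * ?q ^ 6" by (simp add: abs_mult)
      then show "norm (X f * Y f * Z f) \<le> norm (a * b * c * ?q ^ 6)"
        unfolding real_norm_def by (rule order_trans[OF _ abs_ge_self])
    qed
  qed measurable
qed

lemma norm_le_sq_sum:
  assumes "i \<in> rows2" shows "(norm (f i))\<^sup>2 \<le> sq_sum rows2 f"
  unfolding sq_sum_def using assms by (intro member_le_sum) auto

lemma norm_mult_le_sq_sum:
  assumes "i \<in> rows2" "j \<in> rows2" shows "norm (f i) * norm (f j) \<le> sq_sum rows2 f"
proof -
  have "2 * (norm (f i) * norm (f j)) \<le> (norm (f i))\<^sup>2 + (norm (f j))\<^sup>2"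
    using sum_squares_bound[of "norm (f i)" "norm (f j)"] by simp
  also have "\<dots> \<le> 2 * sq_sum rows2 f" using norm_le_sq_sum[OF assms(1), of f] norm_le_sq_sum[OF assms(2), of f] by simp
  finally show ?thesis by simp
qed

lemma quadraticI:
  fixes X :: "(nat \<times> nat \<Rightarrow> 'a::euclidean_space) \<Rightarrow> real"
  assumes "X \<in> borel_measurable gauss_rows2"
    and "i \<in> rows2" "j \<in> rows2" "k \<in> rows2" "l \<in> rows2"
    and X: "\<And>f. \<bar>X f\<bar> \<le> (norm (f i) * norm (f j)) * (norm (f k) * norm (f l))"
  shows "quadratic X"
  unfolding quadratic_def
proof (intro conjI exI[of _ 1] allI)
  fix f :: "nat \<times> nat \<Rightarrow> 'a"
  have "(norm (f i) * norm (f j)) * (norm (f k) * norm (f l)) \<le> sq_sum rows2 f * sq_sum rows2 f"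
    using assms by (intro mult_mono norm_mult_le_sq_sum sq_sum_nonneg) auto
  then show "\<bar>X f\<bar> \<le> 1 * (sq_sum rows2 f)\<^sup>2" using X[of f] by (simp add: power2_eq_square)
qed (rule assms(1))

lemma integral_flip:
  fixes F :: "(nat \<times> nat \<Rightarrow> 'a::euclidean_space) \<Rightarrow> real"
  assumes "integrable gauss_rows2 F" "i \<in> rows2"
  shows "(\<integral>f. F (f(i := - f i)) \<partial>gauss_rows2) = (\<integral>f. F f \<partial>gauss_rows2)"
  using assms by (intro integral_PiM_gauss_update(2)) (auto simp: distr_gauss_uminus)

text \<open>The functions \<open>x\<close>, \<open>y\<close>, \<open>z\<close> stand for cross terms with index pairs \<open>01\<close>, \<open>02\<close>, \<open>12\<close>; a sign change
  of entry \<open>i\<close> of the first row negates those whose pair contains \<open>i\<close>. The identity and the three sign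
  changes realise the sign patterns \<open>+++\<close>, \<open>--+\<close>, \<open>-+-\<close>, \<open>+--\<close> on \<open>(x, y, z)\<close>, and averaging a
  polynomial over them keeps exactly the monomials in which the three exponents have the same parity.\<close>

lemma integral_flip_average:
  fixes S x y z :: "(nat \<times> nat \<Rightarrow> 'a::euclidean_space) \<Rightarrow> real"
  assumes q: "quadratic S" "quadratic x" "quadratic y" "quadratic z"
    and S: "\<And>f i. S (f(i := - f i)) = S f"
    and x: "\<And>f. x (f((0,0) := - f (0,0))) = - x f" "\<And>f. x (f((0,1) := - f (0,1))) = - x f" "\<And>f. x (f((0,2) := - f (0,2))) = x f"
    and y: "\<And>f. y (f((0,0) := - f (0,0))) = - y f" "\<And>f. y (f((0,1) := - f (0,1))) = y f" "\<And>f. y (f((0,2) := - f (0,2))) = - y f"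
    and z: "\<And>f. z (f((0,0) := - f (0,0))) = z f" "\<And>f. z (f((0,1) := - f (0,1))) = - z f" "\<And>f. z (f((0,2) := - f (0,2))) = - z f"
  defines "W \<equiv> \<lambda>f. S f + 2 * (x f + y f + z f)"
  shows "(\<integral>f. W f \<partial>gauss_rows2) = (\<integral>f. S f \<partial>gauss_rows2)"
    and "(\<integral>f. W f ^ 3 \<partial>gauss_rows2) = (\<integral>f. S f * S f * S f \<partial>gauss_rows2)
      + 12 * ((\<integral>f. S f * x f * x f \<partial>gauss_rows2) + (\<integral>f. S f * y f * y f \<partial>gauss_rows2) + (\<integral>f. S f * z f * z f \<partial>gauss_rows2))
      + 48 * (\<integral>f. x f * y f * z f \<partial>gauss_rows2)"
proof -
  have qW: "quadratic W" unfolding W_def by (intro quadratic_add quadratic_cmult q)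
  have iW3: "integrable gauss_rows2 (\<lambda>f. W f ^ 3)"
    using integrable_quadratic3[OF qW qW qW] by (simp add: power3_eq_cube)
  let ?F = "\<lambda>i f. f(i := - f i) :: nat \<times> nat \<Rightarrow> 'a"
  have W0: "W (?F (0,0) f) = S f + 2 * (- x f - y f + z f)" for f by (simp only: W_def S x y z) simp
  have W1: "W (?F (0,1) f) = S f + 2 * (- x f + y f - z f)" for f by (simp only: W_def S x y z) simp
  have W2: "W (?F (0,2) f) = S f + 2 * (x f - y f - z f)" for f by (simp only: W_def S x y z) simp
  have upd: "integrable gauss_rows2 (\<lambda>f. F (?F i f))" if "integrable gauss_rows2 F" "i \<in> rows2" for F :: "(nat \<times> nat \<Rightarrow> 'a) \<Rightarrow> real" and i
    using that by (intro integral_PiM_gauss_update(1)) (auto simp: distr_gauss_uminus)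
  have mem: "(0,0) \<in> rows2" "(0,1) \<in> rows2" "(0,2) \<in> rows2" by auto
  have four: "4 * (\<integral>f. H (W f) \<partial>gauss_rows2) = (\<integral>f. H (W f) + H (W (?F (0,0) f)) + H (W (?F (0,1) f)) + H (W (?F (0,2) f)) \<partial>gauss_rows2)"
    if "integrable gauss_rows2 (\<lambda>f. H (W f))" for H :: "real \<Rightarrow> real"
    using that upd[OF that mem(1)] upd[OF that mem(2)] upd[OF that mem(3)]
      integral_flip[OF that mem(1)] integral_flip[OF that mem(2)] integral_flip[OF that mem(3)]
    by simp
  have "4 * (\<integral>f. W f \<partial>gauss_rows2) = (\<integral>f. 4 * S f \<partial>gauss_rows2)"
    unfolding four[of "\<lambda>r. r", OF integrable_quadratic[OF qW]] W0 W1 W2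
    by (intro Bochner_Integration.integral_cong refl) (simp add: W_def)
  then show "(\<integral>f. W f \<partial>gauss_rows2) = (\<integral>f. S f \<partial>gauss_rows2)" by simp
  note int3 = integrable_quadratic3[OF q(1) q(1) q(1)] integrable_quadratic3[OF q(1) q(2) q(2)]
    integrable_quadratic3[OF q(1) q(3) q(3)] integrable_quadratic3[OF q(1) q(4) q(4)] integrable_quadratic3[OF q(2) q(3) q(4)]
  have "4 * (\<integral>f. W f ^ 3 \<partial>gauss_rows2) = (\<integral>f. 4 * (S f * S f * S f + 12 * (S f * x f * x f + S f * y f * y f + S f * z f * z f) + 48 * (x f * y f * z f)) \<partial>gauss_rows2)"
    unfolding four[of "\<lambda>r. r ^ 3", OF iW3] W0 W1 W2
    by (intro Bochner_Integration.integral_cong refl) (simp add: W_def power3_eq_cube algebra_simps)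
  also have "\<dots> = 4 * ((\<integral>f. S f * S f * S f \<partial>gauss_rows2)
      + 12 * ((\<integral>f. S f * x f * x f \<partial>gauss_rows2) + (\<integral>f. S f * y f * y f \<partial>gauss_rows2) + (\<integral>f. S f * z f * z f \<partial>gauss_rows2))
      + 48 * (\<integral>f. x f * y f * z f \<partial>gauss_rows2))"
    using int3 by simp
  finally show "(\<integral>f. W f ^ 3 \<partial>gauss_rows2) = (\<integral>f. S f * S f * S f \<partial>gauss_rows2)
      + 12 * ((\<integral>f. S f * x f * x f \<partial>gauss_rows2) + (\<integral>f. S f * y f * y f \<partial>gauss_rows2) + (\<integral>f. S f * z f * z f \<partial>gauss_rows2))
      + 48 * (\<integral>f. x f * y f * z f \<partial>gauss_rows2)" by simp
qed

section \<open>Permanental minors against the Gram determinant\<close>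

text \<open>What the three algebras have in common. In the last assumption, \<open>\<Sum>u\<in>Basis. u * w * cj u\<close> is a multiple of
  \<open>w\<close> in the commutative cases and \<open>4 Re w\<close> for quaternions, and \<open>x * y\<close> and \<open>y * x\<close> have the same real
  part; so the sum is a nonnegative multiple of a square.\<close>

locale conj_algebra =
  fixes cj :: "'a::{real_normed_algebra_1, euclidean_space} \<Rightarrow> 'a"
  assumes norm_times: "norm (x * y) = norm x * norm (y::'a)"
    and norm_cj: "norm (cj x) = norm x"
    and inner_times_left: "(x * y) \<bullet> z = y \<bullet> (cj x * z)"
    and inner_times_right: "(x * y) \<bullet> z = x \<bullet> (z * cj y)"
    and cj_times: "cj (x * y) = cj y * cj x"
    and cj_cj: "cj (cj x) = x"
    and distr_times_Basis: "u \<in> Basis \<Longrightarrow> distr gauss borel (\<lambda>x. u * x :: 'a) = gauss"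
    and twisted_trace_nonneg: "0 \<le> (\<Sum>u\<in>Basis. (u * c * (x * y) * cj (u * c)) \<bullet> (y * x))"
begin

lemma measurable_cj [measurable]: "cj \<in> borel_measurable borel"
proof (rule borel_measurable_euclidean_space[THEN iffD2], rule)
  fix b :: 'a
  have "cj x \<bullet> b = (x * b) \<bullet> 1" for x
    using inner_times_left[of x b 1] by (simp add: inner_commute)
  then show "(\<lambda>x. cj x \<bullet> b) \<in> borel_measurable borel" by simp
qed

lemma inner_times_common:
  fixes x y z :: 'a
  shows "(x * z) \<bullet> (y * z) = (norm z)\<^sup>2 * (x \<bullet> y)" "(z * x) \<bullet> (z * y) = (norm z)\<^sup>2 * (x \<bullet> y)"
proof -
  have sq: "(w * z) \<bullet> (w * z) = (norm z)\<^sup>2 * (w \<bullet> w)" "(z * w) \<bullet> (z * w) = (norm z)\<^sup>2 * (w \<bullet> w)" for w :: 'a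
    unfolding power2_norm_eq_inner[symmetric] by (simp_all add: norm_times power_mult_distrib)
  have pol: "4 * (a \<bullet> b) = (a + b) \<bullet> (a + b) - (a - b) \<bullet> (a - b)" for a b :: 'a
    by (simp add: inner_add_left inner_add_right inner_diff_left inner_diff_right inner_commute)
  have "4 * ((x * z) \<bullet> (y * z)) = (norm z)\<^sup>2 * (4 * (x \<bullet> y))"
    unfolding pol[of "x * z"] distrib_right[symmetric] left_diff_distrib[symmetric] sq pol[of x y]
    by (simp add: right_diff_distrib)
  then show "(x * z) \<bullet> (y * z) = (norm z)\<^sup>2 * (x \<bullet> y)" by simp
  have "4 * ((z * x) \<bullet> (z * y)) = (norm z)\<^sup>2 * (4 * (x \<bullet> y))"
    unfolding pol[of "z * x"] distrib_left[symmetric] right_diff_distrib[symmetric] sq pol[of x y]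
    by (simp add: right_diff_distrib)
  then show "(z * x) \<bullet> (z * y) = (norm z)\<^sup>2 * (x \<bullet> y)" by simp
qed

text \<open>Parseval's identity: moved across the inner product, each factor becomes the coordinate of a
  fixed vector in the direction \<open>u\<close>.\<close>

lemma sum_Basis_times:
  "(\<Sum>u\<in>Basis. ((u * x) \<bullet> p) * ((u * y) \<bullet> q)) = (p * cj x) \<bullet> (q * cj y)"
proof -
  have flip: "(u * x) \<bullet> p = (p * cj x) \<bullet> u" for u x p :: 'a
    using inner_times_right[of u x p] inner_commute[of u "p * cj x"] by (rule trans)
  have "(\<Sum>u\<in>Basis. ((u * x) \<bullet> p) * ((u * y) \<bullet> q)) = (\<Sum>u\<in>Basis. ((p * cj x) \<bullet> u) * ((q * cj y) \<bullet> u))"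
    by (intro sum.cong refl arg_cong2[of _ _ _ _ "(*)"] flip)
  also have "\<dots> = (p * cj x) \<bullet> (q * cj y)"
    by (rule euclidean_inner[symmetric])
  finally show ?thesis .
qed

lemma sum_Basis_times_self:
  "(\<Sum>u\<in>Basis. ((u * x) \<bullet> (p :: 'a))\<^sup>2) = (norm x)\<^sup>2 * (norm p)\<^sup>2"
  using sum_Basis_times[of x p x p]
  by (simp add: power2_eq_square[symmetric] power2_norm_eq_inner[symmetric] norm_times norm_cj power_mult_distrib)

text \<open>With \<open>a i = f (0, i)\<close> and \<open>b j = f (1, j)\<close>, this is the part without interference that the
  permanental minors and the Gram determinant share.\<close>

definition split_sq :: "(nat \<times> nat \<Rightarrow> 'a) \<Rightarrow> real" where
  "split_sq f = (\<Sum>i<3. \<Sum>j\<in>{..<3} - {i}. (norm (f (0, i)))\<^sup>2 * (norm (f (1, j)))\<^sup>2)"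

text \<open>The interference of the two products in the permanental minor \<open>a i * b j + a j * b i\<close>.\<close>

definition cross_perm :: "nat \<Rightarrow> nat \<Rightarrow> (nat \<times> nat \<Rightarrow> 'a) \<Rightarrow> real" where
  "cross_perm i j f = (f (0, i) * f (1, j)) \<bullet> (f (0, j) * f (1, i))"

text \<open>The interference of the summands \<open>a i * cj (b i)\<close> and \<open>a j * cj (b j)\<close> in the inner product of
  the two rows. In the commutative cases it agrees with the interference in the minors.\<close>

definition cross_gram :: "nat \<Rightarrow> nat \<Rightarrow> (nat \<times> nat \<Rightarrow> 'a) \<Rightarrow> real" where
  "cross_gram i j f = (f (0, i) * cj (f (1, i))) \<bullet> (f (0, j) * cj (f (1, j)))"

text \<open>The squared length of the vector of permanental minors (\<open>sum_norm_perm_minor\<close>).\<close>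

definition perm_minor_sq :: "(nat \<times> nat \<Rightarrow> 'a) \<Rightarrow> real" where
  "perm_minor_sq f = split_sq f + 2 * (cross_perm 0 1 f + cross_perm 0 2 f + cross_perm 1 2 f)"

text \<open>The Gram determinant of the two rows (\<open>gram_det2_eq\<close>).\<close>

definition gram_det2 :: "(nat \<times> nat \<Rightarrow> 'a) \<Rightarrow> real" where
  "gram_det2 f = split_sq f - 2 * (cross_gram 0 1 f + cross_gram 0 2 f + cross_gram 1 2 f)"

lemma measurable_entry: "p \<in> rows2 \<Longrightarrow> (\<lambda>f. f p) \<in> measurable gauss_rows2 (borel :: 'a measure)"
  using measurable_component_singleton[of p rows2 "\<lambda>_. gauss :: 'a measure"] by simp

lemma quadratic_cross_perm: "i < 3 \<Longrightarrow> j < 3 \<Longrightarrow> quadratic (cross_perm i j)"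
  by (rule quadraticI[of _ "(0, i)" "(1, j)" "(0, j)" "(1, i)"])
     (auto simp: cross_perm_def[abs_def] norm_times intro!: order_trans[OF Cauchy_Schwarz_ineq2]
       borel_measurable_inner borel_measurable_times measurable_entry)

lemma quadratic_cross_gram: "i < 3 \<Longrightarrow> j < 3 \<Longrightarrow> quadratic (cross_gram i j)"
proof (rule quadraticI[of _ "(0, i)" "(1, i)" "(0, j)" "(1, j)"])
  assume ij: "i < 3" "j < 3"
  have [measurable]: "(\<lambda>f. f (r, k)) \<in> measurable gauss_rows2 (borel :: 'a measure)" if "r \<le> 1" "k < 3" for r k
    using that by (intro measurable_entry) simp
  show "cross_gram i j \<in> borel_measurable gauss_rows2"
    unfolding cross_gram_def[abs_def] using ij by measurable
  fix f :: "nat \<times> nat \<Rightarrow> 'a"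
  show "\<bar>cross_gram i j f\<bar> \<le> norm (f (0, i)) * norm (f (1, i)) * (norm (f (0, j)) * norm (f (1, j)))"
    using Cauchy_Schwarz_ineq2[of "f (0, i) * cj (f (1, i))" "f (0, j) * cj (f (1, j))"]
    by (simp add: cross_gram_def norm_times norm_cj)
qed auto

lemma quadratic_split_sq: "quadratic split_sq"
proof -
  have t: "quadratic (\<lambda>f::nat \<times> nat \<Rightarrow> 'a. (norm (f (0, i)))\<^sup>2 * (norm (f (1, j)))\<^sup>2)" if "i < 3" "j < 3" for i j
    using that by (intro quadraticI[of _ "(0, i)" "(0, i)" "(1, j)" "(1, j)"])
      (auto simp: power2_eq_square intro!: borel_measurable_times borel_measurable_norm[THEN measurable_compose_rev] measurable_entry)
  have eq: "split_sq = (\<lambda>f. (norm (f (0, 0)))\<^sup>2 * (norm (f (1, 1)))\<^sup>2 + (norm (f (0, 0)))\<^sup>2 * (norm (f (1, 2)))\<^sup>2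
     + ((norm (f (0, 1)))\<^sup>2 * (norm (f (1, 0)))\<^sup>2 + (norm (f (0, 1)))\<^sup>2 * (norm (f (1, 2)))\<^sup>2)
     + ((norm (f (0, 2)))\<^sup>2 * (norm (f (1, 0)))\<^sup>2 + (norm (f (0, 2)))\<^sup>2 * (norm (f (1, 1)))\<^sup>2))"
    by (simp add: fun_eq_iff split_sq_def lessThan_3 insert_Diff_if)
  show ?thesis unfolding eq by (intro quadratic_add t) simp_all
qed

lemma norm_Basis_times [simp]: "u \<in> Basis \<Longrightarrow> norm (u * x) = norm (x :: 'a)"
  by (simp add: norm_times)

lemma split_sq_update:
  assumes "norm (y :: 'a) = norm (f p)" shows "split_sq (f(p := y)) = split_sq f"
proof -
  have "norm ((f(p := y)) q) = norm (f q)" for q using assms by simp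
  then show ?thesis by (simp only: split_sq_def)
qed

lemma DIM_mult_integral:
  fixes F :: "(nat \<times> nat \<Rightarrow> 'a) \<Rightarrow> real"
  assumes F: "integrable gauss_rows2 F" and p: "p \<in> rows2"
    and H: "\<And>f. (\<Sum>u\<in>Basis. F (f(p := u * f p))) = H f"
  shows "DIM('a) * (\<integral>f. F f \<partial>gauss_rows2) = (\<integral>f. H f \<partial>gauss_rows2)" "integrable gauss_rows2 H"
proof -
  have m: "(\<lambda>x. u * x) \<in> borel_measurable borel" for u :: 'a by measurable
  have i: "integrable gauss_rows2 (\<lambda>f. F (f(p := u * f p)))"
    and e: "(\<integral>f. F (f(p := u * f p)) \<partial>gauss_rows2) = (\<integral>f. F f \<partial>gauss_rows2)" if "u \<in> Basis" for u
    using integral_PiM_gauss_update[OF finite_rows2 p m distr_times_Basis[OF that] F] by auto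
  have Hf: "H = (\<lambda>f. \<Sum>u\<in>Basis. F (f(p := u * f p)))" by (simp add: H fun_eq_iff)
  show "integrable gauss_rows2 H" unfolding Hf by (intro Bochner_Integration.integrable_sum i)
  show "DIM('a) * (\<integral>f. F f \<partial>gauss_rows2) = (\<integral>f. H f \<partial>gauss_rows2)"
    unfolding Hf by (simp add: Bochner_Integration.integral_sum i e)
qed

text \<open>Averaging over the phase of \<open>a i\<close> replaces both squared cross terms by the same product of squared
  norms.\<close>

lemma integral_split_cross_eq:
  assumes ij: "i < 3" "j < 3" "i \<noteq> j"
  shows "(\<integral>f. split_sq f * cross_perm i j f * cross_perm i j f \<partial>gauss_rows2) = (\<integral>f. split_sq f * cross_gram i j f * cross_gram i j f \<partial>gauss_rows2)"
proof -
  let ?H = "\<lambda>f::nat \<times> nat \<Rightarrow> 'a. split_sq f * ((norm (f (0, i)))\<^sup>2 * (norm (f (1, j)))\<^sup>2 * ((norm (f (0, j)))\<^sup>2 * (norm (f (1, i)))\<^sup>2))"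
  have p: "(0, i) \<in> rows2" using ij by simp
  have S: "split_sq (f((0, i) := u * f (0, i))) = split_sq f" if "u \<in> Basis" for u and f :: "nat \<times> nat \<Rightarrow> 'a"
    by (intro split_sq_update norm_Basis_times that)
  have "DIM('a) * (\<integral>f. split_sq f * cross_perm i j f * cross_perm i j f \<partial>gauss_rows2) = (\<integral>f. ?H f \<partial>gauss_rows2)"
  proof (rule DIM_mult_integral(1)[OF _ p])
    show "integrable gauss_rows2 (\<lambda>f. split_sq f * cross_perm i j f * cross_perm i j f)"
      by (intro integrable_quadratic3 quadratic_split_sq quadratic_cross_perm ij)
    fix f :: "nat \<times> nat \<Rightarrow> 'a"
    have "(\<Sum>u\<in>Basis. split_sq (f((0, i) := u * f (0, i))) * cross_perm i j (f((0, i) := u * f (0, i))) * cross_perm i j (f((0, i) := u * f (0, i))))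
       = split_sq f * (\<Sum>u\<in>Basis. ((u * (f (0, i) * f (1, j))) \<bullet> (f (0, j) * f (1, i)))\<^sup>2)"
      using ij by (simp add: S cross_perm_def sum_distrib_left mult.assoc power2_eq_square)
    then show "(\<Sum>u\<in>Basis. split_sq (f((0, i) := u * f (0, i))) * cross_perm i j (f((0, i) := u * f (0, i))) * cross_perm i j (f((0, i) := u * f (0, i)))) = ?H f"
      by (simp only: sum_Basis_times_self norm_times power_mult_distrib)
  qed
  moreover have "DIM('a) * (\<integral>f. split_sq f * cross_gram i j f * cross_gram i j f \<partial>gauss_rows2) = (\<integral>f. ?H f \<partial>gauss_rows2)"
  proof (rule DIM_mult_integral(1)[OF _ p])
    show "integrable gauss_rows2 (\<lambda>f. split_sq f * cross_gram i j f * cross_gram i j f)"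
      by (intro integrable_quadratic3 quadratic_split_sq quadratic_cross_gram ij)
    fix f :: "nat \<times> nat \<Rightarrow> 'a"
    have "(\<Sum>u\<in>Basis. split_sq (f((0, i) := u * f (0, i))) * cross_gram i j (f((0, i) := u * f (0, i))) * cross_gram i j (f((0, i) := u * f (0, i))))
       = split_sq f * (\<Sum>u\<in>Basis. ((u * (f (0, i) * cj (f (1, i)))) \<bullet> (f (0, j) * cj (f (1, j))))\<^sup>2)"
      using ij by (simp add: S cross_gram_def sum_distrib_left mult.assoc power2_eq_square)
    also have "\<dots> = ?H f"
      unfolding sum_Basis_times_self norm_times norm_cj power_mult_distrib by (simp add: ac_simps)
    finally show "(\<Sum>u\<in>Basis. split_sq (f((0, i) := u * f (0, i))) * cross_gram i j (f((0, i) := u * f (0, i))) * cross_gram i j (f((0, i) := u * f (0, i)))) = ?H f" .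
  qed
  ultimately have "real DIM('a) * (\<integral>f. split_sq f * cross_perm i j f * cross_perm i j f \<partial>gauss_rows2)
      = real DIM('a) * (\<integral>f. split_sq f * cross_gram i j f * cross_gram i j f \<partial>gauss_rows2)"
    by (rule trans[OF _ sym])
  then show ?thesis
    using DIM_positive[where 'a='a] by (simp only: mult_cancel_left of_nat_eq_0_iff) simp
qed

text \<open>Averaging over the phases of \<open>a 0\<close> and \<open>a 1\<close> eliminates the first row up to norms, and the remaining
  expression in the second row, averaged over the phase of \<open>b 0\<close>, is the twisted trace of the locale.\<close>

lemma integral_triangle_perm_nonneg:
  "0 \<le> (\<integral>f. cross_perm 0 1 f * cross_perm 0 2 f * cross_perm 1 2 f \<partial>gauss_rows2)" (is "0 \<le> ?I")
proof -
  let ?Y = "\<lambda>f::nat \<times> nat \<Rightarrow> 'a. (norm (f (0, 0)))\<^sup>2 *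
     ((f (0, 1) * (f (1, 0) * cj (f (1, 1)))) \<bullet> (f (0, 2) * (f (1, 0) * cj (f (1, 2))))) * cross_perm 1 2 f"
  let ?Z = "\<lambda>f::nat \<times> nat \<Rightarrow> 'a. (norm (f (0, 0)))\<^sup>2 * ((norm (f (0, 1)))\<^sup>2 * (norm (f (0, 2)))\<^sup>2) *
     ((f (1, 0) * (cj (f (1, 2)) * f (1, 1)) * cj (f (1, 0))) \<bullet> (f (1, 1) * cj (f (1, 2))))"
  let ?X = "\<lambda>f::nat \<times> nat \<Rightarrow> 'a. (norm (f (0, 0)))\<^sup>2 * ((norm (f (0, 1)))\<^sup>2 * (norm (f (0, 2)))\<^sup>2) *
     (\<Sum>u\<in>Basis. (u * f (1, 0) * (cj (f (1, 2)) * f (1, 1)) * cj (u * f (1, 0))) \<bullet> (f (1, 1) * cj (f (1, 2))))"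
  have int0: "integrable gauss_rows2 (\<lambda>f. cross_perm 0 1 f * cross_perm 0 2 f * cross_perm 1 2 f)"
    by (intro integrable_quadratic3 quadratic_cross_perm) simp_all
  have s1: "(\<Sum>u\<in>Basis. cross_perm 0 1 (f((0, 0) := u * f (0, 0))) * cross_perm 0 2 (f((0, 0) := u * f (0, 0)))
      * cross_perm 1 2 (f((0, 0) := u * f (0, 0)))) = ?Y f" for f :: "nat \<times> nat \<Rightarrow> 'a"
  proof -
    have "(\<Sum>u\<in>Basis. cross_perm 0 1 (f((0, 0) := u * f (0, 0))) * cross_perm 0 2 (f((0, 0) := u * f (0, 0)))
      * cross_perm 1 2 (f((0, 0) := u * f (0, 0))))
      = (\<Sum>u\<in>Basis. ((u * (f (0, 0) * f (1, 1))) \<bullet> (f (0, 1) * f (1, 0))) * ((u * (f (0, 0) * f (1, 2))) \<bullet> (f (0, 2) * f (1, 0)))) * cross_perm 1 2 f"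
      by (simp add: cross_perm_def sum_distrib_right mult.assoc)
    also have "\<dots> = ?Y f"
      unfolding sum_Basis_times cj_times
      using inner_times_common(1)[of "f (0, 1) * (f (1, 0) * cj (f (1, 1)))" "cj (f (0, 0))" "f (0, 2) * (f (1, 0) * cj (f (1, 2)))"]
      by (simp add: mult.assoc norm_cj)
    finally show ?thesis .
  qed
  note Y = DIM_mult_integral[OF int0 _ s1]
  have s2: "(\<Sum>u\<in>Basis. ?Y (f((0, 1) := u * f (0, 1)))) = ?Z f" for f :: "nat \<times> nat \<Rightarrow> 'a"
  proof -
    have "(\<Sum>u\<in>Basis. ?Y (f((0, 1) := u * f (0, 1)))) = (norm (f (0, 0)))\<^sup>2 *
       (\<Sum>u\<in>Basis. ((u * (f (0, 1) * (f (1, 0) * cj (f (1, 1))))) \<bullet> (f (0, 2) * (f (1, 0) * cj (f (1, 2)))))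
         * ((u * (f (0, 1) * f (1, 2))) \<bullet> (f (0, 2) * f (1, 1))))"
      by (simp add: cross_perm_def sum_distrib_left mult.assoc)
    also have "\<dots> = ?Z f"
      unfolding sum_Basis_times cj_times cj_cj
      using inner_times_common(1)[of "f (0, 2) * (f (1, 0) * (cj (f (1, 2)) * f (1, 1)) * cj (f (1, 0)))" "cj (f (0, 1))"
          "f (0, 2) * (f (1, 1) * cj (f (1, 2)))"]
        inner_times_common(2)[of "f (0, 2)" "f (1, 0) * (cj (f (1, 2)) * f (1, 1)) * cj (f (1, 0))" "f (1, 1) * cj (f (1, 2))"]
      by (simp add: mult.assoc norm_cj)
    finally show ?thesis .
  qed
  note Z = DIM_mult_integral[OF Y(2) _ s2]
  have s3: "(\<Sum>u\<in>Basis. ?Z (f((1, 0) := u * f (1, 0)))) = ?X f" for f :: "nat \<times> nat \<Rightarrow> 'a"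
    by (simp add: sum_distrib_left)
  note X = DIM_mult_integral[OF Z(2) _ s3]
  have "0 \<le> (\<integral>f. ?X f \<partial>gauss_rows2)"
    by (intro Bochner_Integration.integral_nonneg mult_nonneg_nonneg twisted_trace_nonneg) simp_all
  moreover have "DIM('a) * (DIM('a) * (DIM('a) * ?I)) = (\<integral>f. ?X f \<partial>gauss_rows2)"
    using X(1) Z(1) Y(1) by simp
  ultimately have "0 \<le> real DIM('a) * (real DIM('a) * (real DIM('a) * ?I))" by simp
  then show ?thesis using DIM_positive[where 'a='a] by (simp add: zero_le_mult_iff)
qed

text \<open>With \<open>w i = a i * cj (b i)\<close>, averaging over the phase of \<open>a 0\<close> turns the triangle into
  \<open>(norm (w 0))\<^sup>2 * (w 1 \<bullet> w 2)\<^sup>2\<close>, and averaging over the phase of \<open>a 1\<close> leaves a product of squared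
  norms, whose mean is positive.\<close>

lemma integral_triangle_gram_pos:
  "0 < (\<integral>f. cross_gram 0 1 f * cross_gram 0 2 f * cross_gram 1 2 f \<partial>gauss_rows2)" (is "0 < ?I")
proof -
  let ?w = "\<lambda>f i. f (0, i) * cj (f (1, i)) :: 'a"
  let ?Y = "\<lambda>f::nat \<times> nat \<Rightarrow> 'a. (norm (?w f 0))\<^sup>2 * (?w f 1 \<bullet> ?w f 2)\<^sup>2"
  let ?Z = "\<lambda>f::nat \<times> nat \<Rightarrow> 'a. (norm (?w f 0))\<^sup>2 * ((norm (?w f 1))\<^sup>2 * (norm (?w f 2))\<^sup>2)"
  have int0: "integrable gauss_rows2 (\<lambda>f. cross_gram 0 1 f * cross_gram 0 2 f * cross_gram 1 2 f)"
    by (intro integrable_quadratic3 quadratic_cross_gram) simp_all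
  have s1: "(\<Sum>u\<in>Basis. cross_gram 0 1 (f((0, 0) := u * f (0, 0))) * cross_gram 0 2 (f((0, 0) := u * f (0, 0)))
      * cross_gram 1 2 (f((0, 0) := u * f (0, 0)))) = ?Y f" for f :: "nat \<times> nat \<Rightarrow> 'a"
  proof -
    have "(\<Sum>u\<in>Basis. cross_gram 0 1 (f((0, 0) := u * f (0, 0))) * cross_gram 0 2 (f((0, 0) := u * f (0, 0)))
      * cross_gram 1 2 (f((0, 0) := u * f (0, 0))))
      = (\<Sum>u\<in>Basis. ((u * ?w f 0) \<bullet> ?w f 1) * ((u * ?w f 0) \<bullet> ?w f 2)) * (?w f 1 \<bullet> ?w f 2)"
      by (simp add: cross_gram_def sum_distrib_right mult.assoc)
    also have "\<dots> = ?Y f"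
      unfolding sum_Basis_times inner_times_common(1) norm_cj by (simp add: power2_eq_square)
    finally show ?thesis .
  qed
  note Y = DIM_mult_integral[OF int0 _ s1]
  have s2: "(\<Sum>u\<in>Basis. ?Y (f((0, 1) := u * f (0, 1)))) = ?Z f" for f :: "nat \<times> nat \<Rightarrow> 'a"
  proof -
    have "(\<Sum>u\<in>Basis. ?Y (f((0, 1) := u * f (0, 1)))) = (norm (?w f 0))\<^sup>2 * (\<Sum>u\<in>Basis. ((u * ?w f 1) \<bullet> ?w f 2)\<^sup>2)"
      by (simp add: sum_distrib_left mult.assoc)
    then show ?thesis by (simp only: sum_Basis_times_self)
  qed
  note Z = DIM_mult_integral[OF Y(2) _ s2]
  interpret product_sigma_finite "\<lambda>_. gauss :: 'a measure"
    unfolding product_sigma_finite_def by (auto intro: prob_space_imp_sigma_finite prob_space_gauss)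
  have int: "integrable gauss (\<lambda>x::'a. (norm x)\<^sup>2)"
    using nn_integral_norm_gauss_finite[where 'a='a, of 1] by (simp add: integrable_iff_bounded)
  have pos: "0 < (\<integral>x. (norm (x::'a))\<^sup>2 \<partial>gauss)"
    using nn_integral_norm_gauss_pos[where 'a='a, of 1] int by (simp add: nn_integral_eq_integral)
  have "?Z f = (\<Prod>p\<in>rows2. (norm (f p))\<^sup>2)" for f
  proof -
    have r2: "rows2 = {(0,0),(0,1),(0,2),(1,0),(1,1),(1,2)}" by (auto simp: rows2_def)
    show ?thesis unfolding r2 by (simp add: norm_times norm_cj power_mult_distrib ac_simps)
  qed
  then have "(\<integral>f. ?Z f \<partial>gauss_rows2) = (\<integral>f. (\<Prod>p\<in>rows2. (norm (f p :: 'a))\<^sup>2) \<partial>gauss_rows2)" by simp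
  also have "\<dots> = (\<Prod>p\<in>rows2. (\<integral>x. (norm (x::'a))\<^sup>2 \<partial>gauss))"
    by (intro product_integral_prod int) simp
  also have "0 < \<dots>" using pos by (intro prod_pos) auto
  finally have "0 < (\<integral>f. ?Z f \<partial>gauss_rows2)" .
  moreover have "DIM('a) * (DIM('a) * ?I) = (\<integral>f. ?Z f \<partial>gauss_rows2)"
    using Z(1) Y(1) by simp
  ultimately have "0 < real DIM('a) * (real DIM('a) * ?I)" by simp
  then show ?thesis using DIM_positive[where 'a='a] by (simp add: zero_less_mult_iff)
qed

text \<open>After the averages over signs and phases the two cubes differ only in their triangles, which the permanent counts
  positively and the Gram determinant negatively.\<close>

lemma integral_perm_minor_vs_gram:
  "(\<integral>f. perm_minor_sq f \<partial>gauss_rows2) = (\<integral>f. gram_det2 f \<partial>gauss_rows2)"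
  "(\<integral>f. gram_det2 f ^ 3 \<partial>gauss_rows2) < (\<integral>f. perm_minor_sq f ^ 3 \<partial>gauss_rows2)"
proof -
  have S: "split_sq (f(p := - f p)) = split_sq f" for p and f :: "nat \<times> nat \<Rightarrow> 'a"
    by (rule split_sq_update) simp
  note P = integral_flip_average[where S = split_sq and x = "cross_perm 0 1" and y = "cross_perm 0 2" and z = "cross_perm 1 2"]
  have P1: "(\<integral>f. perm_minor_sq f \<partial>gauss_rows2) = (\<integral>f. split_sq f \<partial>gauss_rows2)"
    unfolding perm_minor_sq_def by (rule P(1)) (auto simp: quadratic_split_sq quadratic_cross_perm S cross_perm_def)
  have P3: "(\<integral>f. perm_minor_sq f ^ 3 \<partial>gauss_rows2) = (\<integral>f. split_sq f * split_sq f * split_sq f \<partial>gauss_rows2)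
      + 12 * ((\<integral>f. split_sq f * cross_perm 0 1 f * cross_perm 0 1 f \<partial>gauss_rows2) + (\<integral>f. split_sq f * cross_perm 0 2 f * cross_perm 0 2 f \<partial>gauss_rows2)
         + (\<integral>f. split_sq f * cross_perm 1 2 f * cross_perm 1 2 f \<partial>gauss_rows2))
      + 48 * (\<integral>f. cross_perm 0 1 f * cross_perm 0 2 f * cross_perm 1 2 f \<partial>gauss_rows2)"
    unfolding perm_minor_sq_def by (rule P(2)) (auto simp: quadratic_split_sq quadratic_cross_perm S cross_perm_def)
  have gram_det2': "gram_det2 f = split_sq f + 2 * (- cross_gram 0 1 f + - cross_gram 0 2 f + - cross_gram 1 2 f)" for f
    by (simp add: gram_det2_def)
  note D = integral_flip_average[where S = split_sq and x = "\<lambda>f. - cross_gram 0 1 f" and y = "\<lambda>f. - cross_gram 0 2 f" and z = "\<lambda>f. - cross_gram 1 2 f"]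
  have qD: "quadratic (\<lambda>f. - cross_gram 0 1 f)" "quadratic (\<lambda>f. - cross_gram 0 2 f)" "quadratic (\<lambda>f. - cross_gram 1 2 f)"
    by (intro quadratic_uminus quadratic_cross_gram; simp)+
  have D1: "(\<integral>f. gram_det2 f \<partial>gauss_rows2) = (\<integral>f. split_sq f \<partial>gauss_rows2)"
    unfolding gram_det2' by (rule D(1)[OF quadratic_split_sq qD]) (auto simp: S cross_gram_def)
  have D3: "(\<integral>f. gram_det2 f ^ 3 \<partial>gauss_rows2) = (\<integral>f. split_sq f * split_sq f * split_sq f \<partial>gauss_rows2)
      + 12 * ((\<integral>f. split_sq f * - cross_gram 0 1 f * - cross_gram 0 1 f \<partial>gauss_rows2) + (\<integral>f. split_sq f * - cross_gram 0 2 f * - cross_gram 0 2 f \<partial>gauss_rows2)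
         + (\<integral>f. split_sq f * - cross_gram 1 2 f * - cross_gram 1 2 f \<partial>gauss_rows2))
      + 48 * (\<integral>f. - cross_gram 0 1 f * - cross_gram 0 2 f * - cross_gram 1 2 f \<partial>gauss_rows2)"
    unfolding gram_det2' by (rule D(2)[OF quadratic_split_sq qD]) (auto simp: S cross_gram_def)
  show "(\<integral>f. perm_minor_sq f \<partial>gauss_rows2) = (\<integral>f. gram_det2 f \<partial>gauss_rows2)" by (simp add: P1 D1)
  have "(\<integral>f. - cross_gram 0 1 f * - cross_gram 0 2 f * - cross_gram 1 2 f \<partial>gauss_rows2) < 0"
    using integral_triangle_gram_pos by simp
  then show "(\<integral>f. gram_det2 f ^ 3 \<partial>gauss_rows2) < (\<integral>f. perm_minor_sq f ^ 3 \<partial>gauss_rows2)"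
    unfolding P3 D3 using integral_triangle_perm_nonneg
    by (simp add: integral_split_cross_eq)
qed

lemma quadratic_perm_minor_sq: "quadratic perm_minor_sq"
  unfolding perm_minor_sq_def[abs_def] by (intro quadratic_add quadratic_cmult quadratic_split_sq quadratic_cross_perm) simp_all

lemma quadratic_gram_det2: "quadratic gram_det2"
proof -
  have "quadratic (\<lambda>f. split_sq f + (-2) * (cross_gram 0 1 f + cross_gram 0 2 f + cross_gram 1 2 f))"
    by (intro quadratic_add quadratic_cmult quadratic_split_sq quadratic_cross_gram) simp_all
  moreover have "gram_det2 = (\<lambda>f. split_sq f + (-2) * (cross_gram 0 1 f + cross_gram 0 2 f + cross_gram 1 2 f))"
    by (simp add: fun_eq_iff gram_det2_def)
  ultimately show ?thesis by (simp only:)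
qed

end

section \<open>The third row\<close>

lemma sum_permutes_3:
  fixes F :: "(nat \<Rightarrow> nat) \<Rightarrow> 'b::comm_monoid_add"
  shows "(\<Sum>p | p permutes {0..<3}. F p) =
    (\<Sum>b\<in>{0,1,2}. \<Sum>c\<in>{1,2}. F (Transposition.transpose 0 b \<circ> (Transposition.transpose 1 c \<circ> id)))"
proof -
  have eq: "{0..<3} = insert 0 (insert 1 (insert (2::nat) {}))" by auto
  show ?thesis
    unfolding eq
    by (simp add: sum_over_permutations_insert del: One_nat_def)
qed

lemma per_3:
  fixes a :: "nat \<times> nat \<Rightarrow> 'b::semiring_1"
  shows "per (Matrix.mat 3 3 a) =
    (a (0,1) * a (1,2) + a (0,2) * a (1,1)) * a (2,0)
    + (a (0,0) * a (1,2) + a (0,2) * a (1,0)) * a (2,1)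
    + (a (0,0) * a (1,1) + a (0,1) * a (1,0)) * a (2,2)"
proof -
  have lt: "p i < 3" if "p permutes {0..<3}" "i < 3" for p :: "nat \<Rightarrow> nat" and i
    using permutes_in_image[OF that(1), of i] that(2) by simp
  have upt3: "[0..<3::nat] = [0, 1, 2]" by (simp add: upt_rec)
  have "per (Matrix.mat 3 3 a) = (\<Sum>p | p permutes {0..<3}. a (0, p 0) * a (1, p 1) * a (2, p 2))"
    unfolding per_def by (intro sum.cong) (auto simp: upt3 lt mult.assoc)
  then show ?thesis
    unfolding sum_permutes_3 by (simp add: Transposition.transpose_def algebra_simps)
qed

lemma det_3:
  fixes a :: "nat \<times> nat \<Rightarrow> 'b::comm_ring_1"
  shows "Determinant.det (Matrix.mat 3 3 a) =
    (a (0,1) * a (1,2) - a (0,2) * a (1,1)) * a (2,0)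
    + (a (0,2) * a (1,0) - a (0,0) * a (1,2)) * a (2,1)
    + (a (0,0) * a (1,1) - a (0,1) * a (1,0)) * a (2,2)"
proof -
  have lt: "p i < 3" if "p permutes {0..<3}" "i < 3" for p :: "nat \<Rightarrow> nat" and i
    using permutes_in_image[OF that(1), of i] that(2) by simp
  have set3: "{0..<3::nat} = {0, 1, 2}" by auto
  have sg: "sign (Transposition.transpose 0 b \<circ> (Transposition.transpose 1 c \<circ> id)) = (if b = 0 then 1 else -1) * (if c = 1 then 1 else - 1 :: int)"
    for b c :: nat
    by (auto simp: sign_compose permutation_swap_id permutation_compose sign_swap_id)
  have "Determinant.det (Matrix.mat 3 3 a) = (\<Sum>p | p permutes {0..<3}. signof p * (a (0, p 0) * a (1, p 1) * a (2, p 2)))"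
    unfolding Determinant.det_def
    by (simp, intro sum.cong refl) (auto simp: set3 lt mult.assoc)
  then show ?thesis
    unfolding sum_permutes_3 sg by (simp add: Transposition.transpose_def algebra_simps)
qed

definition row3 :: "(nat \<times> nat) set" where
  "row3 = Pair 2 ` {..<3}"

lemma finite_row3 [simp]: "finite row3" by (simp add: row3_def)

lemma sum_row3: "(\<Sum>j\<in>row3. g j) = (\<Sum>k<3. g (2, k))"
  unfolding row3_def by (subst sum.reindex) (auto simp: inj_on_def)

lemma rows2_Un_row3: "rows2 \<union> row3 = {0..<3} \<times> {0..<3}" "rows2 \<inter> row3 = {}"
  by (auto simp: rows2_def row3_def)

context conj_algebra
begin

definition perm_minor :: "(nat \<times> nat \<Rightarrow> 'a) \<Rightarrow> nat \<Rightarrow> 'a" where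
  "perm_minor f k = (if k = 0 then f (0,1) * f (1,2) + f (0,2) * f (1,1)
     else if k = 1 then f (0,0) * f (1,2) + f (0,2) * f (1,0)
     else f (0,0) * f (1,1) + f (0,1) * f (1,0))"

lemma per_expand_third_row: "per (Matrix.mat 3 3 f) = (\<Sum>k<3. perm_minor f k * f (2, k))"
  by (simp add: per_3 perm_minor_def lessThan_3 add.assoc)

lemma sum_norm_perm_minor: "(\<Sum>k<3. (norm (perm_minor f k))\<^sup>2) = perm_minor_sq f"
proof -
  have sq: "(norm (p + q))\<^sup>2 = (norm p)\<^sup>2 + (norm q)\<^sup>2 + 2 * (p \<bullet> q)" for p q :: 'a
    by (simp add: power2_norm_eq_inner inner_add_left inner_add_right inner_commute)
  show ?thesis
    by (simp add: lessThan_3 perm_minor_def sq perm_minor_sq_def split_sq_def cross_perm_def norm_times power_mult_distrib insert_Diff_if)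
qed

lemma nn_integral_row3_left:
  "(\<integral>\<^sup>+c. ennreal (norm (\<Sum>k<3. x k * c (2, k)) ^ (2 * m)) \<partial>PiM row3 (\<lambda>_. gauss))
    = ennreal ((\<Sum>k<3. (norm (x k :: 'a))\<^sup>2) ^ m) * (\<integral>\<^sup>+u. ennreal (norm (u::'a) ^ (2 * m)) \<partial>gauss)"
proof -
  have "(\<integral>\<^sup>+c. ennreal (norm (\<Sum>j\<in>row3. x (snd j) * c j) ^ (2 * m)) \<partial>PiM row3 (\<lambda>_. gauss))
    = ennreal ((\<Sum>j\<in>row3. (norm (x (snd j)))\<^sup>2) ^ m) * (\<integral>\<^sup>+u. ennreal (norm (u::'a) ^ (2 * m)) \<partial>gauss)"
    by (rule nn_integral_norm_sum_conformal[where L' = "\<lambda>j u. cj (x (snd j)) * u"])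
       (simp_all only: finite_row3 inner_times_left norm_times norm_cj)
  then show ?thesis by (simp add: sum_row3)
qed

lemma nn_integral_row3_right:
  "(\<integral>\<^sup>+c. ennreal (norm (\<Sum>k<3. c (2, k) * x k) ^ (2 * m)) \<partial>PiM row3 (\<lambda>_. gauss))
    = ennreal ((\<Sum>k<3. (norm (x k :: 'a))\<^sup>2) ^ m) * (\<integral>\<^sup>+u. ennreal (norm (u::'a) ^ (2 * m)) \<partial>gauss)"
proof -
  have "(\<integral>\<^sup>+c. ennreal (norm (\<Sum>j\<in>row3. c j * x (snd j)) ^ (2 * m)) \<partial>PiM row3 (\<lambda>_. gauss))
    = ennreal ((\<Sum>j\<in>row3. (norm (x (snd j)))\<^sup>2) ^ m) * (\<integral>\<^sup>+u. ennreal (norm (u::'a) ^ (2 * m)) \<partial>gauss)"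
    by (rule nn_integral_norm_sum_conformal[where L' = "\<lambda>j u. u * cj (x (snd j))"])
       (simp_all only: finite_row3 inner_times_right norm_times norm_cj mult.commute)
  then show ?thesis by (simp add: sum_row3)
qed

text \<open>The assumption \<open>conormal\<close> says that, for given first two rows, \<open>D\<close> is the squared norm of a linear
  expression in the third row whose coefficient vector has the Gram determinant as its squared length. Then
  conditioning on the first two rows gives the moments of \<open>\<Delta>\<close> and of \<open>X_var 3 A\<close> as the
  same constants \<open>K m\<close> times moments of the two forms that were compared above.\<close>

theorem stochastic_orders_fail:
  fixes A :: "'w \<Rightarrow> 'a mat" and D :: "'a mat \<Rightarrow> real"
  assumes "prob_space M" and A: "gaussian_matrix M 3 A"
    and D0: "\<And>B. 0 \<le> D B"
    and Dm: "(\<lambda>f. D (Matrix.mat 3 3 f)) \<in> borel_measurable (PiM ({0..<3} \<times> {0..<3}) (\<lambda>_. borel))"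
    and conormal: "\<And>f. \<exists>v. (\<Sum>k<3. (norm (v k))\<^sup>2) = gram_det2 f \<and>
      (\<forall>g. (\<forall>p\<in>rows2. g p = f p) \<longrightarrow> D (Matrix.mat 3 3 g) = (norm (\<Sum>k<3. g (2, k) * v k))\<^sup>2)"
  defines "\<Delta> \<equiv> \<lambda>\<omega>. D (A \<omega>) / 6"
  shows "\<not> st_le M \<Delta> (X_var 3 A) \<and> \<not> st_le M (X_var 3 A) \<Delta> \<and> \<not> cx_le M (X_var 3 A) \<Delta>"
proof -
  interpret prob_space M by fact
  interpret G: product_sigma_finite "\<lambda>_. gauss :: 'a measure"
    unfolding product_sigma_finite_def by (auto intro: prob_space_imp_sigma_finite prob_space_gauss)
  let ?I = "{0..<3} \<times> {0..<3} :: (nat \<times> nat) set"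
  let ?B = "PiM ?I (\<lambda>_. borel :: 'a measure)"
  let ?P = "PiM ?I (\<lambda>_. gauss :: 'a measure)"
  define Z where "Z = (\<lambda>\<omega>. \<lambda>ij\<in>?I. A \<omega> $$ ij)"
  have ind: "indep_vars (\<lambda>_. borel) (\<lambda>ij \<omega>. A \<omega> $$ ij) ?I"
    and std: "\<And>ij. ij \<in> ?I \<Longrightarrow> std_gaussian M (\<lambda>\<omega>. A \<omega> $$ ij)"
    and carr: "\<And>\<omega>. \<omega> \<in> space M \<Longrightarrow> A \<omega> \<in> carrier_mat 3 3"
    using A unfolding gaussian_matrix_def by auto
  have entry [measurable]: "\<And>ij. ij \<in> ?I \<Longrightarrow> (\<lambda>\<omega>. A \<omega> $$ ij) \<in> borel_measurable M"
    using std by (intro std_gaussian_measurable)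
  have Zm [measurable]: "Z \<in> measurable M ?B"
    unfolding Z_def by (intro measurable_restrict entry)
  have AZ: "A \<omega> = Matrix.mat 3 3 (Z \<omega>)" if "\<omega> \<in> space M" for \<omega>
    using carr[OF that] by (intro eq_matI) (auto simp: Z_def)
  have sets_eq: "sets ?P = sets ?B" by (intro sets_PiM_cong) auto
  have law: "distr M ?B Z = ?P"
  proof -
    have "distr M ?B Z = PiM ?I (\<lambda>ij. distr M borel (\<lambda>\<omega>. A \<omega> $$ ij))"
      unfolding Z_def using ind entry by (subst (asm) indep_vars_iff_distr_eq_PiM') auto
    also have "\<dots> = ?P"
      by (intro PiM_cong refl distr_std_gaussian prob_space_axioms std)
    finally show ?thesis .
  qed
  have transfer: "(\<integral>\<^sup>+\<omega>. H (A \<omega>) \<partial>M)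
      = (\<integral>\<^sup>+f. (\<integral>\<^sup>+c. H (Matrix.mat 3 3 (merge rows2 row3 (f, c))) \<partial>PiM row3 (\<lambda>_. gauss)) \<partial>gauss_rows2)"
    if Hm: "(\<lambda>f. H (Matrix.mat 3 3 f)) \<in> borel_measurable ?B" for H :: "'a mat \<Rightarrow> ennreal"
  proof -
    have "(\<integral>\<^sup>+\<omega>. H (A \<omega>) \<partial>M) = (\<integral>\<^sup>+\<omega>. H (Matrix.mat 3 3 (Z \<omega>)) \<partial>M)"
      by (intro nn_integral_cong) (simp add: AZ)
    also have "\<dots> = (\<integral>\<^sup>+f. H (Matrix.mat 3 3 f) \<partial>distr M ?B Z)"
      by (subst nn_integral_distr) (simp_all add: Hm Zm)
    also have "\<dots> = (\<integral>\<^sup>+f. H (Matrix.mat 3 3 f) \<partial>PiM (rows2 \<union> row3) (\<lambda>_. gauss))"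
      by (simp only: law rows2_Un_row3)
    also have "\<dots> = (\<integral>\<^sup>+f. (\<integral>\<^sup>+c. H (Matrix.mat 3 3 (merge rows2 row3 (f, c))) \<partial>PiM row3 (\<lambda>_. gauss)) \<partial>gauss_rows2)"
      using Hm measurable_cong_sets[OF sets_eq refl]
      by (intro G.product_nn_integral_fold) (simp_all add: rows2_Un_row3)
    finally show ?thesis .
  qed
  have merge_low: "merge rows2 row3 (f, c) p = f p" if "p \<in> rows2" for f c :: "nat \<times> nat \<Rightarrow> 'a" and p
    using that by (simp add: merge_def)
  have merge_top: "merge rows2 row3 (f, c) (2, k) = c (2, k)" if "k < 3" for f c :: "nat \<times> nat \<Rightarrow> 'a" and k
    using that by (simp add: merge_def row3_def)
  have perm: "(\<lambda>f. per (Matrix.mat 3 3 f)) \<in> borel_measurable ?B"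
  proof -
    have [measurable]: "(\<lambda>f. f (i, j)) \<in> borel_measurable ?B" if "i < 3" "j < 3" for i j
      using that by (intro measurable_component_singleton) auto
    show ?thesis unfolding per_3 by measurable
  qed
  define K where "K = (\<lambda>m. \<integral>\<^sup>+u. ennreal (norm (u::'a) ^ (2 * m)) \<partial>gauss)"
  have momP: "(\<integral>\<^sup>+\<omega>. ennreal (norm (per (A \<omega>)) ^ (2 * m)) \<partial>M) = (\<integral>\<^sup>+f. ennreal (perm_minor_sq f ^ m) * K m \<partial>gauss_rows2)" for m
  proof -
    have "(\<integral>\<^sup>+\<omega>. ennreal (norm (per (A \<omega>)) ^ (2 * m)) \<partial>M)
       = (\<integral>\<^sup>+f. (\<integral>\<^sup>+c. ennreal (norm (per (Matrix.mat 3 3 (merge rows2 row3 (f :: nat \<times> nat \<Rightarrow> 'a, c)))) ^ (2 * m)) \<partial>PiM row3 (\<lambda>_. gauss)) \<partial>gauss_rows2)"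
      by (rule transfer[of "\<lambda>B. ennreal (norm (per B) ^ (2 * m))"]) (use perm in measurable)
    also have "\<dots> = (\<integral>\<^sup>+f. (\<integral>\<^sup>+c. ennreal (norm (\<Sum>k<3. perm_minor f k * c (2, k)) ^ (2 * m)) \<partial>PiM row3 (\<lambda>_. gauss)) \<partial>gauss_rows2)"
    proof (intro nn_integral_cong arg_cong[of _ _ ennreal] arg_cong[of _ _ "\<lambda>y. norm y ^ (2 * m)"])
      fix f c :: "nat \<times> nat \<Rightarrow> 'a"
      have "perm_minor (merge rows2 row3 (f, c)) k = perm_minor f k" for k
        by (simp only: perm_minor_def) (simp add: merge_low)
      then show "per (Matrix.mat 3 3 (merge rows2 row3 (f, c))) = (\<Sum>k<3. perm_minor f k * c (2, k))"
        unfolding per_expand_third_row by (intro sum.cong refl) (simp only: lessThan_iff merge_top)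
    qed
    finally show ?thesis by (simp only: nn_integral_row3_left sum_norm_perm_minor K_def)
  qed
  have momD: "(\<integral>\<^sup>+\<omega>. ennreal (D (A \<omega>) ^ m) \<partial>M) = (\<integral>\<^sup>+f. ennreal (gram_det2 f ^ m) * K m \<partial>gauss_rows2)" for m
  proof -
    have "(\<integral>\<^sup>+\<omega>. ennreal (D (A \<omega>) ^ m) \<partial>M)
       = (\<integral>\<^sup>+f. (\<integral>\<^sup>+c. ennreal (D (Matrix.mat 3 3 (merge rows2 row3 (f, c))) ^ m) \<partial>PiM row3 (\<lambda>_. gauss)) \<partial>gauss_rows2)"
      by (rule transfer[of "\<lambda>B. ennreal (D B ^ m)"]) (use Dm in measurable)
    also have "\<dots> = (\<integral>\<^sup>+f. ennreal (gram_det2 f ^ m) * K m \<partial>gauss_rows2)"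
    proof (intro nn_integral_cong)
      fix f :: "nat \<times> nat \<Rightarrow> 'a"
      obtain v where v: "(\<Sum>k<3. (norm (v k))\<^sup>2) = gram_det2 f"
        and Dv: "\<And>g. (\<forall>p\<in>rows2. g p = f p) \<Longrightarrow> D (Matrix.mat 3 3 g) = (norm (\<Sum>k<3. g (2, k) * v k))\<^sup>2"
        using conormal[of f] by auto
      have "D (Matrix.mat 3 3 (merge rows2 row3 (f, c))) = (norm (\<Sum>k<3. c (2, k) * v k))\<^sup>2" for c
      proof -
        have "(\<Sum>k<3. merge rows2 row3 (f, c) (2, k) * v k) = (\<Sum>k<3. c (2, k) * v k)"
          by (intro sum.cong refl) (simp only: lessThan_iff merge_top)
        then show ?thesis by (subst Dv) (simp_all add: merge_low)
      qed
      then show "(\<integral>\<^sup>+c. ennreal (D (Matrix.mat 3 3 (merge rows2 row3 (f, c))) ^ m) \<partial>PiM row3 (\<lambda>_. gauss)) = ennreal (gram_det2 f ^ m) * K m"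
        using nn_integral_row3_right[of v m] by (simp only: power_mult[symmetric] v K_def)
    qed
    finally show ?thesis .
  qed
  have sumP0: "0 \<le> perm_minor_sq f" for f unfolding sum_norm_perm_minor[symmetric] by (simp add: sum_nonneg)
  have sumD0: "0 \<le> gram_det2 f" for f
  proof -
    obtain v :: "nat \<Rightarrow> 'a" where "(\<Sum>k<3. (norm (v k))\<^sup>2) = gram_det2 f" using conormal[of f] by blast
    then have "gram_det2 f = (\<Sum>k<3. (norm (v k))\<^sup>2)" by (rule sym)
    then show ?thesis by (simp only:) (intro sum_nonneg zero_le_power2)
  qed
  have iP: "integrable gauss_rows2 perm_minor_sq" "integrable gauss_rows2 (\<lambda>f. perm_minor_sq f ^ 3)"
    and iD: "integrable gauss_rows2 gram_det2" "integrable gauss_rows2 (\<lambda>f. gram_det2 f ^ 3)"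
    using integrable_quadratic[OF quadratic_perm_minor_sq] integrable_quadratic3[OF quadratic_perm_minor_sq quadratic_perm_minor_sq quadratic_perm_minor_sq]
      integrable_quadratic[OF quadratic_gram_det2] integrable_quadratic3[OF quadratic_gram_det2 quadratic_gram_det2 quadratic_gram_det2]
    by (simp_all add: power3_eq_cube)
  have scale: "(\<integral>\<^sup>+\<omega>. ennreal ((Y \<omega> / 6) ^ m) \<partial>M) = ennreal (1 / 6 ^ m * (\<integral>f. s f ^ m \<partial>gauss_rows2)) * K m"
    if Ym: "Y \<in> borel_measurable M" and Y0: "\<And>\<omega>. 0 \<le> Y \<omega>"
      and mom: "(\<integral>\<^sup>+\<omega>. ennreal (Y \<omega> ^ m) \<partial>M) = (\<integral>\<^sup>+f. ennreal (s f ^ m) * K m \<partial>gauss_rows2)"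
      and s: "\<And>f. 0 \<le> s f" "integrable gauss_rows2 (\<lambda>f. s f ^ m)"
    for Y :: "'w \<Rightarrow> real" and s :: "(nat \<times> nat \<Rightarrow> 'a) \<Rightarrow> real" and m
  proof -
    have "(\<integral>\<^sup>+\<omega>. ennreal ((Y \<omega> / 6) ^ m) \<partial>M) = (\<integral>\<^sup>+\<omega>. ennreal (1 / 6 ^ m) * ennreal (Y \<omega> ^ m) \<partial>M)"
      using Y0 by (intro nn_integral_cong) (simp add: ennreal_mult'[symmetric] power_divide)
    also have "\<dots> = ennreal (1 / 6 ^ m) * (\<integral>\<^sup>+\<omega>. ennreal (Y \<omega> ^ m) \<partial>M)"
      using Ym by (intro nn_integral_cmult) measurable
    also have "(\<integral>\<^sup>+\<omega>. ennreal (Y \<omega> ^ m) \<partial>M) = ennreal (\<integral>f. s f ^ m \<partial>gauss_rows2) * K m"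
      unfolding mom using s borel_measurable_integrable[OF s(2)]
      by (subst nn_integral_multc) (simp_all add: nn_integral_eq_integral)
    also have "ennreal (1 / 6 ^ m) * (ennreal (\<integral>f. s f ^ m \<partial>gauss_rows2) * K m) = ennreal (1 / 6 ^ m * (\<integral>f. s f ^ m \<partial>gauss_rows2)) * K m"
      using s by (subst ennreal_mult) (auto simp: mult.assoc intro!: Bochner_Integration.integral_nonneg)
    finally show ?thesis .
  qed
  have X: "X_var 3 A = (\<lambda>\<omega>. (norm (per (A \<omega>)))\<^sup>2 / 6)"
    by (simp add: fun_eq_iff X_var_def fact_numeral)
  have pm [measurable]: "(\<lambda>\<omega>. per (A \<omega>)) \<in> borel_measurable M"
    using measurable_compose[OF Zm perm] by (rule measurable_cong[THEN iffD2, rotated]) (simp add: AZ)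
  have dm [measurable]: "(\<lambda>\<omega>. D (A \<omega>)) \<in> borel_measurable M"
    using measurable_compose[OF Zm Dm] by (rule measurable_cong[THEN iffD2, rotated]) (simp add: AZ)
  have EX: "(\<integral>\<^sup>+\<omega>. ennreal (X_var 3 A \<omega> ^ m) \<partial>M) = ennreal (1 / 6 ^ m * (\<integral>f. perm_minor_sq f ^ m \<partial>gauss_rows2)) * K m"
    if "integrable gauss_rows2 (\<lambda>f. perm_minor_sq f ^ m)" for m
    unfolding X by (rule scale) (use that momP[of m] in \<open>auto simp: power_mult sumP0\<close>)
  have ED: "(\<integral>\<^sup>+\<omega>. ennreal (\<Delta> \<omega> ^ m) \<partial>M) = ennreal (1 / 6 ^ m * (\<integral>f. gram_det2 f ^ m \<partial>gauss_rows2)) * K m"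
    if "integrable gauss_rows2 (\<lambda>f. gram_det2 f ^ m)" for m
    unfolding \<Delta>_def by (rule scale) (use that momD[of m] in \<open>auto simp: sumD0 D0\<close>)
  have K: "0 < K m" "K m < \<infinity>" for m
    unfolding K_def by (rule nn_integral_norm_gauss_pos nn_integral_norm_gauss_finite)+
  show ?thesis
  proof (rule third_moment_obstructs_orders)
    show "(\<integral>\<^sup>+\<omega>. ennreal (X_var 3 A \<omega>) \<partial>M) = (\<integral>\<^sup>+\<omega>. ennreal (\<Delta> \<omega>) \<partial>M)"
      using EX[of 1] ED[of 1] iP(1) iD(1) integral_perm_minor_vs_gram(1) by simp
    show "(\<integral>\<^sup>+\<omega>. ennreal (\<Delta> \<omega>) \<partial>M) < \<infinity>"
      using ED[of 1] iD(1) K(2)[of 1] by (simp add: ennreal_mult_less_top)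
    show "(\<integral>\<^sup>+\<omega>. ennreal (X_var 3 A \<omega> ^ 3) \<partial>M) < \<infinity>"
      using EX[of 3] iP(2) K(2)[of 3] by (simp add: ennreal_mult_less_top)
    obtain k where k: "0 < k" "K 3 = ennreal k"
      using K[of 3] by (cases "K 3") auto
    have "0 \<le> (\<integral>f. gram_det2 f ^ 3 \<partial>gauss_rows2)" by (intro Bochner_Integration.integral_nonneg) (simp add: sumD0)
    then show "(\<integral>\<^sup>+\<omega>. ennreal (\<Delta> \<omega> ^ 3) \<partial>M) < (\<integral>\<^sup>+\<omega>. ennreal (X_var 3 A \<omega> ^ 3) \<partial>M)"
      using EX[OF iP(2)] ED[OF iD(2)] integral_perm_minor_vs_gram(2) k
      by (simp add: ennreal_mult[symmetric] ennreal_less_iff)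
  qed (auto simp: X \<Delta>_def D0 intro: assms(1))
qed

end

section \<open>Real and complex determinants\<close>

lemma conj_algebra_real: "conj_algebra (\<lambda>x::real. x)"
proof
  fix u :: real assume "u \<in> Basis"
  then show "distr gauss borel (\<lambda>x. u * x) = (gauss :: real measure)"
    by (intro distr_gauss_signed_permutation[of id "\<lambda>_. 1"]) auto
next
  fix c x y :: real
  have "(1 * c * (x * y) * (1 * c)) \<bullet> (y * x) = (c * (x * y))\<^sup>2"
    by (simp add: power2_eq_square ac_simps)
  then show "0 \<le> (\<Sum>u\<in>Basis. (u * c * (x * y) * (u * c)) \<bullet> (y * x))" by simp
qed (simp_all add: abs_mult)

lemma conj_algebra_complex: "conj_algebra cnj"
proof
  fix u :: complex assume u: "u \<in> Basis"
  show "distr gauss borel (\<lambda>x. u * x) = (gauss :: complex measure)"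
  proof (cases "u = 1")
    case True
    then show ?thesis by (intro distr_gauss_signed_permutation[of id "\<lambda>_. 1"]) auto
  next
    case False
    then have "u = \<i>" using u by (simp add: Basis_complex_def)
    then show ?thesis
      by (intro distr_gauss_signed_permutation[of "Transposition.transpose 1 \<i>" "\<lambda>b. if b = 1 then -1 else 1"])
         (auto simp: Basis_complex_def bij_betw_def inj_on_def Transposition.transpose_def inner_complex_def complex_eq_iff)
  qed
next
  fix c x y :: complex
  have "u * c * (x * y) * cnj (u * c) = (norm (u * c))\<^sup>2 *\<^sub>R (y * x)" for u
  proof -
    have "u * c * (x * y) * cnj (u * c) = (u * c * cnj (u * c)) * (y * x)" by (simp only: ac_simps)
    then show ?thesis by (simp only: scaleR_conv_of_real complex_norm_square)
  qed
  then show "0 \<le> (\<Sum>u\<in>Basis. (u * c * (x * y) * cnj (u * c)) \<bullet> (y * x))"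
    by (simp add: sum_nonneg)
qed (auto simp: norm_mult inner_complex_def algebra_simps)

locale conj_field = conj_algebra cj
  for cj :: "'a::{real_normed_field, euclidean_space} \<Rightarrow> 'a"
begin

lemma cross_gram_commutative: "cross_gram i j f = (f (0, i) * f (1, j)) \<bullet> (f (0, j) * f (1, i))"
proof -
  have "cross_gram i j f = f (0, i) \<bullet> (f (0, j) * f (1, i) * cj (f (1, j)))"
    unfolding cross_gram_def inner_times_right[of "f (0, i)"] cj_cj by (simp add: ac_simps)
  then show ?thesis by (simp add: inner_times_right[of "f (0, i)"])
qed

theorem det_orders_fail:
  fixes A :: "'w \<Rightarrow> 'a mat"
  assumes "prob_space M" "gaussian_matrix M 3 A"
  shows "\<not> st_le M (Delta_var 3 A) (X_var 3 A) \<and> \<not> st_le M (X_var 3 A) (Delta_var 3 A) \<and> \<not> cx_le M (X_var 3 A) (Delta_var 3 A)"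
proof -
  define D where "D = (\<lambda>B::'a mat. (norm (Determinant.det B))\<^sup>2)"
  have \<Delta>: "Delta_var 3 A = (\<lambda>\<omega>. D (A \<omega>) / 6)"
    by (simp add: fun_eq_iff Delta_var_def D_def fact_numeral)
  show ?thesis
    unfolding \<Delta>
  proof (rule stochastic_orders_fail[OF assms])
    show "(\<lambda>f. D (Matrix.mat 3 3 f)) \<in> borel_measurable (PiM ({0..<3} \<times> {0..<3}) (\<lambda>_. borel))"
    proof -
      have [measurable]: "(\<lambda>f. f (i, j)) \<in> measurable (PiM ({0..<3} \<times> {0..<3}) (\<lambda>_. borel)) (borel :: 'a measure)"
        if "i < 3" "j < 3" for i j :: nat
        using that by (intro measurable_component_singleton) auto
      show ?thesis unfolding D_def det_3 by measurable
    qed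
  next
    fix f :: "nat \<times> nat \<Rightarrow> 'a"
    define v where "v = (\<lambda>k::nat. if k = 0 then f (0,1) * f (1,2) - f (0,2) * f (1,1)
      else if k = 1 then f (0,2) * f (1,0) - f (0,0) * f (1,2)
      else f (0,0) * f (1,1) - f (0,1) * f (1,0))"
    have sq: "(norm (p - q))\<^sup>2 = (norm p)\<^sup>2 + (norm q)\<^sup>2 - 2 * (p \<bullet> q)" for p q :: 'a
      by (simp add: power2_norm_eq_inner inner_diff_left inner_diff_right inner_commute)
    have "(\<Sum>k<3. (norm (v k))\<^sup>2) = gram_det2 f"
      by (simp add: lessThan_3 v_def sq gram_det2_def split_sq_def cross_gram_commutative norm_mult power_mult_distrib insert_Diff_if inner_commute)
    moreover have "D (Matrix.mat 3 3 g) = (norm (\<Sum>k<3. g (2, k) * v k))\<^sup>2" if g: "\<forall>p\<in>rows2. g p = f p" for g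
    proof -
      have "g (0, k) = f (0, k)" "g (1, k) = f (1, k)" if "k < 3" for k using g that by auto
      then have "Determinant.det (Matrix.mat 3 3 g) = (\<Sum>k<3. g (2, k) * v k)"
        unfolding det_3 by (simp add: lessThan_3 v_def algebra_simps)
      then show ?thesis by (simp add: D_def)
    qed
    ultimately show "\<exists>v. (\<Sum>k<3. (norm (v k))\<^sup>2) = gram_det2 f \<and>
        (\<forall>g. (\<forall>p\<in>rows2. g p = f p) \<longrightarrow> D (Matrix.mat 3 3 g) = (norm (\<Sum>k<3. g (2, k) * v k))\<^sup>2)"
      by blast
  qed (simp add: D_def)
qed

end

section \<open>Quaternionic singular value decomposition\<close>

lemma qcnj_qcnj [simp]: "qcnj (qcnj x) = x"
  by (simp add: qcnj_def)

lemma qcnj_add: "qcnj (x + y) = qcnj x + qcnj y"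
  by (simp add: qcnj_def plus_quat_def)

lemma qcnj_0 [simp]: "qcnj 0 = 0"
  by (simp add: qcnj_def zero_quat_def)

lemma qcnj_1 [simp]: "qcnj 1 = 1"
  by (simp add: qcnj_def one_quat_def)

lemma qcnj_minus: "qcnj (- x) = - qcnj x"
  by (simp add: qcnj_def uminus_quat_def)

lemma qcnj_mult: "qcnj (x * y) = qcnj y * qcnj x"
  by (simp add: qcnj_def times_quat_def)

lemma qcnj_scaleR: "qcnj (r *\<^sub>R x) = r *\<^sub>R qcnj x"
  by (simp add: qcnj_def scaleR_quat_def)

lemma qcnj_sum: "qcnj (sum f A) = (\<Sum>x\<in>A. qcnj (f x))"
  by (induction A rule: infinite_finite_induct) (auto simp: qcnj_add)

lemma quat_of_real: "(of_real r :: quat) = Quat r 0 0 0"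
  by (simp add: of_real_def scaleR_quat_def one_quat_def)

lemma qcnj_of_real [simp]: "qcnj (of_real r) = of_real r"
  by (simp add: qcnj_def quat_of_real)

lemma inner_quat_mult_left: "inner (x * y) (z::quat) = inner y (qcnj x * z)"
  by (simp add: inner_quat_def qcnj_def times_quat_def algebra_simps)

lemma inner_quat_mult_right: "inner (x * y) (z::quat) = inner x (z * qcnj y)"
  by (simp add: inner_quat_def qcnj_def times_quat_def algebra_simps)

lemma quat_mult_qcnj: "x * qcnj x = of_real ((norm x)\<^sup>2)"
  by (simp add: norm_eq_sqrt_inner quat_of_real inner_quat_def qcnj_def times_quat_def quat_eq_iff algebra_simps)

lemma qcnj_mult_self: "qcnj x * x = of_real ((norm x)\<^sup>2)"
  by (simp add: norm_eq_sqrt_inner quat_of_real inner_quat_def qcnj_def times_quat_def quat_eq_iff algebra_simps)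

lemma norm_qcnj [simp]: "norm (qcnj x) = norm x"
  by (simp add: norm_eq_sqrt_inner inner_quat_def qcnj_def)

lemma norm_quat_mult: "norm (x * y) = norm x * norm (y::quat)"
proof -
  have "inner (x * y) (x * y) = inner x x * inner y y"
    by (simp add: inner_quat_def times_quat_def algebra_simps)
  then show ?thesis by (simp add: norm_eq_sqrt_inner real_sqrt_mult)
qed

instance quat :: real_normed_algebra_1
proof
  show "norm (x * y) \<le> norm x * norm y" for x y :: quat by (simp only: norm_quat_mult)
  show "norm (1 :: quat) = 1" by (simp add: norm_quat_def inner_quat_def one_quat_def)
qed

lemma qRe_add: "qRe (x + y) = qRe x + qRe y"
  by (simp add: plus_quat_def)

lemma qRe_diff: "qRe (x - y) = qRe x - qRe y"
  by (simp add: minus_quat_def)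

lemma qRe_0 [simp]: "qRe 0 = 0"
  by (simp add: zero_quat_def)

lemma qRe_of_real [simp]: "qRe (of_real r) = r"
  by (simp add: quat_of_real)

lemma qRe_sum: "qRe (sum f A) = (\<Sum>x\<in>A. qRe (f x))"
  by (induction A rule: infinite_finite_induct) (auto simp: qRe_add)

lemma qRe_scaleR [simp]: "qRe (r *\<^sub>R x) = r * qRe x"
  by (simp add: scaleR_quat_def)

lemma qRe_qcnj [simp]: "qRe (qcnj x) = qRe x"
  by (simp add: qcnj_def)

lemma qRe_mult_commute: "qRe (x * y) = qRe (y * x)"
  by (simp add: times_quat_def algebra_simps)

lemma qRe_mult_eq_inner: "qRe (x * y) = inner x (qcnj y)"
  by (simp add: times_quat_def inner_quat_def qcnj_def)

lemma qRe_le_norm: "qRe x \<le> norm x"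
proof -
  have "qRe x = inner x 1" by (simp add: inner_quat_def one_quat_def)
  also have "\<dots> \<le> norm x * norm (1::quat)" by (rule norm_cauchy_schwarz)
  finally show ?thesis by simp
qed

lemma quat_mult_of_real: "of_real r * x = r *\<^sub>R x" "x * of_real r = r *\<^sub>R (x :: quat)"
  by (simp_all add: of_real_def)

lemma continuous_on_qcnj [continuous_intros]:
  assumes "continuous_on S f" shows "continuous_on S (\<lambda>x. qcnj (f x))"
proof -
  have "bounded_linear qcnj"
    by (rule bounded_linear_intro[where K = 1]) (auto simp: qcnj_add qcnj_scaleR)
  then show ?thesis using assms by (rule bounded_linear.continuous_on)
qed

lemma continuous_on_qRe [continuous_intros]:
  assumes "continuous_on S f" shows "continuous_on S (\<lambda>x. qRe (f x))"
proof -
  have "continuous_on S (\<lambda>x. inner (f x) 1)" using assms by (intro continuous_intros)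
  then show ?thesis by (simp add: inner_quat_def one_quat_def)
qed

lemma qadjoint_carrier [simp]: "A \<in> carrier_mat n m \<Longrightarrow> qadjoint A \<in> carrier_mat m n"
  by (auto simp: qadjoint_def)

lemma qadjoint_dim [simp]: "dim_row (qadjoint A) = dim_col A" "dim_col (qadjoint A) = dim_row A"
  by (simp_all add: qadjoint_def)

lemma qadjoint_index [simp]: "i < dim_col A \<Longrightarrow> j < dim_row A \<Longrightarrow> qadjoint A $$ (i, j) = qcnj (A $$ (j, i))"
  by (simp add: qadjoint_def)

lemma qadjoint_qadjoint [simp]: "qadjoint (qadjoint A) = A"
  by (rule eq_matI) auto

lemma qadjoint_one [simp]: "qadjoint (1\<^sub>m n) = 1\<^sub>m n"
  by (rule eq_matI) auto

lemma mat_mult_index: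
  assumes "A \<in> carrier_mat n m" "B \<in> carrier_mat m k" "i < n" "j < k"
  shows "(A * B) $$ (i, j) = (\<Sum>l<m. A $$ (i, l) * B $$ (l, j))"
  using assms by (auto simp: scalar_prod_def atLeast0LessThan intro!: sum.cong)

lemma qadjoint_mult:
  assumes "A \<in> carrier_mat n m" "B \<in> carrier_mat m k"
  shows "qadjoint (A * B) = qadjoint B * qadjoint A"
proof (rule eq_matI)
  fix i j assume "i < dim_row (qadjoint B * qadjoint A)" "j < dim_col (qadjoint B * qadjoint A)"
  then have ij: "i < k" "j < n" using assms by auto
  then show "qadjoint (A * B) $$ (i, j) = (qadjoint B * qadjoint A) $$ (i, j)"
    using assms by (subst mat_mult_index[of _ k m _ n])
      (auto simp: mat_mult_index[of A n m B k] qcnj_sum qcnj_mult simp del: index_mult_mat(1))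
qed (use assms in auto)

lemma qadjoint_mat_diag: "qadjoint (mat_diag n f) = mat_diag n (\<lambda>i. qcnj (f i))"
  by (rule eq_matI) (simp_all add: mat_diag_def)

lemma qunitary_carrier: "qunitary n U \<Longrightarrow> U \<in> carrier_mat n n"
  by (simp add: qunitary_def)

lemma qunitary_one: "qunitary n (1\<^sub>m n)"
  by (simp add: qunitary_def)

lemma qunitary_qadjoint: "qunitary n U \<Longrightarrow> qunitary n (qadjoint U)"
  by (simp add: qunitary_def)

lemma qunitary_cancel:
  assumes "qunitary n U" "X \<in> carrier_mat n m"
  shows "U * (qadjoint U * X) = X" "qadjoint U * (U * X) = X"
proof -
  have U: "U \<in> carrier_mat n n" "qadjoint U \<in> carrier_mat n n" "U * qadjoint U = 1\<^sub>m n" "qadjoint U * U = 1\<^sub>m n"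
    using assms(1) by (auto simp: qunitary_def)
  show "U * (qadjoint U * X) = X"
    using U(3) assms(2) by (subst assoc_mult_mat[OF U(1,2) assms(2), symmetric]) simp
  show "qadjoint U * (U * X) = X"
    using U(4) assms(2) by (subst assoc_mult_mat[OF U(2,1) assms(2), symmetric]) simp
qed

lemma qunitary_mult:
  assumes U: "qunitary n U" and V: "qunitary n V"
  shows "qunitary n (U * V)"
proof -
  note c = qunitary_carrier[OF U] qunitary_carrier[OF V]
  have adj: "qadjoint (U * V) = qadjoint V * qadjoint U" by (rule qadjoint_mult[OF c])
  have "(U * V) * (qadjoint V * qadjoint U) = U * (V * (qadjoint V * qadjoint U))"
    using c by (intro assoc_mult_mat) auto
  also have "\<dots> = 1\<^sub>m n"
    using c U by (subst qunitary_cancel[OF V, of _ n]) (auto simp: qunitary_def)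
  finally have 1: "(U * V) * (qadjoint V * qadjoint U) = 1\<^sub>m n" .
  have "(qadjoint V * qadjoint U) * (U * V) = qadjoint V * (qadjoint U * (U * V))"
    using c by (intro assoc_mult_mat) auto
  also have "\<dots> = 1\<^sub>m n"
    using c V by (subst qunitary_cancel[OF U, of _ n]) (auto simp: qunitary_def)
  finally show ?thesis using 1 c adj by (simp add: qunitary_def)
qed

lemma qunitary_mat_diag:
  assumes "\<And>i. i < n \<Longrightarrow> norm (r i) = 1"
  shows "qunitary n (mat_diag n r)"
proof -
  have "mat_diag n (\<lambda>i. r i * qcnj (r i)) = 1\<^sub>m n" "mat_diag n (\<lambda>i. qcnj (r i) * r i) = 1\<^sub>m n"
    using assms by (auto intro!: eq_matI simp: mat_diag_def quat_mult_qcnj qcnj_mult_self)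
  then show ?thesis
    by (simp add: qunitary_def qadjoint_mat_diag)
qed

text \<open>The sine is a quaternion: its direction is free, so that rotations can probe all four real
  coordinates of a matrix entry.\<close>

definition plane_rotation :: "nat \<Rightarrow> nat \<Rightarrow> nat \<Rightarrow> real \<Rightarrow> quat \<Rightarrow> quat mat" where
  "plane_rotation n i j c q = Matrix.mat n n (\<lambda>(k, l).
     if k = i then (if l = i then of_real c else if l = j then - q else 0)
     else if k = j then (if l = i then qcnj q else if l = j then of_real c else 0)
     else if k = l then 1 else 0)"

lemma plane_rotation_mult:
  assumes M: "M \<in> carrier_mat n m" and ij: "i < n" "j < n" "i \<noteq> j"
  shows "plane_rotation n i j c q * M = Matrix.mat n m (\<lambda>(k, l).
     if k = i then of_real c * M $$ (i, l) - q * M $$ (j, l)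
     else if k = j then qcnj q * M $$ (i, l) + of_real c * M $$ (j, l)
     else M $$ (k, l))" (is "?R * M = ?N")
proof (rule eq_matI)
  have R: "?R \<in> carrier_mat n n" by (simp add: plane_rotation_def)
  fix k l assume "k < dim_row ?N" "l < dim_col ?N"
  then have kl: "k < n" "l < m" by auto
  have two: "(\<Sum>x<n. (if x = i then a else if x = j then b else 0) * M $$ (x, l)) = a * M $$ (i, l) + b * M $$ (j, l)" for a b
  proof -
    have "(\<Sum>x<n. (if x = i then a else if x = j then b else 0) * M $$ (x, l))
       = (\<Sum>x<n. (if x = i then a * M $$ (i, l) else 0) + (if x = j then b * M $$ (j, l) else 0))"
      using ij by (intro sum.cong) auto
    also have "\<dots> = a * M $$ (i, l) + b * M $$ (j, l)"
      using ij by (simp add: sum.distrib)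
    finally show ?thesis .
  qed
  have one: "(\<Sum>x<n. (if k = x then 1 else 0) * M $$ (x, l)) = M $$ (k, l)"
    using kl by (simp add: if_distrib[of "\<lambda>y. y * _"] cong: if_cong)
  have "(?R * M) $$ (k, l) = (\<Sum>x<n. ?R $$ (k, x) * M $$ (x, l))"
    by (rule mat_mult_index[OF R M kl])
  also have "\<dots> = (\<Sum>x<n. (if k = i then (if x = i then of_real c else if x = j then - q else 0)
     else if k = j then (if x = i then qcnj q else if x = j then of_real c else 0)
     else if k = x then 1 else 0) * M $$ (x, l))"
    using kl by (intro sum.cong) (auto simp: plane_rotation_def)
  also have "\<dots> = ?N $$ (k, l)"
    using kl ij by (cases "k = i"; cases "k = j") (simp_all add: two one)
  finally show "(?R * M) $$ (k, l) = ?N $$ (k, l)" .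
qed (use M in \<open>auto simp: plane_rotation_def\<close>)

lemma qunitary_plane_rotation:
  assumes ij: "i < n" "j < n" "i \<noteq> j" and c: "c\<^sup>2 + (norm q)\<^sup>2 = 1"
  shows "qunitary n (plane_rotation n i j c q)"
proof -
  have carr: "plane_rotation n i j c p \<in> carrier_mat n n" for p by (simp add: plane_rotation_def)
  have adj: "qadjoint (plane_rotation n i j c q) = plane_rotation n i j c (- q)"
    by (rule eq_matI) (use ij in \<open>auto simp: plane_rotation_def qcnj_minus\<close>)
  have c': "(of_real c * of_real c :: quat) + of_real ((norm q)\<^sup>2) = 1"
    unfolding of_real_mult[symmetric] of_real_add[symmetric] using c by (simp add: power2_eq_square)
  have inv: "plane_rotation n i j c p * plane_rotation n i j c (- p) = 1\<^sub>m n" if p: "norm p = norm q" for p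
  proof -
    have p1: "of_real c * of_real c + p * qcnj p = 1" "qcnj p * p + of_real c * of_real c = 1"
      using c' by (simp_all add: quat_mult_qcnj qcnj_mult_self p add.commute)
    have p2: "of_real c * - (- p) - p * of_real c = 0" "qcnj p * of_real c + of_real c * qcnj (- p) = 0"
      by (simp_all add: quat_mult_of_real qcnj_minus)
    show ?thesis
      unfolding plane_rotation_mult[OF carr ij]
    proof (rule eq_matI, goal_cases)
      case (1 k l)
      then have "k < n" "l < n" by auto
      then show ?case
        using ij p1 p2
        by (cases "k = i"; cases "k = j"; cases "l = i"; cases "l = j")
           (simp_all add: plane_rotation_def qcnj_minus quat_mult_of_real)
    qed simp_all
  qed
  show ?thesis
    unfolding qunitary_def adj using inv[of q] inv[of "- q"] carr by simp
qed

text \<open>The unit vector in the direction of \<open>(\<beta>, \<alpha>)\<close> gives the value \<open>sqrt (\<alpha>\<^sup>2 + \<beta>\<^sup>2)\<close>, which exceeds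
  \<open>\<beta>\<close> unless \<open>\<alpha>\<close> vanishes.\<close>

lemma rotation_critical:
  fixes \<alpha> \<beta> :: real
  assumes "\<And>c s. c\<^sup>2 + s\<^sup>2 = 1 \<Longrightarrow> \<alpha> * s + \<beta> * c \<le> \<beta>"
  shows "\<alpha> = 0"
proof (rule ccontr)
  assume "\<alpha> \<noteq> 0"
  define r where "r = sqrt (\<alpha>\<^sup>2 + \<beta>\<^sup>2)"
  have r: "0 < r" "r\<^sup>2 = \<alpha>\<^sup>2 + \<beta>\<^sup>2" using \<open>\<alpha> \<noteq> 0\<close> by (auto simp: r_def sum_power2_gt_zero_iff)
  have "(\<beta> / r)\<^sup>2 + (\<alpha> / r)\<^sup>2 = (\<beta>\<^sup>2 + \<alpha>\<^sup>2) / r\<^sup>2" by (simp add: power_divide add_divide_distrib)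
  also have "\<dots> = 1" using r by (metis add.commute divide_self less_numeral_extra(3) zero_less_power)
  finally have "(\<beta> / r)\<^sup>2 + (\<alpha> / r)\<^sup>2 = 1" .
  from assms[OF this] have "(\<alpha>\<^sup>2 + \<beta>\<^sup>2) / r \<le> \<beta>" by (simp add: power2_eq_square add_divide_distrib)
  then have "r * r \<le> \<beta> * r" using r by (simp add: power2_eq_square divide_le_eq)
  then have "r \<le> \<beta>" using r by (simp add: mult_le_cancel_right)
  moreover have "\<beta> < r"
    using \<open>\<alpha> \<noteq> 0\<close> unfolding r_def by (intro real_less_rsqrt) auto
  ultimately show False by simp
qed

text \<open>The weights are positive and pairwise different. Positivity makes the diagonal of a maximiser real and
  nonnegative; that they differ forces its off-diagonal entries to vanish.\<close>

definition wtrace :: "nat \<Rightarrow> quat mat \<Rightarrow> real" where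
  "wtrace n M = (\<Sum>j<n. real (Suc j) * qRe (M $$ (j, j)))"

lemma wtrace_qadjoint: "M \<in> carrier_mat n n \<Longrightarrow> wtrace n (qadjoint M) = wtrace n M"
  by (auto simp: wtrace_def intro!: sum.cong)

text \<open>The first claim tests phase changes of a single row, the second one tests plane rotations. The
  relation between the entries \<open>(i, j)\<close> and \<open>(j, i)\<close> alone does not annihilate them; its
  counterpart for the adjoint matrix does.\<close>

lemma wtrace_maximal:
  assumes B: "B \<in> carrier_mat n n" and max: "\<And>R. qunitary n R \<Longrightarrow> wtrace n (R * B) \<le> wtrace n B"
  shows "j < n \<Longrightarrow> B $$ (j, j) = of_real (norm (B $$ (j, j)))"
    and "i < n \<Longrightarrow> j < n \<Longrightarrow> i \<noteq> j \<Longrightarrow> real (Suc j) *\<^sub>R B $$ (i, j) = real (Suc i) *\<^sub>R qcnj (B $$ (j, i))"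
proof -
  assume j: "j < n"
  define x where "x = B $$ (j, j)"
  show "B $$ (j, j) = of_real (norm (B $$ (j, j)))"
  proof (cases "x = 0")
    case False
    define r where "r = qcnj x /\<^sub>R norm x"
    have "r * x = of_real (inverse (norm x) * (norm x)\<^sup>2)"
      by (simp add: r_def qcnj_mult_self scaleR_conv_of_real mult.assoc)
    moreover have "inverse (norm x) * (norm x)\<^sup>2 = norm x"
      using False by (simp add: power2_eq_square)
    ultimately have r: "norm r = 1" "r * x = of_real (norm x)"
      using False by (simp_all add: r_def del: of_real_mult)
    let ?R = "mat_diag n (\<lambda>k. if k = j then r else 1)"
    have "wtrace n (?R * B) \<le> wtrace n B"
      using r(1) by (intro max qunitary_mat_diag) simp
    also have "wtrace n (?R * B) = (\<Sum>k<n. real (Suc k) * qRe (B $$ (k, k)) + (if k = j then real (Suc j) * (norm x - qRe x) else 0))"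
      unfolding mat_diag_mult_left[OF B] wtrace_def
      by (intro sum.cong) (simp_all add: r(2) x_def[symmetric] right_diff_distrib)
    also have "\<dots> = wtrace n B + real (Suc j) * (norm x - qRe x)"
      using j by (simp add: sum.distrib wtrace_def)
    finally have "norm x \<le> qRe x" by (simp add: mult_le_0_iff)
    then have eq: "norm x = qRe x" using qRe_le_norm[of x] by simp
    then have "(qRe x)\<^sup>2 = inner x x" by (metis power2_norm_eq_inner)
    then have "(qI x)\<^sup>2 + (qJ x)\<^sup>2 + (qK x)\<^sup>2 = 0" by (simp add: inner_quat_def power2_eq_square)
    then have "qI x = 0" "qJ x = 0" "qK x = 0"
      by (simp_all add: add_nonneg_eq_0_iff)
    then show ?thesis using eq unfolding x_def[symmetric] by (simp add: quat_eq_iff quat_of_real)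
  qed (simp add: x_def)
next
  assume ij: "i < n" "j < n" "i \<noteq> j"
  show "real (Suc j) *\<^sub>R B $$ (i, j) = real (Suc i) *\<^sub>R qcnj (B $$ (j, i))"
  proof (rule euclidean_eqI)
    fix p :: quat assume p: "p \<in> Basis"
    define \<alpha> where "\<alpha> = real (Suc j) * qRe (qcnj p * B $$ (i, j)) - real (Suc i) * qRe (p * B $$ (j, i))"
    define \<beta> where "\<beta> = real (Suc i) * qRe (B $$ (i, i)) + real (Suc j) * qRe (B $$ (j, j))"
    have "\<alpha> = 0"
    proof (rule rotation_critical)
      fix c s :: real assume cs: "c\<^sup>2 + s\<^sup>2 = 1"
      let ?R = "plane_rotation n i j c (s *\<^sub>R p)"
      have "wtrace n (?R * B) \<le> wtrace n B"
        using ij cs p by (intro max qunitary_plane_rotation) auto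
      also have "wtrace n (?R * B) = (\<Sum>k<n. real (Suc k) * qRe (B $$ (k, k))
          + (if k = i then real (Suc i) * ((c - 1) * qRe (B $$ (i, i)) - s * qRe (p * B $$ (j, i))) else 0)
          + (if k = j then real (Suc j) * ((c - 1) * qRe (B $$ (j, j)) + s * qRe (qcnj p * B $$ (i, j))) else 0))"
        unfolding plane_rotation_mult[OF B ij] wtrace_def
      proof (intro sum.cong refl)
        fix k assume "k \<in> {..<n}"
        then show "real (Suc k) * qRe (Matrix.mat n n (\<lambda>(k, l).
              if k = i then of_real c * B $$ (i, l) - s *\<^sub>R p * B $$ (j, l)
              else if k = j then qcnj (s *\<^sub>R p) * B $$ (i, l) + of_real c * B $$ (j, l)
              else B $$ (k, l)) $$ (k, k)) =
            real (Suc k) * qRe (B $$ (k, k))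
          + (if k = i then real (Suc i) * ((c - 1) * qRe (B $$ (i, i)) - s * qRe (p * B $$ (j, i))) else 0)
          + (if k = j then real (Suc j) * ((c - 1) * qRe (B $$ (j, j)) + s * qRe (qcnj p * B $$ (i, j))) else 0)"
          using ij
          by (cases "k = i"; cases "k = j")
             (simp_all add: qcnj_scaleR quat_mult_of_real qRe_add qRe_diff right_diff_distrib left_diff_distrib distrib_left)
      qed
      also have "\<dots> = wtrace n B + (\<alpha> * s + \<beta> * c - \<beta>)"
        using ij by (simp add: sum.distrib wtrace_def \<alpha>_def \<beta>_def algebra_simps)
      finally show "\<alpha> * s + \<beta> * c \<le> \<beta>" by simp
    qed
    then show "inner (real (Suc j) *\<^sub>R B $$ (i, j)) p = inner (real (Suc i) *\<^sub>R qcnj (B $$ (j, i))) p"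
      unfolding \<alpha>_def
      by (simp add: qRe_mult_commute[of "qcnj p"] qRe_mult_eq_inner[of _ "qcnj p"] qRe_mult_eq_inner[of p] inner_commute)
  qed
qed

text \<open>The pairs of unitary matrices form a compact set in the product topology on families of entries,
  because the entries of a unitary matrix are bounded by one.\<close>

lemma wtrace_maximizer_exists:
  assumes A: "A \<in> carrier_mat n n"
  obtains U V where "qunitary n U" "qunitary n V"
    "\<And>U' V'. qunitary n U' \<Longrightarrow> qunitary n V' \<Longrightarrow> wtrace n (qadjoint U' * A * V') \<le> wtrace n (qadjoint U * A * V)"
proof -
  \<comment> \<open>Pinning the irrelevant entries to zero makes \<open>K\<close> a product of compact sets.\<close>
  define S where "S = (\<lambda>ij::nat \<times> nat. if fst ij < n \<and> snd ij < n then cball (0::quat) 1 else {0})"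
  define K where "K = Pi\<^sub>E UNIV S"
  have "compact K"
    unfolding K_def using compactin_PiE[of "\<lambda>_. euclidean" UNIV S]
    by (auto simp: euclidean_product_topology S_def)
  let ?mat = "\<lambda>f. Matrix.mat n n f :: quat mat"
  have coord: "continuous_on T (\<lambda>f::nat \<times> nat \<Rightarrow> quat. f ij)" for T ij
    by (rule continuous_on_product_coordinates[THEN continuous_on_subset]) simp
  have un: "qunitary n (?mat f) \<longleftrightarrow> (\<forall>i\<in>{..<n}. \<forall>j\<in>{..<n}.
      (\<Sum>l<n. f (i, l) * qcnj (f (j, l))) = (if i = j then 1 else 0) \<and>
      (\<Sum>l<n. qcnj (f (l, i)) * f (l, j)) = (if i = j then 1 else 0))" for f
  proof -
    have "(?mat f * qadjoint (?mat f)) $$ (i, j) = (\<Sum>l<n. f (i, l) * qcnj (f (j, l)))"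
      "(qadjoint (?mat f) * ?mat f) $$ (i, j) = (\<Sum>l<n. qcnj (f (l, i)) * f (l, j))" if "i < n" "j < n" for i j
      using that by (subst mat_mult_index[of _ n n _ n]; auto)+
    then show ?thesis
      unfolding qunitary_def by (auto simp: mat_eq_iff simp del: index_mult_mat(1))
  qed
  define C where "C = {f. qunitary n (?mat f)}"
  have "C = (\<Inter>i\<in>{..<n}. \<Inter>j\<in>{..<n}.
      {f. (\<Sum>l<n. f (i, l) * qcnj (f (j, l))) = (if i = j then 1 else 0)} \<inter>
      {f. (\<Sum>l<n. qcnj (f (l, i)) * f (l, j)) = (if i = j then 1 else 0)})"
    by (auto simp: C_def un)
  also have "closed \<dots>"
    by (intro closed_INT ballI closed_Int closed_Collect_eq continuous_intros coord)
  finally have "closed C" .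
  define P where "P = (K \<inter> C) \<times> (K \<inter> C)"
  have "compact P" unfolding P_def using \<open>compact K\<close> \<open>closed C\<close> by (intro compact_Times compact_Int_closed)
  define F where "F = (\<lambda>(u, v). \<Sum>j<n. real (Suc j) * qRe (\<Sum>l<n. (\<Sum>k<n. qcnj (u (k, j)) * A $$ (k, l)) * v (l, j)))"
  have F: "wtrace n (qadjoint (?mat u) * A * ?mat v) = F (u, v)" for u v
  proof -
    have "(qadjoint (?mat u) * A * ?mat v) $$ (j, j) = (\<Sum>l<n. (\<Sum>k<n. qcnj (u (k, j)) * A $$ (k, l)) * v (l, j))" if j: "j < n" for j
    proof -
      have "(qadjoint (?mat u) * A) $$ (j, l) = (\<Sum>k<n. qcnj (u (k, j)) * A $$ (k, l))" if "l < n" for l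
        using that j A by (subst mat_mult_index[of _ n n _ n]) auto
      then show ?thesis
        using j A by (subst mat_mult_index[of _ n n _ n]) (auto simp del: index_mult_mat(1))
    qed
    then show ?thesis by (auto simp: wtrace_def F_def simp del: index_mult_mat(1) intro!: sum.cong)
  qed
  have "continuous_on P F"
    unfolding F_def case_prod_unfold
    by (intro continuous_intros continuous_on_compose2[OF coord[of UNIV]]) auto
  have repr: "\<exists>f\<in>K \<inter> C. ?mat f = U" if U: "qunitary n U" for U
  proof -
    note carr = qunitary_carrier[OF U]
    define f where "f = (\<lambda>ij. if fst ij < n \<and> snd ij < n then U $$ ij else 0)"
    have mf: "?mat f = U" using carr by (intro eq_matI) (auto simp: f_def)
    have "norm (U $$ (i, j)) \<le> 1" if ij: "i < n" "j < n" for i j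
    proof -
      have "(U * qadjoint U) $$ (i, i) = (\<Sum>l<n. U $$ (i, l) * qcnj (U $$ (i, l)))"
        using carr ij by (subst mat_mult_index[of _ n n _ n]) auto
      also have "\<dots> = of_real (\<Sum>l<n. (norm (U $$ (i, l)))\<^sup>2)"
        by (simp add: quat_mult_qcnj)
      finally have "of_real (\<Sum>l<n. (norm (U $$ (i, l)))\<^sup>2) = (of_real 1 :: quat)"
        using U ij by (simp add: qunitary_def)
      then have "(\<Sum>l<n. (norm (U $$ (i, l)))\<^sup>2) = 1" by (subst (asm) of_real_eq_iff)
      moreover have "(norm (U $$ (i, j)))\<^sup>2 \<le> (\<Sum>l<n. (norm (U $$ (i, l)))\<^sup>2)"
        using ij by (intro member_le_sum) auto
      ultimately show ?thesis by (simp add: power2_le_imp_le[of _ 1])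
    qed
    then have "f \<in> K" by (auto simp: K_def S_def f_def)
    moreover have "f \<in> C" using U mf by (simp add: C_def)
    ultimately show ?thesis using mf by auto
  qed
  have "P \<noteq> {}" using repr[OF qunitary_one] by (auto simp: P_def)
  from continuous_attains_sup[OF \<open>compact P\<close> this \<open>continuous_on P F\<close>]
  obtain u v where uv: "(u, v) \<in> P" and max: "\<And>z. z \<in> P \<Longrightarrow> F z \<le> F (u, v)" by force
  show ?thesis
  proof (rule that)
    show "qunitary n (?mat u)" "qunitary n (?mat v)" using uv by (auto simp: P_def C_def)
    fix U' V' assume "qunitary n U'" "qunitary n V'"
    then obtain u' v' where "u' \<in> K \<inter> C" "v' \<in> K \<inter> C" "U' = ?mat u'" "V' = ?mat v'"
      using repr by metis
    then show "wtrace n (qadjoint U' * A * V') \<le> wtrace n (qadjoint (?mat u) * A * ?mat v)"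
      using max[of "(u', v')"] by (simp add: F P_def)
  qed
qed

text \<open>For a maximising pair \<open>U\<close>, \<open>V\<close> the matrix \<open>B = U\<^sup>* A V\<close> cannot be improved by unitary factors on either side. The
  resulting relations \<open>w\<^sub>j B\<^sub>i\<^sub>j = w\<^sub>i B\<^sub>j\<^sub>i\<^sup>*\<close> and \<open>w\<^sub>j B\<^sub>j\<^sub>i\<^sup>* = w\<^sub>i B\<^sub>i\<^sub>j\<close>, with \<open>*\<close> the
  quaternionic conjugate and different weights, leave only a nonnegative diagonal.\<close>

theorem quat_svd_exists:
  assumes A: "A \<in> carrier_mat n n"
  shows "\<exists>U s V. quat_svd A U s V"
proof -
  obtain U V where U: "qunitary n U" and V: "qunitary n V"
    and max: "\<And>U' V'. qunitary n U' \<Longrightarrow> qunitary n V' \<Longrightarrow> wtrace n (qadjoint U' * A * V') \<le> wtrace n (qadjoint U * A * V)"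
    using wtrace_maximizer_exists[OF A] by blast
  note [simp] = qunitary_carrier[OF U] qunitary_carrier[OF V] A mult_carrier_mat[of _ n n _ n]
  define B where "B = qadjoint U * A * V"
  have B [simp]: "B \<in> carrier_mat n n"
    unfolding B_def by (intro mult_carrier_mat[of _ n n _ n]) simp_all
  have left: "wtrace n (R * B) \<le> wtrace n B" if R: "qunitary n R" for R
  proof -
    note [simp] = qunitary_carrier[OF R]
    have "R * B = qadjoint (U * qadjoint R) * A * V"
      unfolding B_def by (subst qadjoint_mult[of _ n n _ n]) (auto simp: assoc_mult_mat[of _ n n _ n _ n])
    then show ?thesis
      using max[OF qunitary_mult[OF U qunitary_qadjoint[OF R]] V] by (simp add: B_def)
  qed
  have right: "wtrace n (R * qadjoint B) \<le> wtrace n (qadjoint B)" if R: "qunitary n R" for R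
  proof -
    note [simp] = qunitary_carrier[OF R]
    have "R * qadjoint B = qadjoint (B * qadjoint R)"
      by (subst qadjoint_mult[of _ n n _ n]) auto
    moreover have "B * qadjoint R = qadjoint U * A * (V * qadjoint R)"
      unfolding B_def by (simp add: assoc_mult_mat[of _ n n _ n _ n])
    ultimately show ?thesis
      using max[OF U qunitary_mult[OF V qunitary_qadjoint[OF R]]]
      by (simp add: B_def wtrace_qadjoint mult_carrier_mat[of _ n n _ n])
  qed
  have off: "B $$ (i, j) = 0" if ij: "i < n" "j < n" "i \<noteq> j" for i j
  proof -
    let ?x = "B $$ (i, j)" and ?y = "qcnj (B $$ (j, i))"
    have 1: "real (Suc j) *\<^sub>R ?x = real (Suc i) *\<^sub>R ?y"
      using wtrace_maximal(2)[OF B left ij] .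
    have 2: "real (Suc j) *\<^sub>R ?y = real (Suc i) *\<^sub>R ?x"
      using wtrace_maximal(2)[OF _ right ij] ij B by simp
    have "(real (Suc j) * real (Suc j)) *\<^sub>R ?x = real (Suc i) *\<^sub>R (real (Suc j) *\<^sub>R ?y)"
      by (simp only: scaleR_scaleR[symmetric] 1) (simp add: mult.commute)
    also have "\<dots> = (real (Suc i) * real (Suc i)) *\<^sub>R ?x" by (simp only: 2 scaleR_scaleR)
    finally have "(real (Suc j) * real (Suc j) - real (Suc i) * real (Suc i)) *\<^sub>R ?x = 0"
      by (simp only: scaleR_diff_left) simp
    moreover have "real (Suc j) * real (Suc j) \<noteq> real (Suc i) * real (Suc i)"
    proof
      assume "real (Suc j) * real (Suc j) = real (Suc i) * real (Suc i)"
      then have "(real (Suc j))\<^sup>2 = (real (Suc i))\<^sup>2"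
        by (simp only: power2_eq_square)
      then have "real (Suc j) = real (Suc i)"
        by (rule power2_eq_imp_eq) simp_all
      then show False using ij by simp
    qed
    ultimately show ?thesis by simp
  qed
  define s where "s = (\<lambda>j. norm (B $$ (j, j)))"
  have "B = mat_diag n (\<lambda>j. of_real (s j))"
    using carrier_matD[OF B] wtrace_maximal(1)[OF B left] off by (intro eq_matI) (auto simp: mat_diag_def s_def)
  moreover have "A = U * B * qadjoint V"
  proof -
    have "U * B * qadjoint V = U * (qadjoint U * (A * (V * qadjoint V)))"
      unfolding B_def by (simp add: assoc_mult_mat[of _ n n _ n _ n])
    also have "\<dots> = A"
      using V by (subst qunitary_cancel[OF U, of _ n]) (simp_all add: qunitary_def right_mult_one_mat[OF A])
    finally show ?thesis ..
  qed
  ultimately show ?thesis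
    unfolding quat_svd_def Let_def carrier_matD[OF A] using U V
    by (intro exI[of _ U] exI[of _ s] exI[of _ V]) (auto simp: s_def)
qed

section \<open>The quaternionic determinant of a matrix with three rows\<close>

text \<open>Over the quaternions the trace itself is not cyclic, but its real part is.\<close>

definition retr :: "quat mat \<Rightarrow> real" where
  "retr M = (\<Sum>i<dim_row M. qRe (M $$ (i, i)))"

lemma retr_mult_commute:
  assumes "X \<in> carrier_mat n n" "Y \<in> carrier_mat n n"
  shows "retr (X * Y) = retr (Y * X)"
proof -
  have "retr (X * Y) = (\<Sum>i<n. \<Sum>l<n. qRe (X $$ (i, l) * Y $$ (l, i)))"
    using assms by (auto simp: retr_def mat_mult_index[of X n n Y n] qRe_sum simp del: index_mult_mat(1) intro!: sum.cong)
  also have "\<dots> = (\<Sum>l<n. \<Sum>i<n. qRe (Y $$ (l, i) * X $$ (i, l)))"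
    by (subst sum.swap) (simp add: qRe_mult_commute)
  also have "\<dots> = retr (Y * X)"
    using assms by (auto simp: retr_def mat_mult_index[of Y n n X n] qRe_sum simp del: index_mult_mat(1) intro!: sum.cong)
  finally show ?thesis .
qed

lemma retr_conj:
  assumes U: "qunitary n U" and X: "X \<in> carrier_mat n n"
  shows "retr (U * X * qadjoint U) = retr X"
proof -
  note [simp] = qunitary_carrier[OF U] X mult_carrier_mat[of _ n n _ n]
  have "retr (U * X * qadjoint U) = retr (qadjoint U * (U * X))"
    by (intro retr_mult_commute[of _ n]) simp_all
  then show ?thesis by (simp add: qunitary_cancel[OF U X])
qed

lemma retr_mat_diag: "retr (mat_diag n (\<lambda>j. of_real (d j))) = (\<Sum>j<n. d j)"
  by (simp add: retr_def mat_diag_def)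

lemma retr_gram_powers:
  assumes A: "A \<in> carrier_mat n n" and svd: "quat_svd A U s V"
  defines "H \<equiv> A * qadjoint A"
  shows "retr H = (\<Sum>j<n. (s j)\<^sup>2)"
    and "retr (H * H) = (\<Sum>j<n. ((s j)\<^sup>2) ^ 2)"
    and "retr (H * H * H) = (\<Sum>j<n. ((s j)\<^sup>2) ^ 3)"
proof -
  define S where "S = (mat_diag n (\<lambda>j. of_real (s j)) :: quat mat)"
  define E where "E = (mat_diag n (\<lambda>j. of_real ((s j)\<^sup>2)) :: quat mat)"
  have U: "qunitary n U" and V: "qunitary n V" and As: "A = U * S * qadjoint V"
    using A svd by (auto simp: quat_svd_def S_def Let_def)
  have [simp]: "S \<in> carrier_mat n n" "E \<in> carrier_mat n n" by (simp_all add: S_def E_def)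
  note [simp] = qunitary_carrier[OF U] qunitary_carrier[OF V] A mult_carrier_mat[of _ n n _ n]
  have Sadj: "qadjoint S = S" by (simp add: S_def qadjoint_mat_diag)
  have SS: "S * S = E" by (simp add: S_def E_def power2_eq_square)
  have "qadjoint A = V * (S * qadjoint U)"
    unfolding As by (simp add: qadjoint_mult[of _ n n _ n] Sadj assoc_mult_mat[of _ n n _ n _ n])
  then have "H = U * (S * (qadjoint V * (V * (S * qadjoint U))))"
    unfolding H_def As by (simp add: assoc_mult_mat[of _ n n _ n _ n])
  also have "qadjoint V * (V * (S * qadjoint U)) = S * qadjoint U"
    by (rule qunitary_cancel[OF V, of _ n]) simp
  also have "U * (S * (S * qadjoint U)) = U * E * qadjoint U"
    by (simp add: assoc_mult_mat[of _ n n _ n _ n] SS[symmetric])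
  finally have H: "H = U * E * qadjoint U" .
  have step: "(U * X * qadjoint U) * (U * Y * qadjoint U) = U * (X * Y) * qadjoint U"
    if "X \<in> carrier_mat n n" "Y \<in> carrier_mat n n" for X Y
  proof -
    have "(U * X * qadjoint U) * (U * Y * qadjoint U) = U * (X * (qadjoint U * (U * (Y * qadjoint U))))"
      using that by (simp add: assoc_mult_mat[of _ n n _ n _ n])
    also have "qadjoint U * (U * (Y * qadjoint U)) = Y * qadjoint U"
      using that by (intro qunitary_cancel[OF U, of _ n]) simp
    finally show ?thesis using that by (simp add: assoc_mult_mat[of _ n n _ n _ n])
  qed
  have E2: "E * E = mat_diag n (\<lambda>j. of_real (((s j)\<^sup>2) ^ 2))"
    and E3: "E * E * E = mat_diag n (\<lambda>j. of_real (((s j)\<^sup>2) ^ 3))"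
    by (simp_all add: E_def power2_eq_square power3_eq_cube)
  show "retr H = (\<Sum>j<n. (s j)\<^sup>2)"
    unfolding H retr_conj[OF U \<open>E \<in> carrier_mat n n\<close>] unfolding E_def by (rule retr_mat_diag)
  show "retr (H * H) = (\<Sum>j<n. ((s j)\<^sup>2) ^ 2)"
    unfolding H step[OF \<open>E \<in> carrier_mat n n\<close> \<open>E \<in> carrier_mat n n\<close>]
    by (subst retr_conj[OF U]) (simp_all only: E2 retr_mat_diag mat_diag_dim)
  show "retr (H * H * H) = (\<Sum>j<n. ((s j)\<^sup>2) ^ 3)"
    unfolding H by (simp only: step \<open>E \<in> carrier_mat n n\<close> mult_carrier_mat[of _ n n _ n])
      (subst retr_conj[OF U]; simp only: E3 retr_mat_diag mat_diag_dim)
qed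

text \<open>The Moore determinant of the Hermitian quaternionic matrix with diagonal \<open>p\<close>, \<open>q\<close>, \<open>r\<close> and entries
  \<open>x\<close>, \<open>y\<close>, \<open>z\<close> above it, in the order \<open>(0, 1)\<close>, \<open>(0, 2)\<close>, \<open>(1, 2)\<close>.\<close>

definition moore3 :: "real \<Rightarrow> real \<Rightarrow> real \<Rightarrow> quat \<Rightarrow> quat \<Rightarrow> quat \<Rightarrow> real" where
  "moore3 p q r x y z = p * q * r - p * (norm z)\<^sup>2 - q * (norm y)\<^sup>2 - r * (norm x)\<^sup>2 + 2 * qRe (x * z * qcnj y)"

text \<open>Newton's identity for the third elementary symmetric function of the eigenvalues.\<close>

lemma newton_moore3:
  assumes H: "H \<in> carrier_mat 3 3"
    and h: "H $$ (0, 0) = of_real p" "H $$ (1, 1) = of_real q" "H $$ (2, 2) = of_real r"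
      "H $$ (0, 1) = x" "H $$ (1, 0) = qcnj x" "H $$ (0, 2) = y" "H $$ (2, 0) = qcnj y"
      "H $$ (1, 2) = z" "H $$ (2, 1) = qcnj z"
  shows "6 * moore3 p q r x y z = retr H ^ 3 - 3 * retr H * retr (H * H) + 2 * retr (H * H * H)"
proof -
  note h = h h[unfolded One_nat_def]
  have [simp]: "H * H \<in> carrier_mat 3 3" using H by (intro mult_carrier_mat[of _ 3 3 _ 3])
  have HH: "(H * H) $$ (i, j) = (\<Sum>l<3. H $$ (i, l) * H $$ (l, j))" if "i < 3" "j < 3" for i j
    using that by (rule mat_mult_index[OF H H])
  have t1: "retr H = p + q + r"
    using H by (simp add: retr_def lessThan_3 h)
  have nsq: "(norm w)\<^sup>2 = (qRe w)\<^sup>2 + (qI w)\<^sup>2 + (qJ w)\<^sup>2 + (qK w)\<^sup>2" for w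
    unfolding power2_norm_eq_inner by (simp add: inner_quat_def power2_eq_square)
  have t2: "retr (H * H) = p\<^sup>2 + q\<^sup>2 + r\<^sup>2 + 2 * ((norm x)\<^sup>2 + (norm y)\<^sup>2 + (norm z)\<^sup>2)"
  proof -
    have "retr (H * H) = (\<Sum>i<3. \<Sum>l<3. qRe (H $$ (i, l) * H $$ (l, i)))"
      using H by (simp add: retr_def HH qRe_sum del: index_mult_mat(1))
    also have "\<dots> = p\<^sup>2 + q\<^sup>2 + r\<^sup>2 + 2 * ((norm x)\<^sup>2 + (norm y)\<^sup>2 + (norm z)\<^sup>2)"
      by (simp add: lessThan_3 h quat_mult_qcnj qcnj_mult_self)
        (simp add: quat_of_real times_quat_def power2_eq_square)
    finally show ?thesis .
  qed
  have t3: "retr (H * H * H) = p ^ 3 + q ^ 3 + r ^ 3 + 3 * p * ((norm x)\<^sup>2 + (norm y)\<^sup>2)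
     + 3 * q * ((norm x)\<^sup>2 + (norm z)\<^sup>2) + 3 * r * ((norm y)\<^sup>2 + (norm z)\<^sup>2) + 6 * qRe (x * z * qcnj y)"
  proof -
    have HHH: "(H * H * H) $$ (i, j) = (\<Sum>l<3. (\<Sum>k<3. H $$ (i, k) * H $$ (k, l)) * H $$ (l, j))" if "i < 3" "j < 3" for i j
    proof -
      have "(H * H * H) $$ (i, j) = (\<Sum>l<3. (H * H) $$ (i, l) * H $$ (l, j))"
        using that by (intro mat_mult_index[of _ 3 3 _ 3] H) simp_all
      then show ?thesis using that by (simp add: HH del: index_mult_mat(1))
    qed
    have "retr (H * H * H) = (\<Sum>i<3. qRe ((H * H * H) $$ (i, i)))"
      by (simp only: retr_def index_mult_mat(2) carrier_matD[OF H])
    also have "\<dots> = (\<Sum>i<3. qRe (\<Sum>l<3. (\<Sum>k<3. H $$ (i, k) * H $$ (k, l)) * H $$ (l, i)))"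
      by (intro sum.cong refl) (simp only: HHH lessThan_iff)
    also have "\<dots> = p ^ 3 + q ^ 3 + r ^ 3 + 3 * p * ((norm x)\<^sup>2 + (norm y)\<^sup>2)
     + 3 * q * ((norm x)\<^sup>2 + (norm z)\<^sup>2) + 3 * r * ((norm y)\<^sup>2 + (norm z)\<^sup>2) + 6 * qRe (x * z * qcnj y)"
      unfolding nsq
      by (simp add: lessThan_3 h) (simp add: quat_of_real times_quat_def plus_quat_def qcnj_def power2_eq_square power3_eq_cube algebra_simps)
    finally show ?thesis .
  qed
  show ?thesis
    unfolding t1 t2 t3 moore3_def by (simp add: power2_eq_square power3_eq_cube algebra_simps)
qed

definition row_inner :: "(nat \<Rightarrow> quat) \<Rightarrow> (nat \<Rightarrow> quat) \<Rightarrow> quat" where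
  "row_inner a b = (\<Sum>k<3. a k * qcnj (b k))"

definition row_sq :: "(nat \<Rightarrow> quat) \<Rightarrow> real" where
  "row_sq a = (\<Sum>k<3. (norm (a k))\<^sup>2)"

definition gram_det3 :: "(nat \<Rightarrow> quat) \<Rightarrow> (nat \<Rightarrow> quat) \<Rightarrow> (nat \<Rightarrow> quat) \<Rightarrow> real" where
  "gram_det3 a b c = moore3 (row_sq a) (row_sq b) (row_sq c) (row_inner a b) (row_inner a c) (row_inner b c)"

definition mat_of_3rows :: "(nat \<Rightarrow> quat) \<Rightarrow> (nat \<Rightarrow> quat) \<Rightarrow> (nat \<Rightarrow> quat) \<Rightarrow> quat mat" where
  "mat_of_3rows a b c = Matrix.mat 3 3 (\<lambda>(i, j). if i = 0 then a j else if i = 1 then b j else c j)"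

lemma mat_of_3rows_carrier [simp]: "mat_of_3rows a b c \<in> carrier_mat 3 3"
  by (simp add: mat_of_3rows_def)

lemma qcnj_row_inner: "qcnj (row_inner a b) = row_inner b a"
  by (simp add: row_inner_def qcnj_sum qcnj_mult)

lemma row_inner_self: "row_inner a a = of_real (row_sq a)"
  by (simp add: row_inner_def row_sq_def quat_mult_qcnj)

text \<open>The traces of the powers of the Gram matrix are the power sums of the squared singular values, for
  every decomposition. This gives the uniqueness of the product of the singular values along with its value.\<close>

lemma gram_det3_eq_prod:
  assumes svd: "quat_svd (mat_of_3rows a b c) U s V"
  shows "gram_det3 a b c = (\<Prod>j<3. s j)\<^sup>2"
proof -
  let ?A = "mat_of_3rows a b c"
  let ?H = "?A * qadjoint ?A"
  have H: "?H \<in> carrier_mat 3 3" by (intro mult_carrier_mat[of _ 3 3 _ 3]) simp_all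
  have idx: "?H $$ (i, j) = (\<Sum>k<3. ?A $$ (i, k) * qcnj (?A $$ (j, k)))" if "i < 3" "j < 3" for i j
    using that by (subst mat_mult_index[of _ 3 3 _ 3]) (auto simp: carrier_matD[OF mat_of_3rows_carrier] intro!: sum.cong)
  have "6 * gram_det3 a b c = retr ?H ^ 3 - 3 * retr ?H * retr (?H * ?H) + 2 * retr (?H * ?H * ?H)"
    unfolding gram_det3_def
    by (rule newton_moore3[OF H])
       (simp_all add: idx row_inner_self[symmetric] qcnj_row_inner del: index_mult_mat(1), simp_all add: mat_of_3rows_def row_inner_def)
  also have "\<dots> = 6 * (\<Prod>j<3. s j)\<^sup>2"
    unfolding retr_gram_powers[OF mat_of_3rows_carrier svd]
    by (simp add: lessThan_3 power2_eq_square power3_eq_cube algebra_simps)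
  finally show ?thesis by simp
qed

lemma gram_det3_nonneg: "0 \<le> gram_det3 a b c"
  using quat_svd_exists[OF mat_of_3rows_carrier] gram_det3_eq_prod by (metis zero_le_power2)

lemma Sdet_mat_of_3rows: "(Sdet (mat_of_3rows a b c))\<^sup>2 = gram_det3 a b c"
proof -
  let ?A = "mat_of_3rows a b c"
  have dim: "dim_row ?A = 3" by (simp add: mat_of_3rows_def)
  have val: "(\<Prod>j<3. s j) = sqrt (gram_det3 a b c)" if "quat_svd ?A U s V" for U s V
  proof -
    have "0 \<le> (\<Prod>j<3. s j)"
      using that dim by (intro prod_nonneg) (auto simp: quat_svd_def Let_def)
    then show ?thesis using gram_det3_eq_prod[OF that] by simp
  qed
  have "Sdet ?A = sqrt (gram_det3 a b c)"
    unfolding Sdet_def dim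
  proof (rule the_equality)
    show "\<exists>U s V. quat_svd ?A U s V \<and> sqrt (gram_det3 a b c) = (\<Prod>j<3. s j)"
      using quat_svd_exists[OF mat_of_3rows_carrier[of a b c]] val by metis
  qed (use val in auto)
  then show ?thesis using gram_det3_nonneg by simp
qed

lemma sum_qcnj_mult_self: "(\<Sum>k\<in>K. qcnj (v k) * v k) = of_real (\<Sum>k\<in>K. (norm (v k))\<^sup>2)"
  by (simp add: qcnj_mult_self)

text \<open>A null vector of the matrix yields a null vector of the diagonal factor, so some singular value is
  zero.\<close>

lemma gram_det3_eq_0_of_null:
  assumes null: "(\<Sum>k<3. a k * v k) = 0" "(\<Sum>k<3. b k * v k) = 0" "(\<Sum>k<3. c k * v k) = 0"
    and v: "(\<Sum>k<3. (norm (v k))\<^sup>2) \<noteq> 0"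
  shows "gram_det3 a b c = 0"
proof -
  let ?A = "mat_of_3rows a b c"
  define w where "w = Matrix.mat 3 1 (\<lambda>(i, j). v i)"
  obtain U s V where svd: "quat_svd ?A U s V" using quat_svd_exists[OF mat_of_3rows_carrier] by blast
  define S where "S = (mat_diag 3 (\<lambda>j. of_real (s j)) :: quat mat)"
  have U: "qunitary 3 U" and V: "qunitary 3 V" and As: "?A = U * S * qadjoint V"
    using svd by (auto simp: quat_svd_def S_def Let_def mat_of_3rows_def)
  note [simp del] = One_nat_def
  have [simp]: "w \<in> carrier_mat 3 1" "S \<in> carrier_mat 3 3" by (simp_all add: w_def S_def)
  note [simp] = qunitary_carrier[OF U] qunitary_carrier[OF V] mult_carrier_mat[of _ 3 3 _ 1] mult_carrier_mat[of _ 3 3 _ 3]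
  have "?A * w = 0\<^sub>m 3 1"
  proof (rule eq_matI)
    fix i j assume "i < dim_row (0\<^sub>m 3 1 :: quat mat)" "j < dim_col (0\<^sub>m 3 1 :: quat mat)"
    then have "i < 3" "j = 0" by auto
    then have "(?A * w) $$ (i, j) = (\<Sum>k<3. ?A $$ (i, k) * v k)"
      by (subst mat_mult_index[of _ 3 3 _ 1]) (auto simp: w_def)
    also have "\<dots> = 0"
      using \<open>i < 3\<close> null by (cases "i = 0"; cases "i = 1") (simp_all add: mat_of_3rows_def)
    finally show "(?A * w) $$ (i, j) = 0\<^sub>m 3 1 $$ (i, j)" using \<open>i < 3\<close> \<open>j = 0\<close> by simp
  qed (auto simp: mat_of_3rows_def w_def)
  define y where "y = qadjoint V * w"
  have y [simp]: "y \<in> carrier_mat 3 1" by (simp add: y_def)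
  have "S * y = qadjoint U * (U * (S * y))"
    by (rule qunitary_cancel(2)[OF U, symmetric, of _ 1]) simp
  also have "U * (S * y) = ?A * w"
    unfolding As y_def by (simp add: assoc_mult_mat[of _ 3 3 _ 3 _ 1] assoc_mult_mat[of _ 3 3 _ 3 _ 3])
  also have "qadjoint U * (?A * w) = 0\<^sub>m 3 1"
    unfolding \<open>?A * w = 0\<^sub>m 3 1\<close> by (intro right_mult_zero_mat) simp
  finally have Sy: "S * y = 0\<^sub>m 3 1" .
  have "\<exists>j<3. s j = 0"
  proof (rule ccontr)
    assume nz: "\<not> (\<exists>j<3. s j = 0)"
    have "y = 0\<^sub>m 3 1"
    proof (rule eq_matI)
      fix i j assume "i < dim_row (0\<^sub>m 3 1 :: quat mat)" "j < dim_col (0\<^sub>m 3 1 :: quat mat)"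
      then have ij: "i < 3" "j = 0" by auto
      have "(S * y) $$ (i, j) = of_real (s i) * y $$ (i, j)"
        unfolding S_def mat_diag_mult_left[OF y] using ij by simp
      then have "s i *\<^sub>R y $$ (i, j) = 0" using Sy ij by (simp add: quat_mult_of_real)
      then show "y $$ (i, j) = 0\<^sub>m 3 1 $$ (i, j)" using nz ij by auto
    qed (use carrier_matD[OF y] in auto)
    have "w = V * y" unfolding y_def by (rule qunitary_cancel(1)[OF V, symmetric, of _ 1]) simp
    also have "\<dots> = 0\<^sub>m 3 1" unfolding \<open>y = 0\<^sub>m 3 1\<close> by (intro right_mult_zero_mat) simp
    finally have "w $$ (k, 0) = 0" if "k < 3" for k using that by simp
    then have "v k = 0" if "k < 3" for k using that by (simp add: w_def)
    then show False using v by simp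
  qed
  then show ?thesis
    unfolding gram_det3_eq_prod[OF svd] by auto
qed

text \<open>Completed by a zero row, the matrix is singular; the column of \<open>V\<close> that belongs to a vanishing singular
  value is the required vector.\<close>

lemma null_vector_exists:
  fixes a b :: "nat \<Rightarrow> quat"
  obtains v where "(\<Sum>k<3. a k * v k) = 0" "(\<Sum>k<3. b k * v k) = 0" "(\<Sum>k<3. (norm (v k :: quat))\<^sup>2) = 1"
proof -
  let ?A = "mat_of_3rows a b (\<lambda>_. 0)"
  obtain U s V where svd: "quat_svd ?A U s V" using quat_svd_exists[OF mat_of_3rows_carrier] by blast
  define S where "S = (mat_diag 3 (\<lambda>j. of_real (s j)) :: quat mat)"
  have U: "qunitary 3 U" and V: "qunitary 3 V" and As: "?A = U * S * qadjoint V"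
    using svd by (auto simp: quat_svd_def S_def Let_def mat_of_3rows_def)
  have [simp]: "S \<in> carrier_mat 3 3" by (simp add: S_def)
  note [simp] = qunitary_carrier[OF U] qunitary_carrier[OF V] mult_carrier_mat[of _ 3 3 _ 3]
  have "gram_det3 a b (\<lambda>_. 0) = 0"
    by (simp add: gram_det3_def moore3_def row_sq_def row_inner_def)
  then have "(\<Prod>j<3. s j) = 0" using gram_det3_eq_prod[OF svd] by simp
  then obtain j where j: "j < 3" "s j = 0" by auto
  have "?A * V = U * (S * (qadjoint V * V))"
    unfolding As by (simp add: assoc_mult_mat[of _ 3 3 _ 3 _ 3])
  also have "\<dots> = U * S" using V by (simp add: qunitary_def right_mult_one_mat[of S 3 3])
  finally have AV: "?A * V = U * S" .
  have null: "(\<Sum>k<3. ?A $$ (i, k) * V $$ (k, j)) = 0" if i: "i < 3" for i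
  proof -
    have "(\<Sum>k<3. ?A $$ (i, k) * V $$ (k, j)) = (?A * V) $$ (i, j)"
      using i j by (subst mat_mult_index[of _ 3 3 _ 3]) auto
    also have "\<dots> = U $$ (i, j) * of_real (s j)"
      unfolding AV S_def mat_diag_mult_right[OF qunitary_carrier[OF U]] using i j by simp
    finally show ?thesis using j by simp
  qed
  have "(qadjoint V * V) $$ (j, j) = (\<Sum>k<3. qcnj (V $$ (k, j)) * V $$ (k, j))"
    using j carrier_matD[OF qunitary_carrier[OF V]] by (subst mat_mult_index[of _ 3 3 _ 3]) (auto intro!: sum.cong)
  also have "\<dots> = of_real (\<Sum>k<3. (norm (V $$ (k, j)))\<^sup>2)" by (simp add: qcnj_mult_self)
  finally have "of_real (\<Sum>k<3. (norm (V $$ (k, j)))\<^sup>2) = (of_real 1 :: quat)"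
    using V j by (simp add: qunitary_def)
  then have "(\<Sum>k<3. (norm (V $$ (k, j)))\<^sup>2) = 1" by (subst (asm) of_real_eq_iff)
  then show ?thesis
    using null[of 0] null[of 1] by (intro that[of "\<lambda>k. V $$ (k, j)"]) (auto simp: mat_of_3rows_def)
qed

text \<open>Split \<open>c\<close> into its component along the conjugate of \<open>v\<close> and the rest \<open>c'\<close>. The component is orthogonal to
  \<open>a\<close> and \<open>b\<close>, hence only contributes to the squared length of the third row, and \<open>a\<close>, \<open>b\<close>, \<open>c'\<close> have the
  common null vector \<open>v\<close>.\<close>

lemma gram_det3_third_row:
  assumes null: "(\<Sum>k<3. a k * v k) = 0" "(\<Sum>k<3. b k * v k) = 0" and v: "(\<Sum>k<3. (norm (v k))\<^sup>2) = 1"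
  shows "gram_det3 a b c = (row_sq a * row_sq b - (norm (row_inner a b))\<^sup>2) * (norm (\<Sum>k<3. c k * v k))\<^sup>2"
proof -
  define l where "l = (\<Sum>k<3. c k * v k)"
  define c' where "c' = (\<lambda>k. c k - l * qcnj (v k))"
  have c: "c k = c' k + l * qcnj (v k)" for k by (simp add: c'_def)
  have vv: "(\<Sum>k<3. qcnj (v k) * v k) = 1"
    unfolding sum_qcnj_mult_self v by simp
  have "(\<Sum>k<3. c' k * v k) = l - (\<Sum>k<3. l * (qcnj (v k) * v k))"
    by (simp add: c'_def l_def left_diff_distrib sum_subtractf mult.assoc)
  also have "\<dots> = 0" by (simp only: sum_distrib_left[symmetric] vv) simp
  finally have c'v: "(\<Sum>k<3. c' k * v k) = 0" .
  have orth: "row_inner d c = row_inner d c'" if "(\<Sum>k<3. d k * v k) = 0" for d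
  proof -
    have "row_inner d c = row_inner d c' + (\<Sum>k<3. d k * v k * qcnj l)"
      by (simp add: row_inner_def c qcnj_add qcnj_mult distrib_left sum.distrib mult.assoc)
    also have "(\<Sum>k<3. d k * v k * qcnj l) = 0"
      by (simp only: sum_distrib_right[symmetric] that) simp
    finally show ?thesis by simp
  qed
  have "row_inner c c = row_inner c c'  + l * qcnj l"
  proof -
    have "row_inner c c = row_inner c c' + (\<Sum>k<3. c k * v k * qcnj l)"
      unfolding row_inner_def
      by (subst (2) c) (simp add: qcnj_add qcnj_mult distrib_left sum.distrib mult.assoc)
    then show ?thesis by (simp only: sum_distrib_right[symmetric] l_def)
  qed
  also have "row_inner c c' = qcnj (row_inner c' c)" by (simp add: qcnj_row_inner)
  also have "row_inner c' c = row_inner c' c'" by (rule orth[OF c'v])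
  finally have "of_real (row_sq c) = (of_real (row_sq c' + (norm l)\<^sup>2) :: quat)"
    by (simp add: row_inner_self quat_mult_qcnj qcnj_row_inner)
  then have sq: "row_sq c = row_sq c' + (norm l)\<^sup>2" by (subst (asm) of_real_eq_iff)
  have "gram_det3 a b c = gram_det3 a b c' + (row_sq a * row_sq b - (norm (row_inner a b))\<^sup>2) * (norm l)\<^sup>2"
    unfolding gram_det3_def orth[OF null(1)] orth[OF null(2)] sq moore3_def by (simp add: algebra_simps)
  also have "gram_det3 a b c' = 0"
    using null c'v v by (intro gram_det3_eq_0_of_null[of a v b c']) auto
  finally show ?thesis by (simp add: l_def)
qed

text \<open>The unit null vector is scaled by the square root of the Gram determinant of \<open>a\<close> and \<open>b\<close>, which is
  nonnegative as the value of \<open>gram_det3\<close> at the conjugate of that null vector.\<close>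

lemma gram_det3_conormal:
  "\<exists>v. (\<forall>c. gram_det3 a b c = (norm (\<Sum>k<3. c k * v k))\<^sup>2) \<and>
    (\<Sum>k<3. (norm (v k))\<^sup>2) = row_sq a * row_sq b - (norm (row_inner a b))\<^sup>2"
proof -
  obtain v where v: "(\<Sum>k<3. a k * v k) = 0" "(\<Sum>k<3. b k * v k) = 0" "(\<Sum>k<3. (norm (v k :: quat))\<^sup>2) = 1"
    by (rule null_vector_exists)
  let ?G = "row_sq a * row_sq b - (norm (row_inner a b))\<^sup>2"
  note third = gram_det3_third_row[OF v]
  have "(\<Sum>k<3. qcnj (v k) * v k) = 1"
    unfolding sum_qcnj_mult_self v(3) by simp
  then have "?G = gram_det3 a b (\<lambda>k. qcnj (v k))" by (simp add: third)
  then have G: "0 \<le> ?G" using gram_det3_nonneg by simp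
  show ?thesis
  proof (intro exI conjI allI)
    show "gram_det3 a b c = (norm (\<Sum>k<3. c k * (sqrt ?G *\<^sub>R v k)))\<^sup>2" for c
      using G by (simp add: third[of c] scaleR_sum_right[symmetric] power_mult_distrib)
    show "(\<Sum>k<3. (norm (sqrt ?G *\<^sub>R v k))\<^sup>2) = ?G"
      using G v(3) by (simp add: power_mult_distrib sum_distrib_left[symmetric])
  qed
qed

section \<open>Quaternionic Gaussian matrices\<close>

lemma distr_gauss_quat_unit:
  fixes u :: quat assumes "u \<in> Basis"
  shows "distr gauss borel (\<lambda>x. u * x) = (gauss :: quat measure)"
proof -
  let ?e = "Quat 1 0 0 0" and ?i = "Quat 0 1 0 0" and ?j = "Quat 0 0 1 0" and ?k = "Quat 0 0 0 1"
  note defs = Basis_quat_def bij_betw_def inj_on_def inner_quat_def times_quat_def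
  consider "u = ?e" | "u = ?i" | "u = ?j" | "u = ?k"
    using assms by (auto simp: Basis_quat_def)
  then show ?thesis
  proof cases
    case 1
    then show ?thesis
      by (intro distr_gauss_signed_permutation[of id "\<lambda>_. 1"]) (auto simp: defs)
  next
    case 2
    then show ?thesis
      by (intro distr_gauss_signed_permutation[of
          "\<lambda>b. if b = ?e then ?i else if b = ?i then ?e else if b = ?j then ?k else ?j"
          "\<lambda>b. if b = ?e \<or> b = ?j then -1 else 1"]) (auto simp: defs)
  next
    case 3
    then show ?thesis
      by (intro distr_gauss_signed_permutation[of
          "\<lambda>b. if b = ?e then ?j else if b = ?j then ?e else if b = ?i then ?k else ?i"
          "\<lambda>b. if b = ?e \<or> b = ?k then -1 else 1"]) (auto simp: defs)
  next
    case 4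
    then show ?thesis
      by (intro distr_gauss_signed_permutation[of
          "\<lambda>b. if b = ?e then ?k else if b = ?k then ?e else if b = ?i then ?j else ?i"
          "\<lambda>b. if b = ?e \<or> b = ?i then -1 else 1"]) (auto simp: defs)
  qed
qed

lemma sum_Basis_quat_conj: "(\<Sum>u\<in>Basis. (u * w * qcnj u) \<bullet> q) = 4 * (qRe w * qRe q)"
  by (simp add: Basis_quat_def inner_quat_def times_quat_def qcnj_def algebra_simps)

lemma conj_algebra_quat: "conj_algebra qcnj"
proof
  fix c x y :: quat
  have "qRe (c * (x * y) * qcnj c) = (norm c)\<^sup>2 * qRe (x * y)"
  proof -
    have "qRe (c * (x * y) * qcnj c) = qRe (x * y * (qcnj c * c))"
      using qRe_mult_commute[of c "x * y * qcnj c"] by (simp only: mult.assoc)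
    then show ?thesis by (simp only: qcnj_mult_self quat_mult_of_real qRe_scaleR)
  qed
  moreover have "(\<Sum>u\<in>Basis. (u * c * (x * y) * qcnj (u * c)) \<bullet> (y * x)) = 4 * (qRe (c * (x * y) * qcnj c) * qRe (y * x))"
    unfolding sum_Basis_quat_conj[symmetric] by (simp add: qcnj_mult mult.assoc)
  ultimately show "0 \<le> (\<Sum>u\<in>Basis. (u * c * (x * y) * qcnj (u * c)) \<bullet> (y * x))"
    by (simp add: qRe_mult_commute[of y x] mult.assoc)
qed (rule norm_quat_mult norm_qcnj inner_quat_mult_left inner_quat_mult_right qcnj_mult qcnj_qcnj
  distr_gauss_quat_unit | assumption)+

lemma (in conj_algebra) gram_det2_eq:
  "gram_det2 f = (\<Sum>k<3. (norm (f (0, k)))\<^sup>2) * (\<Sum>k<3. (norm (f (1, k)))\<^sup>2) - (norm (\<Sum>k<3. f (0, k) * cj (f (1, k))))\<^sup>2"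
proof -
  have sq: "(norm (p + q + r))\<^sup>2 = (norm p)\<^sup>2 + (norm q)\<^sup>2 + (norm r)\<^sup>2 + 2 * (p \<bullet> q + p \<bullet> r + q \<bullet> r)" for p q r :: 'a
    by (simp add: power2_norm_eq_inner inner_add_left inner_add_right inner_commute)
  have "(\<Sum>k<3. f (0, k) * cj (f (1, k))) = f (0, 0) * cj (f (1, 0)) + f (0, 1) * cj (f (1, 1)) + f (0, 2) * cj (f (1, 2))"
    by (simp add: lessThan_3 add.assoc)
  then show ?thesis
    by (simp only: sq) (simp add: gram_det2_def split_sq_def cross_gram_def lessThan_3 norm_times norm_cj power_mult_distrib insert_Diff_if algebra_simps)
qed

lemma borel_measurable_qcnj [measurable]: "qcnj \<in> borel_measurable borel"
  by (intro borel_measurable_continuous_onI continuous_on_qcnj continuous_on_id)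

lemma borel_measurable_qRe [measurable]: "qRe \<in> borel_measurable borel"
  by (intro borel_measurable_continuous_onI continuous_on_qRe continuous_on_id)

theorem Sdet_orders_fail:
  fixes A :: "'w \<Rightarrow> quat mat"
  assumes "prob_space M" "gaussian_matrix M 3 A"
  shows "\<not> st_le M (Delta_var_quat 3 A) (X_var 3 A) \<and> \<not> st_le M (X_var 3 A) (Delta_var_quat 3 A) \<and> \<not> cx_le M (X_var 3 A) (Delta_var_quat 3 A)"
proof -
  interpret conj_algebra qcnj by (rule conj_algebra_quat)
  define D where "D = (\<lambda>B. (Sdet B)\<^sup>2)"
  have \<Delta>: "Delta_var_quat 3 A = (\<lambda>\<omega>. D (A \<omega>) / 6)"
    by (simp add: fun_eq_iff Delta_var_quat_def D_def fact_numeral)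
  have Dg: "D (Matrix.mat 3 3 g) = gram_det3 (\<lambda>k. g (0, k)) (\<lambda>k. g (1, k)) (\<lambda>k. g (2, k))" for g
  proof -
    have "Matrix.mat 3 3 g = mat_of_3rows (\<lambda>k. g (0, k)) (\<lambda>k. g (1, k)) (\<lambda>k. g (2, k))"
    proof (rule eq_matI)
      fix i j assume "i < dim_row (mat_of_3rows (\<lambda>k. g (0, k)) (\<lambda>k. g (1, k)) (\<lambda>k. g (2, k)))"
        "j < dim_col (mat_of_3rows (\<lambda>k. g (0, k)) (\<lambda>k. g (1, k)) (\<lambda>k. g (2, k)))"
      then have "i < 3" "j < 3" by (auto simp: mat_of_3rows_def)
      moreover from \<open>i < 3\<close> have "i = 0 \<or> i = 1 \<or> i = 2" by auto
      ultimately show "Matrix.mat 3 3 g $$ (i, j) = mat_of_3rows (\<lambda>k. g (0, k)) (\<lambda>k. g (1, k)) (\<lambda>k. g (2, k)) $$ (i, j)"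
        by (auto simp: mat_of_3rows_def)
    qed (auto simp: mat_of_3rows_def)
    then show ?thesis by (simp add: D_def Sdet_mat_of_3rows)
  qed
  show ?thesis
    unfolding \<Delta>
  proof (rule stochastic_orders_fail[OF assms])
    show "(\<lambda>f. D (Matrix.mat 3 3 f)) \<in> borel_measurable (PiM ({0..<3} \<times> {0..<3}) (\<lambda>_. borel))"
    proof -
      have [measurable]: "(\<lambda>f. f (i, j)) \<in> measurable (PiM ({0..<3} \<times> {0..<3}) (\<lambda>_. borel)) (borel :: quat measure)"
        if "i < 3" "j < 3" for i j :: nat
        using that by (intro measurable_component_singleton) auto
      show ?thesis
        unfolding Dg gram_det3_def moore3_def row_sq_def row_inner_def by measurable
    qed
  next
    fix f :: "nat \<times> nat \<Rightarrow> quat"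
    obtain v where v: "\<And>c. gram_det3 (\<lambda>k. f (0, k)) (\<lambda>k. f (1, k)) c = (norm (\<Sum>k<3. c k * v k))\<^sup>2"
      and nv: "(\<Sum>k<3. (norm (v k))\<^sup>2) = row_sq (\<lambda>k. f (0, k)) * row_sq (\<lambda>k. f (1, k)) - (norm (row_inner (\<lambda>k. f (0, k)) (\<lambda>k. f (1, k))))\<^sup>2"
      using gram_det3_conormal[of "\<lambda>k. f (0, k)" "\<lambda>k. f (1, k)"] by auto
    have "(\<Sum>k<3. (norm (v k))\<^sup>2) = gram_det2 f"
      by (simp only: nv gram_det2_eq row_sq_def row_inner_def)
    moreover have "D (Matrix.mat 3 3 g) = (norm (\<Sum>k<3. g (2, k) * v k))\<^sup>2" if g: "\<forall>p\<in>rows2. g p = f p" for g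
    proof -
      have "row_sq (\<lambda>k. g (r, k)) = row_sq (\<lambda>k. f (r, k))"
        "row_inner (\<lambda>k. g (r, k)) c = row_inner (\<lambda>k. f (r, k)) c"
        "row_inner c (\<lambda>k. g (r, k)) = row_inner c (\<lambda>k. f (r, k))" if "r \<le> 1" for r c
        using g that by (auto simp: row_sq_def row_inner_def intro!: sum.cong)
      then have "gram_det3 (\<lambda>k. g (0, k)) (\<lambda>k. g (1, k)) (\<lambda>k. g (2, k)) = gram_det3 (\<lambda>k. f (0, k)) (\<lambda>k. f (1, k)) (\<lambda>k. g (2, k))"
        by (simp add: gram_det3_def)
      then show ?thesis by (simp only: Dg v)
    qed
    ultimately show "\<exists>v. (\<Sum>k<3. (norm (v k))\<^sup>2) = gram_det2 f \<and>
        (\<forall>g. (\<forall>p\<in>rows2. g p = f p) \<longrightarrow> D (Matrix.mat 3 3 g) = (norm (\<Sum>k<3. g (2, k) * v k))\<^sup>2)"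
      by blast
  qed (simp add: D_def)
qed

theorem mainTheorem8:
  fixes M\<^sub>R :: "'r measure" and G\<^sub>R :: "'r \<Rightarrow> real mat"
    and M\<^sub>C :: "'c measure" and G\<^sub>C :: "'c \<Rightarrow> complex mat"
    and M\<^sub>H :: "'h measure" and G\<^sub>H :: "'h \<Rightarrow> quat mat"
  assumes "prob_space M\<^sub>R" and "gaussian_matrix M\<^sub>R 3 G\<^sub>R"
    and "prob_space M\<^sub>C" and "gaussian_matrix M\<^sub>C 3 G\<^sub>C"
    and "prob_space M\<^sub>H" and "gaussian_matrix M\<^sub>H 3 G\<^sub>H"
  shows "(\<not> st_le M\<^sub>R (Delta_var 3 G\<^sub>R) (X_var 3 G\<^sub>R) \<and>
          \<not> st_le M\<^sub>R (X_var 3 G\<^sub>R) (Delta_var 3 G\<^sub>R) \<and>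
          \<not> cx_le M\<^sub>R (X_var 3 G\<^sub>R) (Delta_var 3 G\<^sub>R)) \<and>
         (\<not> st_le M\<^sub>C (Delta_var 3 G\<^sub>C) (X_var 3 G\<^sub>C) \<and>
          \<not> st_le M\<^sub>C (X_var 3 G\<^sub>C) (Delta_var 3 G\<^sub>C) \<and>
          \<not> cx_le M\<^sub>C (X_var 3 G\<^sub>C) (Delta_var 3 G\<^sub>C)) \<and>
         (\<not> st_le M\<^sub>H (Delta_var_quat 3 G\<^sub>H) (X_var 3 G\<^sub>H) \<and>
          \<not> st_le M\<^sub>H (X_var 3 G\<^sub>H) (Delta_var_quat 3 G\<^sub>H) \<and>
          \<not> cx_le M\<^sub>H (X_var 3 G\<^sub>H) (Delta_var_quat 3 G\<^sub>H))"
proof -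
  interpret R: conj_field "\<lambda>x::real. x"
    by (intro conj_field.intro conj_algebra_real)
  interpret C: conj_field cnj
    by (intro conj_field.intro conj_algebra_complex)
  show ?thesis
    using R.det_orders_fail[OF assms(1,2)] C.det_orders_fail[OF assms(3,4)] Sdet_orders_fail[OF assms(5,6)]
    by (intro conjI) blast+
qed

end
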